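(* Let $\Gamma$ be a group acting by homeomorphisms on a perfect Hausdorff space $X$. If $\Gamma\curvearrowright X$ admits a deferment system $\Delta$ such that $\Delta(U)$ is non-amenable for all open $U\subseteq X$ with $U\ne\emptyset$, then $\Gamma$ is $\ell^2$-invisible.
   Context: A space is perfect if it has no isolated points. The action of $\Gamma$ on $X$ need not be faithful. The support of a subgroup of $\Gamma$ is the set of points of $X$ moved by some element of the subgroup. Deferment system: an assignment $\Delta\colon U\mapsto\Delta(U)$ of a subgroup $\Delta(U)\le\Gamma$ to each open $U\subseteq X$ such that: (1) the support of $\Delta(U)$ is contained in $U$ for each $U$; (2) if $U\subseteq U'$ then $\Delta(U)\le\Delta(U')$; (3) $\Delta(g(U))=g\Delta(U)g^{-1}$ for all open $U$ and $g\in\Gamma$; (4) whenever $U_1,\dots,U_k$ are pairwise disjoint open sets, $\langle\Delta(U_1),\dots,\Delta(U_k)\rangle$ is the (internal) direct product $\Delta(U_1)\times\cdots\times\Delta(U_k)$. A (discrete) group $\Gamma$ is $\ell^2$-invisible if its group homology $H_i(\Gamma;\mathcal N(\Gamma))$ with coefficients in its group von Neumann algebra $\mathcal N(\Gamma)$ vanishes for all $i\ge 0$. *)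

theory Defs
  imports
    "HOL-Analysis.Analysis"
    "HOL-Algebra.Elementary_Groups"
    "HOL-Algebra.Group_Action"
    "HOL-Library.Poly_Mapping"
    "HOL-Library.Function_Algebras"
begin

section \<open>Group actions and deferment systems\<close>

definition perfect_topology :: "'x topology \<Rightarrow> bool" where
  "perfect_topology X \<longleftrightarrow> (\<forall>x\<in>topspace X. \<not> openin X {x})"

definition acts_by_homeomorphisms ::
  "('g, 'b) monoid_scheme \<Rightarrow> 'x topology \<Rightarrow> ('g \<Rightarrow> 'x \<Rightarrow> 'x) \<Rightarrow> bool" where
  "acts_by_homeomorphisms G X \<phi> \<longleftrightarrow>
     group_action G (topspace X) \<phi> \<and> (\<forall>g\<in>carrier G. homeomorphic_map X X (\<phi> g))"

text \<open>The support is the set of moved points itself; no closure is taken.\<close>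

definition support_of :: "'x set \<Rightarrow> ('g \<Rightarrow> 'x \<Rightarrow> 'x) \<Rightarrow> 'g set \<Rightarrow> 'x set" where
  "support_of E \<phi> H = {x\<in>E. \<exists>h\<in>H. \<phi> h x \<noteq> x}"

text \<open>The subgroup generated by the finite family \<open>(H i)\<^sub>i\<close> is its internal direct product.\<close>

definition internal_direct_product ::
  "('g, 'b) monoid_scheme \<Rightarrow> 'i set \<Rightarrow> ('i \<Rightarrow> 'g set) \<Rightarrow> bool" where
  "internal_direct_product G I H \<longleftrightarrow>
     (\<forall>i\<in>I. H i \<lhd> subgroup_generated G (\<Union>j\<in>I. H j) \<and>
             H i \<inter> generate G (\<Union>j\<in>I - {i}. H j) = {\<one>\<^bsub>G\<^esub>})"

text \<open>Only the values of \<open>\<Delta>\<close> on open subsets of \<open>X\<close> matter.\<close>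

definition deferment_system ::
  "('g, 'b) monoid_scheme \<Rightarrow> 'x topology \<Rightarrow> ('g \<Rightarrow> 'x \<Rightarrow> 'x) \<Rightarrow> ('x set \<Rightarrow> 'g set) \<Rightarrow> bool" where
  "deferment_system G X \<phi> \<Delta> \<longleftrightarrow>
     (\<forall>U. openin X U \<longrightarrow> subgroup (\<Delta> U) G) \<and>
     (\<forall>U. openin X U \<longrightarrow> support_of (topspace X) \<phi> (\<Delta> U) \<subseteq> U) \<and>
     (\<forall>U U'. openin X U \<and> openin X U' \<and> U \<subseteq> U' \<longrightarrow> \<Delta> U \<subseteq> \<Delta> U') \<and>
     (\<forall>U. \<forall>g\<in>carrier G. openin X U \<longrightarrow>
        \<Delta> (\<phi> g ` U) = (\<lambda>h. g \<otimes>\<^bsub>G\<^esub> h \<otimes>\<^bsub>G\<^esub> inv\<^bsub>G\<^esub> g) ` \<Delta> U) \<and>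
     (\<forall>k. \<forall>U :: nat \<Rightarrow> 'x set.
        (\<forall>i\<in>{1..k}. openin X (U i)) \<and> disjoint_family_on U {1..k} \<longrightarrow>
        internal_direct_product G {1..k} (\<lambda>i. \<Delta> (U i)))"

section \<open>Amenability of discrete groups\<close>

text \<open>There is a left-invariant, finitely additive probability measure on all subsets.\<close>

definition amenable :: "('g, 'b) monoid_scheme \<Rightarrow> bool" where
  "amenable G \<longleftrightarrow>
     (\<exists>\<mu> :: 'g set \<Rightarrow> real.
        (\<forall>A\<subseteq>carrier G. 0 \<le> \<mu> A) \<and>
        \<mu> (carrier G) = 1 \<and>
        (\<forall>A\<subseteq>carrier G. \<forall>B\<subseteq>carrier G. A \<inter> B = {} \<longrightarrow> \<mu> (A \<union> B) = \<mu> A + \<mu> B) \<and>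
        (\<forall>g\<in>carrier G. \<forall>A\<subseteq>carrier G. \<mu> (g <#\<^bsub>G\<^esub> A) = \<mu> A))"

section \<open>Group homology\<close>

text \<open>
  The coefficients form a right \<open>G\<close>-module: an additive subgroup \<open>M\<close> of a type together with
  \<open>act m g = m \<cdot> g\<close>. Tensoring \<open>M\<close> over the integral group ring with the (unnormalised) bar
  resolution of the trivial module gives in degree \<open>n\<close> the tensor product of \<open>M\<close> with the free
  abelian group on \<open>G\<^sup>n\<close>, i.e. the finitely supported functions from \<open>G\<^sup>n\<close> (lists of length \<open>n\<close>)
  to \<open>M\<close>; \<open>Poly_Mapping.single [g\<^sub>1, \<dots>, g\<^sub>n] m\<close> stands for \<open>m \<otimes> [g\<^sub>1 | \<dots> | g\<^sub>n]\<close>.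
\<close>

definition bar_chains ::
  "('g, 'b) monoid_scheme \<Rightarrow> 'm::ab_group_add set \<Rightarrow> nat \<Rightarrow> ('g list \<Rightarrow>\<^sub>0 'm) set" where
  "bar_chains G M n =
     {c. (\<forall>gs\<in>Poly_Mapping.keys c. length gs = n \<and> set gs \<subseteq> carrier G) \<and>
         (\<forall>gs. Poly_Mapping.lookup c gs \<in> M)}"

definition bar_face ::
  "('g, 'b) monoid_scheme \<Rightarrow> ('m \<Rightarrow> 'g \<Rightarrow> 'm) \<Rightarrow> nat \<Rightarrow> 'g list \<Rightarrow> 'm::ab_group_add
     \<Rightarrow> ('g list \<Rightarrow>\<^sub>0 'm)" where
  "bar_face G act i gs m =
     (if i = 0 then Poly_Mapping.single (tl gs) (act m (hd gs))
      else if i = length gs then Poly_Mapping.single (butlast gs) m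
      else Poly_Mapping.single
             (take (i - 1) gs @ (gs ! (i - 1) \<otimes>\<^bsub>G\<^esub> gs ! i) # drop (i + 1) gs) m)"

text \<open>The boundary is zero in degree \<open>0\<close>, that is, on the empty list.\<close>

definition bar_boundary ::
  "('g, 'b) monoid_scheme \<Rightarrow> ('m \<Rightarrow> 'g \<Rightarrow> 'm) \<Rightarrow> ('g list \<Rightarrow>\<^sub>0 'm::ab_group_add)
     \<Rightarrow> ('g list \<Rightarrow>\<^sub>0 'm)" where
  "bar_boundary G act c =
     (\<Sum>gs\<in>Poly_Mapping.keys c - {[]}. \<Sum>i\<le>length gs.
        (if even i then bar_face G act i gs (Poly_Mapping.lookup c gs)
         else - bar_face G act i gs (Poly_Mapping.lookup c gs)))"

definition bar_cycles ::
  "('g, 'b) monoid_scheme \<Rightarrow> 'm::ab_group_add set \<Rightarrow> ('m \<Rightarrow> 'g \<Rightarrow> 'm) \<Rightarrow> nat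
     \<Rightarrow> ('g list \<Rightarrow>\<^sub>0 'm) set" where
  "bar_cycles G M act n = {c \<in> bar_chains G M n. bar_boundary G act c = 0}"

definition bar_boundaries ::
  "('g, 'b) monoid_scheme \<Rightarrow> 'm::ab_group_add set \<Rightarrow> ('m \<Rightarrow> 'g \<Rightarrow> 'm) \<Rightarrow> nat
     \<Rightarrow> ('g list \<Rightarrow>\<^sub>0 'm) set" where
  "bar_boundaries G M act n = bar_boundary G act ` bar_chains G M (Suc n)"

definition group_homology ::
  "nat \<Rightarrow> ('g, 'b) monoid_scheme \<Rightarrow> 'm::ab_group_add set \<Rightarrow> ('m \<Rightarrow> 'g \<Rightarrow> 'm)
     \<Rightarrow> ('g list \<Rightarrow>\<^sub>0 'm) set monoid" where
  "group_homology n G M act =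
     \<lparr>carrier = bar_cycles G M act n, monoid.mult = (+), one = 0\<rparr> Mod bar_boundaries G M act n"

section \<open>The group von Neumann algebra\<close>

text \<open>Elements of \<open>\<ell>\<^sup>2(G)\<close> are functions on the whole type that vanish off the carrier.\<close>

definition ell2 :: "('g, 'b) monoid_scheme \<Rightarrow> ('g \<Rightarrow> complex) set" where
  "ell2 G = {f. (\<forall>x. x \<notin> carrier G \<longrightarrow> f x = 0) \<and>
                (\<lambda>x. (cmod (f x))\<^sup>2) summable_on carrier G}"

definition ell2_norm :: "('g, 'b) monoid_scheme \<Rightarrow> ('g \<Rightarrow> complex) \<Rightarrow> real" where
  "ell2_norm G f = sqrt (\<Sum>\<^sub>\<infinity>x\<in>carrier G. (cmod (f x))\<^sup>2)"

definition left_translation ::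
  "('g, 'b) monoid_scheme \<Rightarrow> 'g \<Rightarrow> ('g \<Rightarrow> complex) \<Rightarrow> 'g \<Rightarrow> complex" where
  "left_translation G g f = (\<lambda>x. if x \<in> carrier G then f (inv\<^bsub>G\<^esub> g \<otimes>\<^bsub>G\<^esub> x) else 0)"

text \<open>
  Bounded linear operators on \<open>\<ell>\<^sup>2(G)\<close>, extended by \<open>0\<close> to all functions, so that equality and
  pointwise addition of functions are equality and addition of operators.
\<close>

definition ell2_operators ::
  "('g, 'b) monoid_scheme \<Rightarrow> (('g \<Rightarrow> complex) \<Rightarrow> ('g \<Rightarrow> complex)) set" where
  "ell2_operators G =
     {T. (\<forall>f\<in>ell2 G. T f \<in> ell2 G) \<and>
         (\<forall>f\<in>ell2 G. \<forall>h\<in>ell2 G. T (\<lambda>x. f x + h x) = (\<lambda>x. T f x + T h x)) \<and>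
         (\<forall>a. \<forall>f\<in>ell2 G. T (\<lambda>x. a * f x) = (\<lambda>x. a * T f x)) \<and>
         (\<exists>C. \<forall>f\<in>ell2 G. ell2_norm G (T f) \<le> C * ell2_norm G f) \<and>
         (\<forall>f. f \<notin> ell2 G \<longrightarrow> T f = 0)}"

text \<open>The bounded operators on \<open>\<ell>\<^sup>2(G)\<close> that are equivariant for left translation.\<close>

definition group_von_Neumann_algebra ::
  "('g, 'b) monoid_scheme \<Rightarrow> (('g \<Rightarrow> complex) \<Rightarrow> ('g \<Rightarrow> complex)) set" where
  "group_von_Neumann_algebra G =
     {T \<in> ell2_operators G.
        \<forall>g\<in>carrier G. \<forall>f\<in>ell2 G. T (left_translation G g f) = left_translation G g (T f)}"

text \<open>
  The image of \<open>g\<close> under the ring homomorphism from the group ring to the group von Neumann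
  algebra: it sends the basis vector at \<open>x\<close> to the basis vector at \<open>x g\<^sup>-\<^sup>1\<close>, and
  \<open>g \<mapsto> right_translation G g\<close> is multiplicative.
\<close>

definition right_translation ::
  "('g, 'b) monoid_scheme \<Rightarrow> 'g \<Rightarrow> ('g \<Rightarrow> complex) \<Rightarrow> 'g \<Rightarrow> complex" where
  "right_translation G g f =
     (if f \<in> ell2 G then (\<lambda>x. if x \<in> carrier G then f (x \<otimes>\<^bsub>G\<^esub> g) else 0) else 0)"

definition ell2_invisible :: "('g, 'b) monoid_scheme \<Rightarrow> bool" where
  "ell2_invisible G \<longleftrightarrow>
     (\<forall>i. trivial_group
            (group_homology i G (group_von_Neumann_algebra G) (\<lambda>T g. T \<circ> right_translation G g)))"

end

theory Submission
  imports Defs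
begin

text \<open>
  Let \<open>N\<close> be the group von Neumann algebra. If a subgroup \<open>H\<close> is non-amenable, some averaging
  operator over a finite \<open>S \<subseteq> H\<close> has norm less than \<open>1\<close> on \<open>\<ell>\<^sup>2(G)\<close>. A Neumann series then gives an
  additive map \<open>T\<close> of \<open>N\<close> with \<open>m = (\<Sum>s\<in>S. T m \<cdot> s - T m)\<close>, which commutes with the action of every
  element centralising \<open>H\<close>. So \<open>H\<^sub>0\<close> vanishes in a way that is natural with respect to the centraliser.

  Let \<open>V\<close> be the set of sequences of pairwise disjoint nonempty open sets. For a nonempty tuple
  \<open>\<sigma>\<close> in \<open>V\<close>, cutting the entries of its first sequence successively along the other sequences gives
  disjoint nonempty open cells. The subgroups \<open>\<Delta>(cell)\<close> fix \<open>\<sigma>\<close> and commute, and they depend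
  equivariantly on \<open>\<sigma>\<close>. Let \<open>P\<close> be the module of chains \<open>m \<otimes> \<sigma>\<close>, and let \<open>P'\<close> be that of the chains
  \<open>m \<otimes> \<sigma> \<otimes> l\<close> with \<open>l\<close> in the subgroup of the first cell. The map \<open>P' \<rightarrow> P\<close> that takes
  \<open>m \<otimes> \<sigma> \<otimes> l\<close> to \<open>(m \<cdot> l - m) \<otimes> \<sigma>\<close> is onto, and it is zero on homology because inner automorphisms
  act trivially. Hence \<open>H\<^sub>n(P)\<close> embeds into \<open>H\<^sub>n\<^sub>-\<^sub>1\<close> of the kernel, which is again of the same kind for
  the remaining cells, and \<open>H\<^sub>n(P) = 0\<close> follows by induction on \<open>n\<close>. Finally the augmented complex of
  all tuples in \<open>V\<close> is exact, so a dimension shift carries the vanishing over to \<open>N\<close> itself.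
\<close>

hide_const (open) Measure_Space.additive
hide_fact (open) Measure_Space.additive_def

section \<open>Alternating sums and linear extension\<close>

text \<open>The sign of \<open>i\<close> is encoded by parity because the target is only an abelian
  group, without scalars.\<close>

definition alt :: "nat \<Rightarrow> 'a::ab_group_add \<Rightarrow> 'a" where
  "alt i x = (if even i then x else - x)"

lemma alt_0 [simp]: "alt 0 x = x" and alt_Suc [simp]: "alt (Suc i) x = - alt i x"
  and alt_zero [simp]: "alt i 0 = 0"
  by (simp_all add: alt_def)

lemma alt_add: "alt i (x + y) = alt i x + alt i y"
  by (simp add: alt_def)

lemma alt_alt [simp]: "alt i (alt j x) = alt (i + j) x"
  by (simp add: alt_def)

lemma alt_uminus [simp]: "alt i (- x) = - alt i x"
  by (simp add: alt_def)

lemma alt_sum: "alt i (sum f A) = (\<Sum>a\<in>A. alt i (f a))"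
  by (simp add: alt_def sum_negf)

lemma additive_alt: "additive f \<Longrightarrow> f (alt i x) = alt i (f x)"
  by (simp add: alt_def additive.minus)

text \<open>The cancellation behind a boundary that squares to zero: \<open>F i j\<close> is face
  \<open>j\<close> of face \<open>i\<close>, and the simplicial identity pairs each term
  \<open>(i, j)\<close> with \<open>j < i\<close> with the term \<open>(j, i - 1)\<close> of
  opposite sign.\<close>

lemma sum_alternating_faces_eq_0:
  assumes "\<And>i j. j < i \<Longrightarrow> i \<le> Suc n \<Longrightarrow> F i j = F j (i - 1)"
  shows "(\<Sum>i\<le>Suc n. \<Sum>j\<le>n. alt (i + j) (F i j)) = (0::'a::ab_group_add)"
proof -
  let ?f = "\<lambda>(i, j). alt (i + j) (F i j)"
  let ?A = "{(i, j). i \<le> Suc n \<and> j \<le> n \<and> j < i}" and ?B = "{(i, j). i \<le> Suc n \<and> j \<le> n \<and> i \<le> j}"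
  have fin: "finite ?A" "finite ?B"
    by (rule finite_subset[of _ "{..Suc n} \<times> {..n}"]; auto)+
  have AB: "{..Suc n} \<times> {..n} = ?A \<union> ?B" "?A \<inter> ?B = {}"
    by auto
  have "sum ?f ?A = sum (\<lambda>p. - ?f p) ?B"
  proof (rule sum.reindex_bij_witness[where i = "\<lambda>(i, j). (Suc j, i)" and j = "\<lambda>(i, j). (j, i - 1)"])
    fix p assume p: "p \<in> ?A"
    then obtain i j where ij: "p = (Suc i, j)" "Suc i \<le> Suc n" "j < Suc i"
      by (cases p, case_tac a) auto
    then show "- ?f (case p of (i, j) \<Rightarrow> (j, i - 1)) = ?f p"
      using assms[of j "Suc i"] by (simp add: add.commute)
  qed auto
  then have "sum ?f ({..Suc n} \<times> {..n}) = 0"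
    unfolding AB(1) by (simp add: sum.union_disjoint[OF fin AB(2)] sum_negf)
  then show ?thesis
    by (simp add: sum.cartesian_product)
qed

text \<open>The combinatorics of a prism homotopy: \<open>F i j\<close> is face \<open>i\<close> of
  prism cell \<open>j\<close>, and \<open>E j i\<close> is prism cell \<open>j\<close> over face
  \<open>i\<close>. Away from the diagonals \<open>i = j\<close> and \<open>i = j + 1\<close> the
  two kinds of terms cancel; along these diagonals the sum telescopes to its two ends.\<close>

lemma sum_alternating_prism:
  assumes lo: "\<And>i j. i < j \<Longrightarrow> j \<le> n \<Longrightarrow> F i j = E (j - 1) i"
    and hi: "\<And>i j. Suc j < i \<Longrightarrow> i \<le> Suc n \<Longrightarrow> F i j = E j (i - 1)"
    and diag: "\<And>j. j < n \<Longrightarrow> F (Suc j) (Suc j) = F (Suc j) j"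
  shows "(\<Sum>i\<le>Suc n. \<Sum>j\<le>n. alt (i + j) (F i j)) + (\<Sum>i\<le>n. \<Sum>j<n. alt (i + j) (E j i))
    = F 0 0 - F (Suc n) n"
proof -
  let ?f = "\<lambda>(i, j). alt (i + j) (F i j)" and ?e = "\<lambda>(i, j). alt (i + j) (E j i)"
  let ?L = "{(i, j). j \<le> n \<and> i < j}" and ?U = "{(i, j). i \<le> Suc n \<and> Suc j < i}"
  let ?D = "{(i, j). j \<le> n \<and> i = j} \<union> {(i, j). j \<le> n \<and> i = Suc j}"
  let ?L' = "{(i, j). j < n \<and> i \<le> j}" and ?U' = "{(i, j). i \<le> n \<and> j < i}"
  have fin: "finite ?L" "finite ?U" "finite ?D"
    by (rule finite_subset[of _ "{..Suc n} \<times> {..n}"]; auto)+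
  have fin': "finite ?L'" "finite ?U'"
    by (rule finite_subset[of _ "{..n} \<times> {..n}"]; auto)+
  have split: "{..Suc n} \<times> {..n} = (?L \<union> ?U) \<union> ?D" "(?L \<union> ?U) \<inter> ?D = {}" "?L \<inter> ?U = {}"
    by auto
  have split': "{..n} \<times> {..<n} = ?L' \<union> ?U'" "?L' \<inter> ?U' = {}"
    by auto
  have L: "sum ?f ?L = sum (\<lambda>p. - ?e p) ?L'"
  proof (rule sum.reindex_bij_witness[where i = "\<lambda>(i, j). (i, Suc j)" and j = "\<lambda>(i, j). (i, j - 1)"])
    fix p assume p: "p \<in> ?L"
    then obtain i j where ij: "p = (i, Suc j)" "Suc j \<le> n" "i < Suc j"
      by (cases p, case_tac b) auto
    then show "- ?e (case p of (i, j) \<Rightarrow> (i, j - 1)) = ?f p"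
      using lo[of i "Suc j"] by simp
  qed auto
  have U: "sum ?f ?U = sum (\<lambda>p. - ?e p) ?U'"
  proof (rule sum.reindex_bij_witness[where i = "\<lambda>(i, j). (Suc i, j)" and j = "\<lambda>(i, j). (i - 1, j)"])
    fix p assume p: "p \<in> ?U"
    then obtain i j where ij: "p = (Suc i, j)" "Suc i \<le> Suc n" "Suc j < Suc i"
      by (cases p, case_tac a) auto
    then show "- ?e (case p of (i, j) \<Rightarrow> (i - 1, j)) = ?f p"
      using hi[of j "Suc i"] by simp
  qed auto
  have "sum ?f ?D = sum ?f {(i, j). j \<le> n \<and> i = j} + sum ?f {(i, j). j \<le> n \<and> i = Suc j}"
    by (rule sum.union_disjoint) (auto intro: finite_subset[of _ "{..Suc n} \<times> {..n}"])
  also have "sum ?f {(i, j). j \<le> n \<and> i = j} = (\<Sum>j\<le>n. F j j)"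
    by (rule sum.reindex_bij_witness[where i = "\<lambda>j. (j, j)" and j = snd]) (auto simp: alt_def)
  also have "sum ?f {(i, j). j \<le> n \<and> i = Suc j} = (\<Sum>j\<le>n. - F (Suc j) j)"
    by (rule sum.reindex_bij_witness[where i = "\<lambda>j. (Suc j, j)" and j = snd]) (auto simp: alt_def)
  also have "(\<Sum>j\<le>n. F j j) = F 0 0 + (\<Sum>j<n. F (Suc j) (Suc j))"
    by (cases n) (simp_all add: sum.atMost_Suc_shift lessThan_Suc_atMost del: sum.atMost_Suc)
  also have "(\<Sum>j\<le>n. - F (Suc j) j) = - F (Suc n) n - (\<Sum>j<n. F (Suc j) j)"
    by (simp add: lessThan_Suc_atMost[symmetric] sum_negf)
  also have "(\<Sum>j<n. F (Suc j) (Suc j)) = (\<Sum>j<n. F (Suc j) j)"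
    by (rule sum.cong) (auto simp: diag)
  finally have D: "sum ?f ?D = F 0 0 - F (Suc n) n"
    by simp
  have "sum ?f ({..Suc n} \<times> {..n}) = sum ?f ?L + sum ?f ?U + sum ?f ?D"
    unfolding split(1) sum.union_disjoint[OF finite_UnI[OF fin(1,2)] fin(3) split(2)]
      sum.union_disjoint[OF fin(1,2) split(3)] ..
  moreover have "sum ?e ({..n} \<times> {..<n}) = sum ?e ?L' + sum ?e ?U'"
    unfolding split'(1) by (rule sum.union_disjoint[OF fin' split'(2)])
  ultimately show ?thesis
    using L U D by (simp add: sum.cartesian_product sum_negf)
qed

section \<open>Additive extension of maps on coefficients to finitely supported functions\<close>

definition lin :: "('i \<Rightarrow> 'm \<Rightarrow> 'a) \<Rightarrow> ('i \<Rightarrow>\<^sub>0 'm::zero) \<Rightarrow> 'a::ab_group_add" where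
  "lin F c = (\<Sum>k\<in>Poly_Mapping.keys c. F k (Poly_Mapping.lookup c k))"

text \<open>Keys change under addition, so a common finite index set is needed before values of
  \<open>lin\<close> can be compared.\<close>

lemma lin_superset:
  assumes "finite A" "Poly_Mapping.keys c \<subseteq> A" "\<And>k. F k 0 = 0"
  shows "lin F c = (\<Sum>k\<in>A. F k (Poly_Mapping.lookup c k))"
  unfolding lin_def using assms
  by (intro sum.mono_neutral_left) (auto simp: in_keys_iff)

lemma additive_lin:
  fixes F :: "'i \<Rightarrow> 'm::ab_group_add \<Rightarrow> 'a::ab_group_add"
  assumes "\<And>k. additive (F k)"
  shows "additive (lin F)"
proof
  fix c d :: "'i \<Rightarrow>\<^sub>0 'm"
  let ?A = "Poly_Mapping.keys c \<union> Poly_Mapping.keys d"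
  have sup: "lin F e = (\<Sum>k\<in>?A. F k (Poly_Mapping.lookup e k))" if "Poly_Mapping.keys e \<subseteq> ?A" for e
    by (rule lin_superset) (use that assms in \<open>auto intro: additive.zero\<close>)
  show "lin F (c + d) = lin F c + lin F d"
    by (simp add: sup keys_add[of c d] lookup_add additive.add[OF assms] sum.distrib)
qed

lemma lin_single: "F k 0 = 0 \<Longrightarrow> lin F (Poly_Mapping.single k m) = F k m"
  by (simp add: lin_def)

lemma lin_single_additive: "(\<And>k. additive (F k)) \<Longrightarrow> lin F (Poly_Mapping.single k m) = F k m"
  by (simp add: lin_single additive.zero)

text \<open>Only the basis terms of \<open>c\<close> are tested, with their own coefficients, so
  identities that hold merely for coefficients in a submodule suffice.\<close>

lemma additive_eq_on_keys:
  fixes P Q :: "('i \<Rightarrow>\<^sub>0 'm::ab_group_add) \<Rightarrow> 'a::ab_group_add"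
  assumes "additive P" "additive Q"
    and eq: "\<And>k. k \<in> Poly_Mapping.keys c \<Longrightarrow>
      P (Poly_Mapping.single k (Poly_Mapping.lookup c k)) = Q (Poly_Mapping.single k (Poly_Mapping.lookup c k))"
  shows "P c = Q c"
proof -
  have c: "c = (\<Sum>k\<in>Poly_Mapping.keys c. Poly_Mapping.single k (Poly_Mapping.lookup c k))"
    by (rule poly_mapping_eqI) (auto simp: lookup_sum lookup_single when_def in_keys_iff sum.delta)
  have "P c = (\<Sum>k\<in>Poly_Mapping.keys c. P (Poly_Mapping.single k (Poly_Mapping.lookup c k)))"
    by (subst c) (rule additive.sum[OF assms(1)])
  also have "\<dots> = (\<Sum>k\<in>Poly_Mapping.keys c. Q (Poly_Mapping.single k (Poly_Mapping.lookup c k)))"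
    by (rule sum.cong) (auto simp: eq)
  also have "\<dots> = Q c"
    by (subst (2) c) (rule additive.sum[OF assms(2), symmetric])
  finally show ?thesis .
qed

lemma additive_single: "additive h \<Longrightarrow> additive (\<lambda>m. Poly_Mapping.single k (h m))"
  by (auto simp: additive_def single_add)

lemma additive_alt_fun: "additive h \<Longrightarrow> additive (\<lambda>m. alt i (h m))"
  by (auto simp: additive_def alt_add)

lemma additive_sum_fun: "(\<And>i. additive (h i)) \<Longrightarrow> additive (\<lambda>m. \<Sum>i\<in>A. h i m)"
  by (auto simp: additive_def sum.distrib)

lemma additive_id: "additive (\<lambda>m. m)" and additive_const_0: "additive (\<lambda>m. 0)"
  by (auto simp: additive_def)

lemma additive_diff_fun: "additive f \<Longrightarrow> additive g \<Longrightarrow> additive (\<lambda>m. f m - g m)"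
  by (auto simp: additive_def)

lemma additive_add_fun: "additive f \<Longrightarrow> additive g \<Longrightarrow> additive (\<lambda>m. f m + g m)"
  by (auto simp: additive_def)

lemma additive_minus_fun: "additive f \<Longrightarrow> additive (\<lambda>m. - f m)"
  by (auto simp: additive_def)

lemma additive_compose: "additive f \<Longrightarrow> additive g \<Longrightarrow> additive (\<lambda>m. f (g m))"
  by (auto simp: additive_def)

lemmas additive_intros = additive_single additive_alt_fun additive_sum_fun additive_id
  additive_const_0 additive_diff_fun additive_add_fun additive_minus_fun

section \<open>List operations of the bar complex\<close>

text \<open>The list part of \<open>bar_face\<close>, recast as a recursion so that the simplicial
  identities follow by induction on the list. The clause for \<open>[x]\<close> is the last
  face.\<close>

fun lface :: "('g \<Rightarrow> 'g \<Rightarrow> 'g) \<Rightarrow> nat \<Rightarrow> 'g list \<Rightarrow> 'g list" where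
  "lface f i [] = []"
| "lface f 0 (x # xs) = xs"
| "lface f (Suc 0) [x] = []"
| "lface f (Suc 0) (x # y # zs) = f x y # zs"
| "lface f (Suc (Suc i)) (x # xs) = x # lface f (Suc i) xs"

lemma length_lface: "i \<le> length xs \<Longrightarrow> length (lface f i xs) = length xs - 1"
  by (induction f i xs rule: lface.induct) auto

lemma lface_length: "lface f (length xs) xs = butlast xs"
proof (induction xs)
  case (Cons x xs)
  then show ?case by (cases xs) auto
qed auto

lemma lface_middle:
  "0 < i \<Longrightarrow> i < length xs \<Longrightarrow> lface f i xs = take (i - 1) xs @ f (xs ! (i - 1)) (xs ! i) # drop (i + 1) xs"
  by (induction f i xs rule: lface.induct) auto

fun del :: "nat \<Rightarrow> 'a list \<Rightarrow> 'a list" where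
  "del i [] = []"
| "del 0 (x # xs) = xs"
| "del (Suc i) (x # xs) = x # del i xs"

lemma length_del: "i < length xs \<Longrightarrow> length (del i xs) = length xs - 1"
  by (induction i xs rule: del.induct) (auto simp: Suc_diff_Suc)

lemma set_del: "set (del i xs) \<subseteq> set xs"
  by (induction i xs rule: del.induct) auto

lemma map_del: "map f (del i xs) = del i (map f xs)"
  by (induction i xs rule: del.induct) auto

lemma del_del: "j < i \<Longrightarrow> i < length xs \<Longrightarrow> del j (del i xs) = del (i - 1) (del j xs)"
proof (induction xs arbitrary: i j)
  case (Cons x xs)
  then obtain i' where i: "i = Suc i'" by (cases i) auto
  show ?case
  proof (cases j)
    case (Suc j')
    with Cons.prems i obtain i'' where "i' = Suc i''" by (cases i') auto
    with Cons i Suc show ?thesis by auto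
  qed (use i in auto)
qed auto

context group
begin

lemma set_lface: "set xs \<subseteq> carrier G \<Longrightarrow> set (lface (\<otimes>) i xs) \<subseteq> carrier G"
proof (induction "(\<otimes>)" i xs rule: lface.induct)
qed auto

text \<open>The simplicial identities. Associativity enters only where two adjacent products meet,
  which is the case \<open>j = 1\<close>, \<open>i = 2\<close> up to a shift along the list.\<close>

lemma lface_lface:
  "set xs \<subseteq> carrier G \<Longrightarrow> j < i \<Longrightarrow> i \<le> length xs \<Longrightarrow>
    lface (\<otimes>) j (lface (\<otimes>) i xs) = lface (\<otimes>) (i - 1) (lface (\<otimes>) j xs)"
proof (induction xs arbitrary: i j)
  case (Cons x xs)
  then obtain i' where i: "i = Suc i'" by (cases i) auto
  show ?case
  proof (cases j)
    case 0
    then show ?thesis using i by (cases i'; cases xs) auto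
  next
    case (Suc j')
    with Cons.prems i obtain i'' where i': "i' = Suc i''" by (cases i') auto
    show ?thesis
    proof (cases j')
      case 0
      from Cons.prems i i' obtain y zs where xs: "xs = y # zs" by (cases xs) auto
      show ?thesis using Cons.prems i i' Suc 0 xs
        by (cases i''; cases zs) (auto simp: m_assoc)
    next
      case (Suc j'')
      with Cons.prems i i' \<open>j = Suc j'\<close> obtain i3 where i3: "i'' = Suc i3" by (cases i'') auto
      have "lface (\<otimes>) j' (lface (\<otimes>) i' xs) = lface (\<otimes>) (i' - 1) (lface (\<otimes>) j' xs)"
        using Cons i \<open>j = Suc j'\<close> by auto
      then show ?thesis
        using i i' i3 Suc \<open>j = Suc j'\<close> by simp
    qed
  qed
qed auto

text \<open>The entry that ends up at position \<open>j\<close> is \<open>l\<close> conjugated by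
  the product of the entries before it. These tuples are the cells of the prism between the identity
  and conjugation by \<open>l\<close>.\<close>

fun ins :: "nat \<Rightarrow> 'a \<Rightarrow> 'a list \<Rightarrow> 'a list" where
  "ins 0 l xs = l # xs"
| "ins (Suc j) l [] = [l]"
| "ins (Suc j) l (x # xs) = x # ins j (inv x \<otimes> l \<otimes> x) xs"

lemma length_ins [simp]: "length (ins j l xs) = Suc (length xs)"
  by (induction j l xs rule: ins.induct) auto

lemma ins_neq_Nil [simp]: "ins j l xs \<noteq> []"
  by (induction j l xs rule: ins.induct) auto

lemma set_ins: "set xs \<subseteq> carrier G \<Longrightarrow> l \<in> carrier G \<Longrightarrow> set (ins j l xs) \<subseteq> carrier G"
  by (induction j l xs rule: ins.induct) auto

lemma hd_ins: "0 < j \<Longrightarrow> j \<le> length xs \<Longrightarrow> hd (ins j l xs) = hd xs"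
  by (cases j; cases xs) auto

lemma lface_0_ins: "0 < j \<Longrightarrow> j \<le> length xs \<Longrightarrow>
    lface (\<otimes>) 0 (ins j l xs) = ins (j - 1) (inv (hd xs) \<otimes> l \<otimes> hd xs) (lface (\<otimes>) 0 xs)"
  by (cases j; cases xs) auto

lemma lface_ins_less:
  "set xs \<subseteq> carrier G \<Longrightarrow> l \<in> carrier G \<Longrightarrow> 0 < i \<Longrightarrow> i < j \<Longrightarrow> j \<le> length xs \<Longrightarrow>
    lface (\<otimes>) i (ins j l xs) = ins (j - 1) l (lface (\<otimes>) i xs)"
proof (induction xs arbitrary: i j l)
  case (Cons x xs)
  then obtain i' j' where ij: "i = Suc i'" "j = Suc (Suc j')"
    by (metis Suc_lessE less_imp_Suc_add gr0_implies_Suc)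
  show ?case
  proof (cases i')
    case 0
    from Cons.prems ij obtain y zs where xs: "xs = y # zs" by (cases xs) auto
    show ?thesis using Cons.prems ij xs 0
      by (simp add: m_assoc inv_mult_group)
  next
    case (Suc i'')
    with ij Cons.prems have "lface (\<otimes>) i' (ins (Suc j') (inv x \<otimes> l \<otimes> x) xs)
        = ins j' (inv x \<otimes> l \<otimes> x) (lface (\<otimes>) i' xs)"
      using Cons.IH[of "inv x \<otimes> l \<otimes> x" i' "Suc j'"] by auto
    then show ?thesis using ij Suc by simp
  qed
qed auto

lemma lface_ins_greater:
  "set xs \<subseteq> carrier G \<Longrightarrow> l \<in> carrier G \<Longrightarrow> Suc j < i \<Longrightarrow> i \<le> Suc (length xs) \<Longrightarrow>
    lface (\<otimes>) i (ins j l xs) = ins j l (lface (\<otimes>) (i - 1) xs)"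
proof (induction xs arbitrary: i j l)
  case (Cons x xs)
  then obtain i' where i: "i = Suc (Suc i')" by (cases i; cases "i - 1") auto
  show ?case
  proof (cases j)
    case (Suc j')
    with Cons.prems i obtain i'' where i': "i' = Suc i''" by (cases i') auto
    have "lface (\<otimes>) (Suc i') (ins j' (inv x \<otimes> l \<otimes> x) xs)
        = ins j' (inv x \<otimes> l \<otimes> x) (lface (\<otimes>) i' xs)"
      using Cons.IH[of "inv x \<otimes> l \<otimes> x" j' "Suc i'"] Cons.prems i Suc by auto
    then show ?thesis using i i' Suc by simp
  qed (use i in auto)
qed auto

text \<open>Two neighbouring prism cells share a face: \<open>x\<close> times
  \<open>inv x \<otimes> l \<otimes> x\<close> and \<open>l\<close> times \<open>x\<close> are both
  \<open>l \<otimes> x\<close>, where \<open>x\<close> is entry \<open>j\<close> and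
  \<open>l\<close> the conjugate reached there.\<close>

lemma lface_ins_diag:
  "set xs \<subseteq> carrier G \<Longrightarrow> l \<in> carrier G \<Longrightarrow> j < length xs \<Longrightarrow>
    lface (\<otimes>) (Suc j) (ins (Suc j) l xs) = lface (\<otimes>) (Suc j) (ins j l xs)"
proof (induction xs arbitrary: j l)
  case (Cons x xs)
  show ?case
  proof (cases j)
    case 0
    then show ?thesis using Cons.prems
      by (simp add: m_assoc[symmetric])
  next
    case (Suc j')
    have "lface (\<otimes>) (Suc j') (ins (Suc j') (inv x \<otimes> l \<otimes> x) xs)
        = lface (\<otimes>) (Suc j') (ins j' (inv x \<otimes> l \<otimes> x) xs)"
      using Cons.IH[of "inv x \<otimes> l \<otimes> x" j'] Cons.prems Suc by auto
    then show ?thesis using Suc by simp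
  qed
qed auto

lemma lface_ins_last: "lface (\<otimes>) (Suc (length xs)) (ins (length xs) l xs) = xs"
proof (induction xs arbitrary: l)
  case (Cons x xs)
  then show ?case by simp
qed auto

end

section \<open>The twisted bar complex\<close>

text \<open>The homological algebra, separated from topology and analysis. Later \<open>S\<close>
  consists of sequences of disjoint open sets, \<open>\<Lambda> \<sigma> j\<close> is the subgroup
  attached to cell \<open>j\<close> of \<open>\<sigma>\<close>, and \<open>T \<sigma> j\<close>
  solves the equation that expresses \<open>m\<close> through differences along elements of that
  subgroup.\<close>

locale twisted_bar_complex = group G for G (structure) +
  fixes act :: "'m::ab_group_add \<Rightarrow> 'a \<Rightarrow> 'm" and M :: "'m set"
    and S :: "'s set" and sact :: "'a \<Rightarrow> 's \<Rightarrow> 's" and s0 :: 's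
    and \<Lambda> :: "'s list \<Rightarrow> nat \<Rightarrow> 'a set"
    and F :: "'s list \<Rightarrow> nat \<Rightarrow> 'a set" and T :: "'s list \<Rightarrow> nat \<Rightarrow> 'm \<Rightarrow> 'm"
  assumes additive_act: "additive (\<lambda>m. act m g)"
    and act_mult: "g \<in> carrier G \<Longrightarrow> h \<in> carrier G \<Longrightarrow> act (act m g) h = act m (g \<otimes> h)"
    and M_0: "0 \<in> M" and M_diff: "m \<in> M \<Longrightarrow> m' \<in> M \<Longrightarrow> m - m' \<in> M"
    and M_act: "g \<in> carrier G \<Longrightarrow> m \<in> M \<Longrightarrow> act m g \<in> M"
    and sact_closed: "g \<in> carrier G \<Longrightarrow> s \<in> S \<Longrightarrow> sact g s \<in> S"
    and sact_mult: "g \<in> carrier G \<Longrightarrow> h \<in> carrier G \<Longrightarrow> s \<in> S \<Longrightarrow> sact (g \<otimes> h) s = sact g (sact h s)"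
    and s0: "s0 \<in> S"
    and \<Lambda>_carrier: "set \<sigma> \<subseteq> S \<Longrightarrow> l \<in> \<Lambda> \<sigma> j \<Longrightarrow> l \<in> carrier G"
    and \<Lambda>_conj: "set \<sigma> \<subseteq> S \<Longrightarrow> g \<in> carrier G \<Longrightarrow> l \<in> \<Lambda> \<sigma> j \<Longrightarrow>
      inv g \<otimes> l \<otimes> g \<in> \<Lambda> (map (sact (inv g)) \<sigma>) j"
    and \<Lambda>_fix: "set \<sigma> \<subseteq> S \<Longrightarrow> l \<in> \<Lambda> \<sigma> j \<Longrightarrow> map (sact (inv l)) \<sigma> = \<sigma>"
    and \<Lambda>_commute: "set \<sigma> \<subseteq> S \<Longrightarrow> l \<in> \<Lambda> \<sigma> j \<Longrightarrow> l' \<in> \<Lambda> \<sigma> j' \<Longrightarrow> j \<noteq> j' \<Longrightarrow> l \<otimes> l' = l' \<otimes> l"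
    and additive_T: "additive (T \<sigma> j)"
    and T_closed: "\<sigma> \<noteq> [] \<Longrightarrow> set \<sigma> \<subseteq> S \<Longrightarrow> m \<in> M \<Longrightarrow> T \<sigma> j m \<in> M"
    and F_subset: "\<sigma> \<noteq> [] \<Longrightarrow> set \<sigma> \<subseteq> S \<Longrightarrow> F \<sigma> j \<subseteq> \<Lambda> \<sigma> j"
    and T_inverse: "\<sigma> \<noteq> [] \<Longrightarrow> set \<sigma> \<subseteq> S \<Longrightarrow> m \<in> M \<Longrightarrow>
      (\<Sum>s\<in>F \<sigma> j. act (T \<sigma> j m) s - T \<sigma> j m) = m"
    and T_act: "\<sigma> \<noteq> [] \<Longrightarrow> set \<sigma> \<subseteq> S \<Longrightarrow> m \<in> M \<Longrightarrow> l \<in> \<Lambda> \<sigma> i \<Longrightarrow> i \<noteq> j \<Longrightarrow>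
      T \<sigma> j (act m l) = act (T \<sigma> j m) l"
begin

lemma act_0 [simp]: "act 0 g = 0"
  and act_diff: "act (m - m') g = act m g - act m' g"
  using additive_act[of g] by (auto intro: additive.zero additive.diff)

lemma T_diff: "T \<sigma> j (m - m') = T \<sigma> j m - T \<sigma> j m'" and T_0 [simp]: "T \<sigma> j 0 = 0"
  using additive_T[of \<sigma> j] by (auto intro: additive.diff additive.zero)

lemma conj_conj: "g \<in> carrier G \<Longrightarrow> h \<in> carrier G \<Longrightarrow> l \<in> carrier G \<Longrightarrow>
    inv h \<otimes> (inv g \<otimes> l \<otimes> g) \<otimes> h = inv (g \<otimes> h) \<otimes> l \<otimes> (g \<otimes> h)"
  by (simp add: m_assoc inv_mult_group)

text \<open>
  An index \<open>(gs, \<sigma>, ls)\<close> with coefficient \<open>m\<close> stands for the bar chain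
  \<open>(m \<otimes> \<sigma> \<otimes> ls) \<otimes> [gs]\<close>, where the group acts diagonally on \<open>\<sigma>\<close> and by conjugation on \<open>ls\<close>.
  The entries of \<open>ls\<close> are numbered from the right, so that a new one is put in front.
\<close>

definition indices :: "nat \<Rightarrow> nat \<Rightarrow> nat \<Rightarrow> ('a list \<times> 's list \<times> 'a list) set" where
  "indices n p r = {(gs, \<sigma>, ls). length gs = n \<and> set gs \<subseteq> carrier G \<and> length \<sigma> = p \<and> set \<sigma> \<subseteq> S \<and>
     length ls = r \<and> (\<forall>i<r. ls ! i \<in> \<Lambda> \<sigma> (r - Suc i))}"

definition chains :: "nat \<Rightarrow> nat \<Rightarrow> nat \<Rightarrow> ('a list \<times> 's list \<times> 'a list \<Rightarrow>\<^sub>0 'm) set" where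
  "chains n p r = {c. Poly_Mapping.keys c \<subseteq> indices n p r \<and> (\<forall>k. Poly_Mapping.lookup c k \<in> M)}"

lemma indices_ls_carrier: "(gs, \<sigma>, ls) \<in> indices n p r \<Longrightarrow> set ls \<subseteq> carrier G"
proof
  fix l assume ix: "(gs, \<sigma>, ls) \<in> indices n p r" and "l \<in> set ls"
  then obtain i where "i < length ls" "l = ls ! i"
    by (auto simp: in_set_conv_nth)
  then have "l \<in> \<Lambda> \<sigma> (r - Suc i)" "set \<sigma> \<subseteq> S"
    using ix by (auto simp: indices_def)
  then show "l \<in> carrier G"
    by (auto intro: \<Lambda>_carrier)
qed

lemma chainsD: "c \<in> chains n p r \<Longrightarrow> k \<in> Poly_Mapping.keys c \<Longrightarrow> k \<in> indices n p r"
  "c \<in> chains n p r \<Longrightarrow> Poly_Mapping.lookup c k \<in> M"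
  unfolding chains_def by blast+

lemma chains_0: "0 \<in> chains n p r"
  by (auto simp: chains_def M_0)

lemma chains_diff: "c \<in> chains n p r \<Longrightarrow> d \<in> chains n p r \<Longrightarrow> c - d \<in> chains n p r"
  using keys_diff[of c d] by (auto simp: chains_def lookup_minus M_diff)

lemma chains_uminus: "c \<in> chains n p r \<Longrightarrow> - c \<in> chains n p r"
  using chains_diff[OF chains_0] by fastforce

lemma chains_add: "c \<in> chains n p r \<Longrightarrow> d \<in> chains n p r \<Longrightarrow> c + d \<in> chains n p r"
  using chains_diff[OF _ chains_uminus] by fastforce

lemma chains_alt: "c \<in> chains n p r \<Longrightarrow> alt i c \<in> chains n p r"
  by (simp add: alt_def chains_uminus)

lemma chains_sum: "(\<And>i. i \<in> A \<Longrightarrow> f i \<in> chains n p r) \<Longrightarrow> sum f A \<in> chains n p r"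
  by (induction A rule: infinite_finite_induct) (auto simp: chains_0 chains_add)

lemma chains_single: "k \<in> indices n p r \<Longrightarrow> m \<in> M \<Longrightarrow> Poly_Mapping.single k m \<in> chains n p r"
  by (auto simp: chains_def lookup_single when_def M_0 split: if_splits)

lemma chains_lin:
  assumes "c \<in> chains n p r" "\<And>k m. k \<in> indices n p r \<Longrightarrow> m \<in> M \<Longrightarrow> f k m \<in> chains n' p' r'"
  shows "lin f c \<in> chains n' p' r'"
  unfolding lin_def by (rule chains_sum) (rule assms(2)[OF chainsD[OF assms(1)]])

lemma chains_eqI:
  assumes "additive P" "additive Q" "c \<in> chains n p r"
    and "\<And>gs \<sigma> ls m. (gs, \<sigma>, ls) \<in> indices n p r \<Longrightarrow> m \<in> M \<Longrightarrow>
      P (Poly_Mapping.single (gs, \<sigma>, ls) m) = Q (Poly_Mapping.single (gs, \<sigma>, ls) m)"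
  shows "P c = Q c"
proof (rule additive_eq_on_keys[OF assms(1,2)])
  fix k assume "k \<in> Poly_Mapping.keys c"
  then have "k \<in> indices n p r" "Poly_Mapping.lookup c k \<in> M"
    using chainsD[OF assms(3)] by blast+
  then show "P (Poly_Mapping.single k (Poly_Mapping.lookup c k)) =
      Q (Poly_Mapping.single k (Poly_Mapping.lookup c k))"
    by (cases k) (auto intro: assms(4))
qed

section \<open>Boundary, augmentation, difference and homotopy operators on twisted chains\<close>

definition fidx :: "nat \<Rightarrow> 'a list \<times> 's list \<times> 'a list \<Rightarrow> 'a list \<times> 's list \<times> 'a list" where
  "fidx i = (\<lambda>(gs, \<sigma>, ls). (lface (\<otimes>) i gs,
     if i = 0 then map (sact (inv (hd gs))) \<sigma> else \<sigma>,
     if i = 0 then map (\<lambda>l. inv (hd gs) \<otimes> l \<otimes> hd gs) ls else ls))"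

text \<open>Face \<open>0\<close> lets the first group element act on all three tensor factors. The
  coefficients form a right module, which is why \<open>fidx\<close> lets it act on
  \<open>\<sigma>\<close> and \<open>ls\<close> through the inverse.\<close>

definition fcoeff :: "nat \<Rightarrow> 'a list \<Rightarrow> 'm \<Rightarrow> 'm" where
  "fcoeff i gs m = (if i = 0 then act m (hd gs) else m)"

definition bd_fun :: "'a list \<times> 's list \<times> 'a list \<Rightarrow> 'm \<Rightarrow> ('a list \<times> 's list \<times> 'a list \<Rightarrow>\<^sub>0 'm)" where
  "bd_fun k m = (if fst k = [] then 0
     else \<Sum>i\<le>length (fst k). alt i (Poly_Mapping.single (fidx i k) (fcoeff i (fst k) m)))"

abbreviation bd where "bd \<equiv> lin bd_fun"

text \<open>The boundary of the augmented complex of tuples: on a tuple of length one it is the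
  augmentation to the empty tuple.\<close>

definition eps_fun :: "'a list \<times> 's list \<times> 'a list \<Rightarrow> 'm \<Rightarrow> ('a list \<times> 's list \<times> 'a list \<Rightarrow>\<^sub>0 'm)" where
  "eps_fun = (\<lambda>(gs, \<sigma>, ls) m. \<Sum>i<length \<sigma>. alt i (Poly_Mapping.single (gs, del i \<sigma>, ls) m))"

abbreviation eps where "eps \<equiv> lin eps_fun"

text \<open>The contracting homotopy of the augmented tuple complex. It ignores the group action,
  since \<open>s0\<close> need not be fixed.\<close>

definition kap_fun :: "'a list \<times> 's list \<times> 'a list \<Rightarrow> 'm \<Rightarrow> ('a list \<times> 's list \<times> 'a list \<Rightarrow>\<^sub>0 'm)" where
  "kap_fun = (\<lambda>(gs, \<sigma>, ls) m. Poly_Mapping.single (gs, s0 # \<sigma>, ls) m)"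

abbreviation kap where "kap \<equiv> lin kap_fun"

text \<open>
  The entry \<open>i\<close> is overwritten by \<open>\<one>\<close> rather than deleted, so that the remaining entries keep their
  numbers.
\<close>

definition dlt_fun :: "nat \<Rightarrow> 'a list \<times> 's list \<times> 'a list \<Rightarrow> 'm \<Rightarrow> ('a list \<times> 's list \<times> 'a list \<Rightarrow>\<^sub>0 'm)" where
  "dlt_fun i = (\<lambda>(gs, \<sigma>, ls) m. Poly_Mapping.single (gs, \<sigma>, ls[i := \<one>]) (act m (ls ! i) - m))"

abbreviation dlt where "dlt i \<equiv> lin (dlt_fun i)"

text \<open>The surjection whose kernel carries the induction. Here the front entry disappears, in
  contrast to \<open>dlt 0\<close>; \<open>push_fun\<close> and \<open>pop_fun\<close> pass between
  the two forms.\<close>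

definition dhd_fun :: "'a list \<times> 's list \<times> 'a list \<Rightarrow> 'm \<Rightarrow> ('a list \<times> 's list \<times> 'a list \<Rightarrow>\<^sub>0 'm)" where
  "dhd_fun = (\<lambda>(gs, \<sigma>, ls) m. Poly_Mapping.single (gs, \<sigma>, tl ls) (act m (hd ls) - m))"

abbreviation dhd where "dhd \<equiv> lin dhd_fun"

definition push_fun :: "'a list \<times> 's list \<times> 'a list \<Rightarrow> 'm \<Rightarrow> ('a list \<times> 's list \<times> 'a list \<Rightarrow>\<^sub>0 'm)" where
  "push_fun = (\<lambda>(gs, \<sigma>, ls) m. Poly_Mapping.single (gs, \<sigma>, \<one> # ls) m)"

definition pop_fun :: "'a list \<times> 's list \<times> 'a list \<Rightarrow> 'm \<Rightarrow> ('a list \<times> 's list \<times> 'a list \<Rightarrow>\<^sub>0 'm)" where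
  "pop_fun = (\<lambda>(gs, \<sigma>, ls) m. Poly_Mapping.single (gs, \<sigma>, tl ls) m)"

text \<open>A right inverse of \<open>dhd\<close>, built from the solution \<open>T\<close> for cell
  number \<open>length ls\<close>. As \<open>F\<close> and \<open>T\<close> are not assumed
  equivariant in \<open>\<sigma>\<close>, it need not commute with \<open>bd\<close>; the induction
  in \<open>exact_conj\<close> repairs this.\<close>

definition lift_fun :: "'a list \<times> 's list \<times> 'a list \<Rightarrow> 'm \<Rightarrow> ('a list \<times> 's list \<times> 'a list \<Rightarrow>\<^sub>0 'm)" where
  "lift_fun = (\<lambda>(gs, \<sigma>, ls) m. \<Sum>s\<in>F \<sigma> (length ls).
     Poly_Mapping.single (gs, \<sigma>, s # ls) (T \<sigma> (length ls) m))"

abbreviation lift where "lift \<equiv> lin lift_fun"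

definition prism_fun :: "'a list \<times> 's list \<times> 'a list \<Rightarrow> 'm \<Rightarrow> ('a list \<times> 's list \<times> 'a list \<Rightarrow>\<^sub>0 'm)" where
  "prism_fun = (\<lambda>(gs, \<sigma>, ls) m. \<Sum>j\<le>length gs. alt j (Poly_Mapping.single (ins j (hd ls) gs, \<sigma>, tl ls) m))"

abbreviation prism where "prism \<equiv> lin prism_fun"

lemma additive_fcoeff: "additive (fcoeff i gs)"
  using additive_act[of "hd gs"] by (cases "i = 0") (auto simp: fcoeff_def additive_def)

lemma additive_funs: "additive (bd_fun k)" "additive (eps_fun k)" "additive (kap_fun k)"
    "additive (dlt_fun i k)" "additive (dhd_fun k)" "additive (push_fun k)" "additive (pop_fun k)"
    "additive (lift_fun k)" "additive (prism_fun k)"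
proof -
  obtain gs \<sigma> ls where k: "k = (gs, \<sigma>, ls)" by (cases k) auto
  show "additive (bd_fun k)"
    by (cases "fst k = []")
      (auto simp: bd_fun_def[abs_def] intro!: additive_intros additive_fcoeff)
  show "additive (eps_fun k)" "additive (kap_fun k)" "additive (dlt_fun i k)" "additive (dhd_fun k)"
    "additive (push_fun k)" "additive (pop_fun k)" "additive (lift_fun k)" "additive (prism_fun k)"
    by (auto simp: k eps_fun_def kap_fun_def dlt_fun_def dhd_fun_def push_fun_def pop_fun_def
        lift_fun_def prism_fun_def intro!: additive_intros additive_act additive_T)
qed

lemmas additive_ops = additive_funs[THEN additive_lin]

lemmas ops_0 [simp] = additive_ops[THEN additive.zero]
lemmas ops_diff = additive_ops[THEN additive.diff]
lemmas ops_sum = additive_ops[THEN additive.sum]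
lemmas ops_alt = additive_ops[THEN additive_alt]
lemmas ops_single [simp] = additive_funs[THEN lin_single_additive]

lemma eps_fun: "eps_fun (gs, \<sigma>, ls) m = (\<Sum>i<length \<sigma>. alt i (Poly_Mapping.single (gs, del i \<sigma>, ls) m))"
  and kap_fun: "kap_fun (gs, \<sigma>, ls) m = Poly_Mapping.single (gs, s0 # \<sigma>, ls) m"
  and dlt_fun: "dlt_fun i (gs, \<sigma>, ls) m = Poly_Mapping.single (gs, \<sigma>, ls[i := \<one>]) (act m (ls ! i) - m)"
  and dhd_fun: "dhd_fun (gs, \<sigma>, ls) m = Poly_Mapping.single (gs, \<sigma>, tl ls) (act m (hd ls) - m)"
  and push_fun: "push_fun (gs, \<sigma>, ls) m = Poly_Mapping.single (gs, \<sigma>, \<one> # ls) m"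
  and pop_fun: "pop_fun (gs, \<sigma>, ls) m = Poly_Mapping.single (gs, \<sigma>, tl ls) m"
  and lift_fun: "lift_fun (gs, \<sigma>, ls) m =
    (\<Sum>s\<in>F \<sigma> (length ls). Poly_Mapping.single (gs, \<sigma>, s # ls) (T \<sigma> (length ls) m))"
  and prism_fun: "prism_fun (gs, \<sigma>, ls) m =
    (\<Sum>j\<le>length gs. alt j (Poly_Mapping.single (ins j (hd ls) gs, \<sigma>, tl ls) m))"
  by (simp_all add: eps_fun_def kap_fun_def dlt_fun_def dhd_fun_def push_fun_def pop_fun_def
      lift_fun_def prism_fun_def)

lemma bd_fun_Nil: "bd_fun ([], \<sigma>, ls) m = 0"
  by (simp add: bd_fun_def)

lemma bd_fun_nonempty: "gs \<noteq> [] \<Longrightarrow> bd_fun (gs, \<sigma>, ls) m =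
    (\<Sum>i\<le>length gs. alt i (Poly_Mapping.single (fidx i (gs, \<sigma>, ls)) (fcoeff i gs m)))"
  by (simp add: bd_fun_def)

lemma fst_fidx: "fst (fidx i (gs, \<sigma>, ls)) = lface (\<otimes>) i gs"
  by (simp add: fidx_def)

section \<open>The twisted bar boundary squares to zero\<close>

lemma fidx_in_indices:
  assumes "k \<in> indices (Suc n) p r" "i \<le> Suc n"
  shows "fidx i k \<in> indices n p r"
proof -
  obtain gs \<sigma> ls where k: "k = (gs, \<sigma>, ls)" by (cases k) auto
  note ix = assms(1)[unfolded k indices_def, simplified]
  then have hd: "hd gs \<in> carrier G" by (cases gs) auto
  show ?thesis
    using ix assms(2) hd set_lface[of gs i]
    by (auto simp: k fidx_def indices_def length_lface sact_closed \<Lambda>_conj)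
qed

lemma fcoeff_closed: "set gs \<subseteq> carrier G \<Longrightarrow> gs \<noteq> [] \<Longrightarrow> m \<in> M \<Longrightarrow> fcoeff i gs m \<in> M"
  by (cases gs) (auto simp: fcoeff_def M_act)

lemma bd_closed:
  assumes "c \<in> chains (Suc n) p r"
  shows "bd c \<in> chains n p r"
proof (rule chains_lin[OF assms])
  fix k :: "'a list \<times> 's list \<times> 'a list" and m assume k: "k \<in> indices (Suc n) p r" and m: "m \<in> M"
  obtain gs \<sigma> ls where eq: "k = (gs, \<sigma>, ls)" by (cases k) auto
  with k have gs: "gs \<noteq> []" "length gs = Suc n" "set gs \<subseteq> carrier G" by (auto simp: indices_def)
  show "bd_fun k m \<in> chains n p r"
    unfolding eq bd_fun_nonempty[OF gs(1)]
    by (intro chains_sum chains_alt chains_single fcoeff_closed fidx_in_indices)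
      (use k gs m eq in auto)
qed

lemma bd_chains_0: "c \<in> chains 0 p r \<Longrightarrow> bd c = 0"
  by (rule chains_eqI[where P = bd and Q = "\<lambda>_. 0"])
    (auto intro: additive_ops additive_intros simp: indices_def bd_fun_Nil)

text \<open>For \<open>j = 0\<close>, \<open>i = 1\<close> one side acts by the product of the first
  two entries and the other by these entries in turn, which agree for a right action. All other
  cases reduce to the simplicial identity of \<open>lface\<close>.\<close>

lemma fidx_fidx:
  assumes "(gs, \<sigma>, ls) \<in> indices n p r" "2 \<le> n" "j < i" "i \<le> n"
  shows "fidx j (fidx i (gs, \<sigma>, ls)) = fidx (i - 1) (fidx j (gs, \<sigma>, ls))"
    and "fcoeff j (lface (\<otimes>) i gs) (fcoeff i gs m) =
      fcoeff (i - 1) (lface (\<otimes>) j gs) (fcoeff j gs m)"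
proof -
  have gs: "set gs \<subseteq> carrier G" "length gs = n" and \<sigma>: "set \<sigma> \<subseteq> S"
    using assms by (auto simp: indices_def)
  have ls: "set ls \<subseteq> carrier G"
    by (rule indices_ls_carrier[OF assms(1)])
  from gs assms(2) obtain x y zs where eq: "gs = x # y # zs"
    by (cases gs; cases "tl gs") auto
  have xy: "x \<in> carrier G" "y \<in> carrier G" using gs eq by auto
  have lf: "lface (\<otimes>) j (lface (\<otimes>) i gs) = lface (\<otimes>) (i - 1) (lface (\<otimes>) j gs)"
    by (rule lface_lface) (use gs assms in auto)
  obtain i' where i: "i = Suc i'" using assms by (cases i) auto
  have "map (sact (inv y)) (map (sact (inv x)) \<sigma>) = map (sact (inv (x \<otimes> y))) \<sigma>"
    using \<sigma> xy by (auto simp: inv_mult_group sact_mult)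
  moreover have "map (\<lambda>l. inv y \<otimes> l \<otimes> y) (map (\<lambda>l. inv x \<otimes> l \<otimes> x) ls)
      = map (\<lambda>l. inv (x \<otimes> y) \<otimes> l \<otimes> (x \<otimes> y)) ls"
    using ls xy by (auto simp: conj_conj)
  ultimately show "fidx j (fidx i (gs, \<sigma>, ls)) = fidx (i - 1) (fidx j (gs, \<sigma>, ls))"
    using lf assms(3) by (cases i'; cases j) (auto simp: fidx_def i eq)
  show "fcoeff j (lface (\<otimes>) i gs) (fcoeff i gs m) =
      fcoeff (i - 1) (lface (\<otimes>) j gs) (fcoeff j gs m)"
    using xy assms(3) by (cases i'; cases j) (auto simp: fcoeff_def i eq act_mult)
qed

lemma bd_bd:
  assumes "c \<in> chains n p r"
  shows "bd (bd c) = 0"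
proof (rule chains_eqI[where P = "\<lambda>c. bd (bd c)" and Q = "\<lambda>_. 0", OF _ _ assms])
  fix gs :: "'a list" and \<sigma> :: "'s list" and ls :: "'a list" and m
  assume ix: "(gs, \<sigma>, ls) \<in> indices n p r" and m: "m \<in> M"
  have len: "length gs = n" using ix by (auto simp: indices_def)
  consider "n = 0" | "n = 1" | n' where "n = Suc (Suc n')"
    by (cases n; cases "n - 1") auto
  then show "bd (bd (Poly_Mapping.single (gs, \<sigma>, ls) m)) = 0"
  proof cases
    case 1
    then show ?thesis using len by (simp add: bd_fun_Nil)
  next
    case 2
    \<comment> \<open>In degree one every face has an empty bar part, where \<open>bd_fun\<close> is
      zero by definition.\<close>
    then have "fst (fidx i (gs, \<sigma>, ls)) = []" if "i \<le> 1" for i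
      using length_lface[of i gs "(\<otimes>)"] len that by (auto simp: fst_fidx)
    then have "bd_fun (fidx i (gs, \<sigma>, ls)) x = 0" if "i \<le> 1" for i x
      using that by (simp add: bd_fun_def)
    moreover have "gs \<noteq> []" using len 2 by auto
    ultimately show ?thesis using 2 len by (simp add: bd_fun_nonempty ops_sum ops_alt ops_diff)
  next
    case (3 n')
    then have ne: "gs \<noteq> []" using len by auto
    let ?F = "\<lambda>i j. Poly_Mapping.single (fidx j (fidx i (gs, \<sigma>, ls))) (fcoeff j (lface (\<otimes>) i gs) (fcoeff i gs m))"
    have inner: "bd_fun (fidx i (gs, \<sigma>, ls)) x =
        (\<Sum>j\<le>Suc n'. alt j (Poly_Mapping.single (fidx j (fidx i (gs, \<sigma>, ls))) (fcoeff j (lface (\<otimes>) i gs) x)))"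
      if "i \<le> Suc (Suc n')" for i x
    proof -
      have "length (lface (\<otimes>) i gs) = Suc n'"
        using that len 3 by (simp add: length_lface)
      then show ?thesis
        by (auto simp: bd_fun_def fst_fidx)
    qed
    have "bd (bd (Poly_Mapping.single (gs, \<sigma>, ls) m)) =
        (\<Sum>i\<le>Suc (Suc n'). \<Sum>j\<le>Suc n'. alt (i + j) (?F i j))"
      unfolding ops_single bd_fun_nonempty[OF ne] ops_sum ops_alt len 3
      by (intro sum.cong refl) (simp add: inner alt_sum del: sum.atMost_Suc)
    also have "\<dots> = 0"
      by (rule sum_alternating_faces_eq_0) (simp add: fidx_fidx[OF ix] 3)
    finally show ?thesis .
  qed
qed (auto intro: additive_compose additive_ops additive_intros)

section \<open>The augmented complex of tuples and its contraction\<close>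

lemma eps_closed:
  assumes "c \<in> chains n (Suc p) 0"
  shows "eps c \<in> chains n p 0"
proof (rule chains_lin[OF assms])
  fix k :: "'a list \<times> 's list \<times> 'a list" and m assume k: "k \<in> indices n (Suc p) 0" and m: "m \<in> M"
  obtain gs \<sigma> ls where eq: "k = (gs, \<sigma>, ls)" by (cases k) auto
  have "(gs, del i \<sigma>, ls) \<in> indices n p 0" if "i < length \<sigma>" for i
    using k that order.trans[OF set_del[of i \<sigma>]] by (simp add: eq indices_def length_del)
  then show "eps_fun k m \<in> chains n p 0"
    using m by (auto simp: eq eps_fun intro!: chains_sum chains_alt chains_single)
qed

lemma eps_eps: "eps (eps c) = 0"
proof (rule additive_eq_on_keys[where P = "\<lambda>c. eps (eps c)" and Q = "\<lambda>_. 0"])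
  fix k :: "'a list \<times> 's list \<times> 'a list"
  define m where "m = Poly_Mapping.lookup c k"
  obtain gs \<sigma> ls where k: "k = (gs, \<sigma>, ls)" by (cases k) auto
  consider "length \<sigma> = 0" | "length \<sigma> = 1" | n' where "length \<sigma> = Suc (Suc n')"
    by (cases \<sigma>; cases "tl \<sigma>") auto
  then have "eps (eps (Poly_Mapping.single (gs, \<sigma>, ls) m)) = 0"
  proof cases
    case 2
    then obtain s where "\<sigma> = [s]" by (cases \<sigma>) auto
    then show ?thesis by (simp add: eps_fun)
  next
    case (3 n')
    have inner: "eps_fun (gs, del i \<sigma>, ls) m =
        (\<Sum>j\<le>n'. alt j (Poly_Mapping.single (gs, del j (del i \<sigma>), ls) m))" if "i \<le> Suc n'" for i
      using that 3 by (simp add: eps_fun length_del lessThan_Suc_atMost)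
    have "eps (eps (Poly_Mapping.single (gs, \<sigma>, ls) m)) =
        (\<Sum>i\<le>Suc n'. alt i (eps_fun (gs, del i \<sigma>, ls) m))"
      by (simp add: eps_fun ops_sum ops_alt 3 lessThan_Suc_atMost del: sum.atMost_Suc sum.lessThan_Suc)
    also have "\<dots> = (\<Sum>i\<le>Suc n'. \<Sum>j\<le>n'. alt (i + j) (Poly_Mapping.single (gs, del j (del i \<sigma>), ls) m))"
      by (intro sum.cong refl) (simp add: inner alt_sum del: sum.atMost_Suc)
    also have "\<dots> = 0"
      by (rule sum_alternating_faces_eq_0) (simp add: del_del 3)
    finally show ?thesis .
  qed (simp add: eps_fun)
  then show "eps (eps (Poly_Mapping.single k (Poly_Mapping.lookup c k))) = 0"
    by (simp add: k m_def)
qed (auto intro: additive_compose additive_ops additive_intros)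

lemma bd_eps: "c \<in> chains n p r \<Longrightarrow> bd (eps c) = eps (bd c)"
proof (rule chains_eqI[where P = "\<lambda>c. bd (eps c)" and Q = "\<lambda>c. eps (bd c)"])
  fix gs :: "'a list" and \<sigma> :: "'s list" and ls :: "'a list" and m
  assume ix: "(gs, \<sigma>, ls) \<in> indices n p r" and m: "m \<in> M"
  show "bd (eps (Poly_Mapping.single (gs, \<sigma>, ls) m)) = eps (bd (Poly_Mapping.single (gs, \<sigma>, ls) m))"
  proof (cases "gs = []")
    case False
    have len: "eps_fun (fidx i (gs, \<sigma>, ls)) x =
        (\<Sum>j<length \<sigma>. alt j (Poly_Mapping.single (fidx i (gs, del j \<sigma>, ls)) x))" for i x
      by (auto simp: eps_fun fidx_def map_del)
    have "bd (eps (Poly_Mapping.single (gs, \<sigma>, ls) m)) =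
       (\<Sum>j<length \<sigma>. \<Sum>i\<le>length gs. alt (j + i) (Poly_Mapping.single (fidx i (gs, del j \<sigma>, ls)) (fcoeff i gs m)))"
      by (simp add: eps_fun ops_sum ops_alt bd_fun_nonempty[OF False] alt_sum)
    also have "\<dots> = (\<Sum>i\<le>length gs. \<Sum>j<length \<sigma>. alt (i + j) (Poly_Mapping.single (fidx i (gs, del j \<sigma>, ls)) (fcoeff i gs m)))"
      by (subst sum.swap) (simp add: add.commute)
    also have "\<dots> = eps (bd (Poly_Mapping.single (gs, \<sigma>, ls) m))"
      by (simp add: bd_fun_nonempty[OF False] ops_sum ops_alt alt_sum len)
    finally show ?thesis .
  qed (simp add: bd_fun_Nil eps_fun ops_sum ops_alt)
qed (auto intro: additive_compose additive_ops)

lemma kap_closed: "c \<in> chains n p 0 \<Longrightarrow> kap c \<in> chains n (Suc p) 0"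
  by (erule chains_lin) (auto simp: kap_fun indices_def s0 intro!: chains_single)

lemma eps_kap: "eps (kap c) = c - kap (eps c)"
proof (rule additive_eq_on_keys[where P = "\<lambda>c. eps (kap c)" and Q = "\<lambda>c. c - kap (eps c)"])
  fix k :: "'a list \<times> 's list \<times> 'a list"
  define m where "m = Poly_Mapping.lookup c k"
  obtain gs \<sigma> ls where k: "k = (gs, \<sigma>, ls)" by (cases k) auto
  have "eps (kap (Poly_Mapping.single k m)) = Poly_Mapping.single k m - kap (eps (Poly_Mapping.single k m))"
    by (simp add: k kap_fun eps_fun ops_sum ops_alt sum.lessThan_Suc_shift sum_negf del: sum.lessThan_Suc)
  then show "eps (kap (Poly_Mapping.single k (Poly_Mapping.lookup c k))) =
      Poly_Mapping.single k (Poly_Mapping.lookup c k) - kap (eps (Poly_Mapping.single k (Poly_Mapping.lookup c k)))"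
    by (simp add: m_def)
qed (rule additive_compose[OF additive_ops(2) additive_ops(3)]
    additive_diff_fun[OF additive_id additive_compose[OF additive_ops(3) additive_ops(2)]])+

section \<open>Difference operators, their splitting and the prism homotopy\<close>

lemma dlt_bd:
  assumes "c \<in> chains n p r" "i < r"
  shows "dlt i (bd c) = bd (dlt i c)"
proof (rule chains_eqI[where P = "\<lambda>c. dlt i (bd c)" and Q = "\<lambda>c. bd (dlt i c)", OF _ _ assms(1)])
  fix gs :: "'a list" and \<sigma> :: "'s list" and ls :: "'a list" and m
  assume ix: "(gs, \<sigma>, ls) \<in> indices n p r" and m: "m \<in> M"
  show "dlt i (bd (Poly_Mapping.single (gs, \<sigma>, ls) m)) = bd (dlt i (Poly_Mapping.single (gs, \<sigma>, ls) m))"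
  proof (cases "gs = []")
    case False
    then have g: "hd gs \<in> carrier G" using ix by (cases gs) (auto simp: indices_def)
    have i: "i < length ls" using ix assms(2) by (auto simp: indices_def)
    then have l: "ls ! i \<in> carrier G" using indices_ls_carrier[OF ix] by auto
    \<comment> \<open>This is why face \<open>0\<close> conjugates \<open>ls\<close>: acting by a
      group element and then by the conjugated entry equals acting by the entry and then by that
      element.\<close>
    have "hd gs \<otimes> (inv (hd gs) \<otimes> ls ! i \<otimes> hd gs) = ls ! i \<otimes> hd gs"
      using g l by (simp add: m_assoc[symmetric])
    then have "dlt_fun i (fidx j (gs, \<sigma>, ls)) (fcoeff j gs m)
        = Poly_Mapping.single (fidx j (gs, \<sigma>, ls[i := \<one>])) (fcoeff j gs (act m (ls ! i) - m))" for j
      using g l i by (cases "j = 0")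
        (simp_all add: dlt_fun fidx_def fcoeff_def map_update act_mult act_diff)
    then show ?thesis
      by (simp add: dlt_fun bd_fun_nonempty[OF False] ops_sum ops_alt)
  qed (simp add: dlt_fun bd_fun_Nil)
qed (rule additive_compose[OF additive_ops(4) additive_ops(1)]
    additive_compose[OF additive_ops(1) additive_ops(4)])+

text \<open>Together with \<open>pop_dlt\<close> this shows that \<open>dhd\<close> and
  \<open>dlt 0\<close> vanish on the same chains.\<close>

lemma push_dhd:
  assumes "c \<in> chains n p (Suc r)"
  shows "lin push_fun (dhd c) = dlt 0 c"
proof (rule chains_eqI[where P = "\<lambda>c. lin push_fun (dhd c)", OF _ _ assms])
  fix gs :: "'a list" and \<sigma> :: "'s list" and ls :: "'a list" and m
  assume "(gs, \<sigma>, ls) \<in> indices n p (Suc r)"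
  then obtain l ls' where "ls = l # ls'" by (cases ls) (auto simp: indices_def)
  then show "lin push_fun (dhd (Poly_Mapping.single (gs, \<sigma>, ls) m)) =
      dlt 0 (Poly_Mapping.single (gs, \<sigma>, ls) m)"
    by (simp add: push_fun dhd_fun dlt_fun)
qed (rule additive_compose[OF additive_ops(6) additive_ops(5)] additive_ops(4))+

lemma pop_dlt:
  assumes "c \<in> chains n p (Suc r)"
  shows "lin pop_fun (dlt 0 c) = dhd c"
proof (rule chains_eqI[where P = "\<lambda>c. lin pop_fun (dlt 0 c)", OF _ _ assms])
  fix gs :: "'a list" and \<sigma> :: "'s list" and ls :: "'a list" and m
  assume "(gs, \<sigma>, ls) \<in> indices n p (Suc r)"
  then obtain l ls' where "ls = l # ls'" by (cases ls) (auto simp: indices_def)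
  then show "lin pop_fun (dlt 0 (Poly_Mapping.single (gs, \<sigma>, ls) m)) =
      dhd (Poly_Mapping.single (gs, \<sigma>, ls) m)"
    by (simp add: pop_fun dhd_fun dlt_fun)
qed (rule additive_compose[OF additive_ops(7) additive_ops(4)] additive_ops(5))+

lemma dhd_bd:
  assumes "c \<in> chains n p (Suc r)"
  shows "dhd (bd c) = bd (dhd c)"
proof (rule chains_eqI[where P = "\<lambda>c. dhd (bd c)" and Q = "\<lambda>c. bd (dhd c)", OF _ _ assms])
  fix gs :: "'a list" and \<sigma> :: "'s list" and ls :: "'a list" and m
  assume ix: "(gs, \<sigma>, ls) \<in> indices n p (Suc r)" and m: "m \<in> M"
  then obtain l ls' where ls: "ls = l # ls'" by (cases ls) (auto simp: indices_def)
  show "dhd (bd (Poly_Mapping.single (gs, \<sigma>, ls) m)) = bd (dhd (Poly_Mapping.single (gs, \<sigma>, ls) m))"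
  proof (cases "gs = []")
    case False
    then have g: "hd gs \<in> carrier G" using ix by (cases gs) (auto simp: indices_def)
    have l: "l \<in> carrier G" using indices_ls_carrier[OF ix] ls by auto
    have "hd gs \<otimes> (inv (hd gs) \<otimes> l \<otimes> hd gs) = l \<otimes> hd gs"
      using g l by (simp add: m_assoc[symmetric])
    then have "dhd_fun (fidx j (gs, \<sigma>, ls)) (fcoeff j gs m)
        = Poly_Mapping.single (fidx j (gs, \<sigma>, ls')) (fcoeff j gs (act m l - m))" for j
      using g l by (cases "j = 0")
        (simp_all add: ls dhd_fun fidx_def fcoeff_def act_mult act_diff)
    then show ?thesis
      by (simp add: ls dhd_fun bd_fun_nonempty[OF False] ops_sum ops_alt)
  qed (simp add: dhd_fun bd_fun_Nil)
qed (rule additive_compose[OF additive_ops(5) additive_ops(1)]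
    additive_compose[OF additive_ops(1) additive_ops(5)])+

lemma lift_closed:
  assumes "c \<in> chains n p r" "0 < p"
  shows "lift c \<in> chains n p (Suc r)"
proof (rule chains_lin[OF assms(1)])
  fix k :: "'a list \<times> 's list \<times> 'a list" and m assume k: "k \<in> indices n p r" and m: "m \<in> M"
  obtain gs \<sigma> ls where eq: "k = (gs, \<sigma>, ls)" by (cases k) auto
  have \<sigma>: "\<sigma> \<noteq> []" "set \<sigma> \<subseteq> S" and r: "length ls = r"
    using k assms(2) by (auto simp: eq indices_def)
  \<comment> \<open>The new entry has index \<open>0\<close> in a list of length
    \<open>r + 1\<close> and so belongs to cell \<open>r\<close>; the old entries keep their
    cells.\<close>
  have "(gs, \<sigma>, s # ls) \<in> indices n p (Suc r)" if "s \<in> F \<sigma> r" for s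
  proof -
    have "s \<in> \<Lambda> \<sigma> r" using F_subset[OF \<sigma>] that by blast
    then show ?thesis using k
      by (auto simp: eq indices_def nth_Cons split: nat.split)
  qed
  then show "lift_fun k m \<in> chains n p (Suc r)"
    using m by (auto simp: eq lift_fun r intro!: chains_sum chains_single T_closed \<sigma>)
qed

lemma dhd_lift:
  assumes "c \<in> chains n p r" "0 < p"
  shows "dhd (lift c) = c"
proof (rule chains_eqI[where P = "\<lambda>c. dhd (lift c)" and Q = "\<lambda>c. c", OF _ _ assms(1)])
  fix gs :: "'a list" and \<sigma> :: "'s list" and ls :: "'a list" and m
  assume ix: "(gs, \<sigma>, ls) \<in> indices n p r" and m: "m \<in> M"
  have \<sigma>: "\<sigma> \<noteq> []" "set \<sigma> \<subseteq> S" using ix assms(2) by (auto simp: indices_def)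
  have "dhd (lift (Poly_Mapping.single (gs, \<sigma>, ls) m)) =
      (\<Sum>s\<in>F \<sigma> (length ls). Poly_Mapping.single (gs, \<sigma>, ls) (act (T \<sigma> (length ls) m) s - T \<sigma> (length ls) m))"
    by (simp add: lift_fun dhd_fun ops_sum)
  also have "\<dots> = Poly_Mapping.single (gs, \<sigma>, ls) (\<Sum>s\<in>F \<sigma> (length ls). act (T \<sigma> (length ls) m) s - T \<sigma> (length ls) m)"
    by (rule additive.sum[OF additive_single[OF additive_id], symmetric])
  also have "\<dots> = Poly_Mapping.single (gs, \<sigma>, ls) m"
    by (simp add: T_inverse[OF \<sigma> m])
  finally show "dhd (lift (Poly_Mapping.single (gs, \<sigma>, ls) m)) = Poly_Mapping.single (gs, \<sigma>, ls) m" .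
qed (rule additive_compose[OF additive_ops(5) additive_ops(8)] additive_id)+

text \<open>The new entry belongs to cell \<open>r\<close> and the old entries to cells of smaller
  number, so \<open>T_act\<close> moves the solution past the action of an old entry.\<close>

lemma dlt_lift:
  assumes "c \<in> chains n p r" "0 < p" "i < r"
  shows "dlt (Suc i) (lift c) = lift (dlt i c)"
proof (rule chains_eqI[where P = "\<lambda>c. dlt (Suc i) (lift c)" and Q = "\<lambda>c. lift (dlt i c)", OF _ _ assms(1)])
  fix gs :: "'a list" and \<sigma> :: "'s list" and ls :: "'a list" and m
  assume ix: "(gs, \<sigma>, ls) \<in> indices n p r" and m: "m \<in> M"
  have \<sigma>: "\<sigma> \<noteq> []" "set \<sigma> \<subseteq> S" and r: "length ls = r" and l: "ls ! i \<in> \<Lambda> \<sigma> (r - Suc i)"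
    using ix assms(2,3) by (auto simp: indices_def)
  have "T \<sigma> r (act m (ls ! i)) = act (T \<sigma> r m) (ls ! i)"
    by (rule T_act[OF \<sigma> m l]) (use assms(3) in auto)
  then show "dlt (Suc i) (lift (Poly_Mapping.single (gs, \<sigma>, ls) m)) =
      lift (dlt i (Poly_Mapping.single (gs, \<sigma>, ls) m))"
    by (simp add: lift_fun dlt_fun ops_sum r T_diff)
qed (rule additive_compose[OF additive_ops(4) additive_ops(8)]
    additive_compose[OF additive_ops(8) additive_ops(4)])+

lemma prism_closed:
  assumes "c \<in> chains n p (Suc r)"
  shows "prism c \<in> chains (Suc n) p r"
proof (rule chains_lin[OF assms(1)])
  fix k :: "'a list \<times> 's list \<times> 'a list" and m assume k: "k \<in> indices n p (Suc r)" and m: "m \<in> M"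
  obtain gs \<sigma> ls where eq: "k = (gs, \<sigma>, ls)" by (cases k) auto
  obtain l ls' where ls: "ls = l # ls'" using k by (cases ls) (auto simp: eq indices_def)
  have l: "l \<in> carrier G" using indices_ls_carrier[OF k[unfolded eq]] by (auto simp: ls)
  have "ls' ! i \<in> \<Lambda> \<sigma> (r - Suc i)" if "i < r" for i
  proof -
    have "ls ! Suc i \<in> \<Lambda> \<sigma> (Suc r - Suc (Suc i))"
      using k that unfolding eq indices_def by blast
    then show ?thesis by (simp add: ls)
  qed
  then have "(ins j l gs, \<sigma>, ls') \<in> indices (Suc n) p r" for j
    using k l set_ins[of gs l j] by (auto simp: eq ls indices_def)
  then show "prism_fun k m \<in> chains (Suc n) p r"
    using m by (auto simp: eq ls prism_fun intro!: chains_sum chains_alt chains_single)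
qed

lemma dlt_prism:
  assumes "c \<in> chains n p (Suc r)"
  shows "dlt i (prism c) = prism (dlt (Suc i) c)"
proof (rule chains_eqI[where P = "\<lambda>c. dlt i (prism c)" and Q = "\<lambda>c. prism (dlt (Suc i) c)", OF _ _ assms])
  fix gs :: "'a list" and \<sigma> :: "'s list" and ls :: "'a list" and m
  assume "(gs, \<sigma>, ls) \<in> indices n p (Suc r)"
  then obtain l ls' where "ls = l # ls'" by (cases ls) (auto simp: indices_def)
  then show "dlt i (prism (Poly_Mapping.single (gs, \<sigma>, ls) m)) =
      prism (dlt (Suc i) (Poly_Mapping.single (gs, \<sigma>, ls) m))"
    by (simp add: prism_fun dlt_fun ops_sum ops_alt)
qed (rule additive_compose[OF additive_ops(4) additive_ops(9)]
    additive_compose[OF additive_ops(9) additive_ops(4)])+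

text \<open>
  Conjugation by an element acts trivially on group homology. The prism operator is the standard
  homotopy; its two ends are \<open>m \<mapsto> m \<cdot> l\<close> and \<open>m \<mapsto> m\<close> because the entry \<open>l\<close> fixes \<open>\<sigma>\<close> and commutes
  with the remaining entries of \<open>ls\<close>.
\<close>

lemma bd_prism:
  assumes "c \<in> chains n p (Suc r)"
  shows "bd (prism c) + prism (bd c) = dhd c"
proof (rule chains_eqI[where P = "\<lambda>c. bd (prism c) + prism (bd c)", OF _ _ assms])
  fix gs :: "'a list" and \<sigma> :: "'s list" and ls :: "'a list" and m
  assume ix: "(gs, \<sigma>, ls) \<in> indices n p (Suc r)" and m: "m \<in> M"
  then obtain l ls' where ls: "ls = l # ls'" by (cases ls) (auto simp: indices_def)
  have gs: "set gs \<subseteq> carrier G" "length gs = n" and \<sigma>: "set \<sigma> \<subseteq> S" and l: "l \<in> \<Lambda> \<sigma> r"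
    using ix by (auto simp: indices_def ls)
  have lc: "l \<in> carrier G" and lsc: "set ls' \<subseteq> carrier G"
    using indices_ls_carrier[OF ix] ls by auto
  have conj: "inv l \<otimes> x \<otimes> l = x" if "x \<in> set ls'" for x
  proof -
    from that obtain i where i: "i < length ls'" "x = ls' ! i" by (auto simp: in_set_conv_nth)
    have len: "length ls' = r" using ix by (auto simp: indices_def ls)
    have "ls ! Suc i \<in> \<Lambda> \<sigma> (Suc r - Suc (Suc i))"
      using ix i len unfolding indices_def by blast
    then have "x \<in> \<Lambda> \<sigma> (r - Suc i)" by (simp add: ls i)
    then have "x \<otimes> l = l \<otimes> x"
      by (rule \<Lambda>_commute[OF \<sigma> _ l]) (use i len in auto)
    moreover have "x \<in> carrier G" using lsc that by auto
    ultimately show ?thesis using lc by (simp add: m_assoc) (simp add: m_assoc[symmetric])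
  qed
  \<comment> \<open>\<open>D\<close> inserts first and then takes a face, while \<open>E\<close>
    takes the face first. In \<open>E\<close> with \<open>i = 0\<close> the inserted entry has
    already been conjugated by \<open>hd gs\<close>.\<close>
  define D where "D i j = Poly_Mapping.single (fidx i (ins j l gs, \<sigma>, ls')) (fcoeff i (ins j l gs) m)" for i j
  define E where "E j i = (case fidx i (gs, \<sigma>, ls) of (gs', \<sigma>', ls'') \<Rightarrow>
      Poly_Mapping.single (ins j (hd ls'') gs', \<sigma>', tl ls'') (fcoeff i gs m))" for j i
  have "(\<Sum>i\<le>Suc n. \<Sum>j\<le>n. alt (i + j) (D i j)) + (\<Sum>i\<le>n. \<Sum>j<n. alt (i + j) (E j i))
      = D 0 0 - D (Suc n) n"
  proof (rule sum_alternating_prism)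
    fix i j assume ij: "i < j" "j \<le> n"
    show "D i j = E (j - 1) i"
    proof (cases "i = 0")
      case True
      then show ?thesis using ij gs
        by (simp add: D_def E_def fidx_def fcoeff_def ls hd_ins lface_0_ins)
    next
      case False
      then show ?thesis using ij gs lc
        by (simp add: D_def E_def fidx_def fcoeff_def ls lface_ins_less)
    qed
  next
    fix i j assume ij: "Suc j < i" "i \<le> Suc n"
    then show "D i j = E j (i - 1)"
      using gs lc by (simp add: D_def E_def fidx_def fcoeff_def ls lface_ins_greater)
  next
    fix j assume "j < n"
    then show "D (Suc j) (Suc j) = D (Suc j) j"
      using gs lc by (simp add: D_def fidx_def fcoeff_def lface_ins_diag)
  qed
  moreover have "bd (prism (Poly_Mapping.single (gs, \<sigma>, ls) m)) = (\<Sum>i\<le>Suc n. \<Sum>j\<le>n. alt (i + j) (D i j))"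
  proof -
    have "bd (prism (Poly_Mapping.single (gs, \<sigma>, ls) m)) = (\<Sum>j\<le>n. \<Sum>i\<le>Suc n. alt (j + i) (D i j))"
      by (simp add: prism_fun ls gs(2) ops_sum ops_alt bd_fun_nonempty alt_sum D_def del: sum.atMost_Suc)
    also have "\<dots> = (\<Sum>i\<le>Suc n. \<Sum>j\<le>n. alt (i + j) (D i j))"
      by (subst sum.swap) (simp add: add.commute del: sum.atMost_Suc)
    finally show ?thesis .
  qed
  moreover have "prism (bd (Poly_Mapping.single (gs, \<sigma>, ls) m)) = (\<Sum>i\<le>n. \<Sum>j<n. alt (i + j) (E j i))"
  proof (cases "gs = []")
    case False
    then obtain n' where n': "n = Suc n'" using gs by (cases n) auto
    have "prism_fun (fidx i (gs, \<sigma>, ls)) (fcoeff i gs m) = (\<Sum>j<n. alt j (E j i))" if "i \<le> n" for i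
      using that gs n' by (auto simp: fidx_def prism_fun E_def length_lface lessThan_Suc_atMost)
    then show ?thesis
      by (simp add: bd_fun_nonempty[OF False] gs(2) ops_sum ops_alt alt_sum)
  qed (use gs in \<open>simp add: bd_fun_Nil\<close>)
  moreover have "D 0 0 = Poly_Mapping.single (gs, \<sigma>, ls') (act m l)"
    using \<Lambda>_fix[OF \<sigma> l] conj by (simp add: D_def fidx_def fcoeff_def map_idI)
  moreover have "D (Suc n) n = Poly_Mapping.single (gs, \<sigma>, ls') m"
    using lface_ins_last[of gs l] gs by (simp add: D_def fidx_def fcoeff_def)
  ultimately show "bd (prism (Poly_Mapping.single (gs, \<sigma>, ls) m)) + prism (bd (Poly_Mapping.single (gs, \<sigma>, ls) m))
      = dhd (Poly_Mapping.single (gs, \<sigma>, ls) m)"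
    by (simp add: dhd_fun ls single_diff)
qed (rule additive_add_fun[OF additive_compose[OF additive_ops(1) additive_ops(9)]
    additive_compose[OF additive_ops(9) additive_ops(1)]] additive_ops(5))+

text \<open>Induction on \<open>n\<close>, for all \<open>r\<close> at once, inside the common
  kernel of the differences. The defect \<open>bd (lift c)\<close> lies in the common kernel for one
  more entry, so the induction hypothesis corrects the lift to a cycle \<open>z\<close> with
  \<open>dhd z = c\<close>, and the prism homotopy bounds \<open>dhd z\<close>. The condition
  \<open>0 < p\<close> provides a nonempty tuple, hence cells.\<close>

lemma exact_conj:
  assumes "0 < p"
  shows "c \<in> chains n p r \<Longrightarrow> bd c = 0 \<Longrightarrow> (\<And>i. i < r \<Longrightarrow> dlt i c = 0) \<Longrightarrow>
    \<exists>c'\<in>chains (Suc n) p r. (\<forall>i<r. dlt i c' = 0) \<and> bd c' = c"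
proof (induction n arbitrary: r c)
  case (0 r c)
  have x: "lift c \<in> chains 0 p (Suc r)" by (rule lift_closed[OF 0(1) assms])
  have "bd (prism (lift c)) = c"
    using bd_prism[OF x] by (simp add: bd_chains_0[OF x] dhd_lift[OF 0(1) assms])
  moreover have "dlt i (prism (lift c)) = 0" if "i < r" for i
    by (simp add: dlt_prism[OF x] dlt_lift[OF 0(1) assms that] 0(3)[OF that])
  ultimately show ?case
    using prism_closed[OF x] by blast
next
  case (Suc n r c)
  have x: "lift c \<in> chains (Suc n) p (Suc r)" by (rule lift_closed[OF Suc(2) assms])
  have y: "bd (lift c) \<in> chains n p (Suc r)" by (rule bd_closed[OF x])
  \<comment> \<open>Index \<open>0\<close> is the new entry, where the difference is
    \<open>dhd\<close> up to \<open>push_fun\<close>; index \<open>i' + 1\<close> is the old entry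
    \<open>i'\<close>, whose difference already kills \<open>c\<close>.\<close>
  have "dlt i (bd (lift c)) = 0" if "i < Suc r" for i
  proof (cases i)
    case 0
    have "dhd (bd (lift c)) = 0"
      by (simp add: dhd_bd[OF x] dhd_lift[OF Suc(2) assms] Suc(3))
    then show ?thesis using push_dhd[OF y] 0 by simp
  next
    case (Suc i')
    then have "i' < r" using that by simp
    then show ?thesis
      using Suc dlt_bd[OF x that] dlt_lift[OF Suc.prems(1) assms, of i'] Suc.prems(3) by simp
  qed
  then obtain w where w: "w \<in> chains (Suc n) p (Suc r)" "\<And>i. i < Suc r \<Longrightarrow> dlt i w = 0" "bd w = bd (lift c)"
    using Suc.IH[OF y bd_bd[OF x]] by blast
  define z where "z = lift c - w"
  have z: "z \<in> chains (Suc n) p (Suc r)" and bz: "bd z = 0"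
    using w by (auto simp: z_def chains_diff x ops_diff)
  have "dhd w = 0" using pop_dlt[OF w(1)] w(2)[of 0] by simp
  then have dz: "dhd z = c" by (simp add: z_def ops_diff dhd_lift[OF Suc(2) assms])
  have "bd (prism z) = c" using bd_prism[OF z] by (simp add: bz dz)
  \<comment> \<open>\<open>prism\<close> consumes the front entry, so index \<open>i\<close> after
    it is index \<open>i + 1\<close> before it; this spares \<open>dlt 0\<close>, which need not
    kill \<open>z\<close>.\<close>
  moreover have "dlt i (prism z) = 0" if "i < r" for i
    unfolding dlt_prism[OF z] using w(2)[of "Suc i"] that
    by (simp add: z_def ops_diff dlt_lift[OF Suc(2) assms that] Suc(4)[OF that])
  ultimately show ?case
    using prism_closed[OF z] by blast
qed

text \<open>The dimension shift. The preimage \<open>kap c\<close> of \<open>c\<close> under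
  \<open>eps\<close> is corrected to a cycle by the induction hypothesis for longer tuples, and that
  cycle bounds by \<open>exact_conj\<close> with \<open>r = 0\<close>. Applying \<open>eps\<close>
  to the bounding chain finishes, as \<open>eps\<close> commutes with \<open>bd\<close> and squares
  to zero.\<close>

lemma exact_aug:
  "c \<in> chains n p 0 \<Longrightarrow> bd c = 0 \<Longrightarrow> eps c = 0 \<Longrightarrow>
    \<exists>c'\<in>chains (Suc n) p 0. eps c' = 0 \<and> bd c' = c"
proof (induction n arbitrary: p c)
  case (0 p c)
  have x: "kap c \<in> chains 0 (Suc p) 0" by (rule kap_closed[OF 0(1)])
  have "eps (kap c) = c" by (simp add: eps_kap 0)
  moreover obtain y where y: "y \<in> chains (Suc 0) (Suc p) 0" "bd y = kap c"
    using exact_conj[OF _ x bd_chains_0[OF x]] by auto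
  ultimately show ?case
    using eps_closed[OF y(1)] bd_eps[OF y(1)] eps_eps[of y] by metis
next
  case (Suc n p c)
  have x: "kap c \<in> chains (Suc n) (Suc p) 0" by (rule kap_closed[OF Suc(2)])
  have ek: "eps (kap c) = c" by (simp add: eps_kap Suc)
  have "eps (bd (kap c)) = 0" by (simp add: bd_eps[OF x, symmetric] ek Suc)
  then obtain w where w: "w \<in> chains (Suc n) (Suc p) 0" "eps w = 0" "bd w = bd (kap c)"
    using Suc.IH[OF bd_closed[OF x] bd_bd[OF x]] by blast
  have z: "kap c - w \<in> chains (Suc n) (Suc p) 0" "bd (kap c - w) = 0" "eps (kap c - w) = c"
    using w ek by (auto simp: chains_diff x ops_diff)
  obtain y where y: "y \<in> chains (Suc (Suc n)) (Suc p) 0" "bd y = kap c - w"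
    using exact_conj[OF _ z(1,2)] by auto
  then show ?case
    using eps_closed[OF y(1)] bd_eps[OF y(1)] eps_eps[of y] z(3) by metis
qed

section \<open>Return to the bar complex with coefficients in \<open>M\<close>\<close>

definition emb_fun :: "'a list \<Rightarrow> 'm \<Rightarrow> ('a list \<times> 's list \<times> 'a list \<Rightarrow>\<^sub>0 'm)" where
  "emb_fun gs m = Poly_Mapping.single (gs, [], []) m"

definition pr_fun :: "'a list \<times> 's list \<times> 'a list \<Rightarrow> 'm \<Rightarrow> ('a list \<Rightarrow>\<^sub>0 'm)" where
  "pr_fun k m = Poly_Mapping.single (fst k) m"

definition bar_fun :: "'a list \<Rightarrow> 'm \<Rightarrow> ('a list \<Rightarrow>\<^sub>0 'm)" where
  "bar_fun gs m = (if gs = [] then 0 else \<Sum>i\<le>length gs. alt i (bar_face G act i gs m))"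

lemma bar_face_eq: "gs \<noteq> [] \<Longrightarrow> i \<le> length gs \<Longrightarrow>
    bar_face G act i gs m = Poly_Mapping.single (lface (\<otimes>) i gs) (fcoeff i gs m)"
  using lface_length[of "(\<otimes>)" gs] by (cases gs) (auto simp: bar_face_def fcoeff_def lface_middle)

lemma additive_bar: "additive (emb_fun gs)" "additive (pr_fun k)" "additive (bar_fun gs)"
proof -
  have "additive (\<lambda>m. bar_face G act i gs m)" if "gs \<noteq> []" "i \<le> length gs" for i
    using that by (simp add: bar_face_eq additive_single additive_fcoeff)
  then have "additive (\<lambda>m. \<Sum>i\<le>length gs. alt i (bar_face G act i gs m))" if "gs \<noteq> []"
    using that by (auto simp: additive_def sum.distrib[symmetric] alt_add[symmetric] intro!: sum.cong)
  then show "additive (bar_fun gs)"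
    by (cases "gs = []") (auto simp: bar_fun_def[abs_def] additive_const_0)
qed (auto simp: emb_fun_def[abs_def] pr_fun_def[abs_def] intro!: additive_intros)

lemmas bar_single [simp] = additive_bar[THEN lin_single_additive]
lemmas bar_sum = additive_bar[THEN additive_lin, THEN additive.sum]
lemmas bar_alt = additive_bar[THEN additive_lin, THEN additive_alt]
lemmas bar_zero [simp] = additive_bar[THEN additive_lin, THEN additive.zero]

lemma bar_boundary_eq: "bar_boundary G act c = lin bar_fun c"
proof -
  have "lin bar_fun c = (\<Sum>gs\<in>Poly_Mapping.keys c - {[]}. bar_fun gs (Poly_Mapping.lookup c gs))"
    unfolding lin_def by (rule sum.mono_neutral_right) (auto simp: bar_fun_def)
  then show ?thesis
    by (auto simp: bar_boundary_def bar_fun_def alt_def intro!: sum.cong)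
qed

lemma emb_closed:
  assumes "c \<in> bar_chains G M n"
  shows "lin emb_fun c \<in> chains n 0 0"
  unfolding lin_def emb_fun_def using assms
  by (intro chains_sum chains_single) (auto simp: bar_chains_def indices_def)

lemma bar_chains_0: "0 \<in> bar_chains G M n"
  by (simp add: bar_chains_def M_0)

lemma bar_chains_diff: "c \<in> bar_chains G M n \<Longrightarrow> d \<in> bar_chains G M n \<Longrightarrow> c - d \<in> bar_chains G M n"
  using keys_diff[of c d] by (fastforce simp: bar_chains_def lookup_minus M_diff)

lemma bar_chains_add: "c \<in> bar_chains G M n \<Longrightarrow> d \<in> bar_chains G M n \<Longrightarrow> c + d \<in> bar_chains G M n"
  using bar_chains_diff[OF _ bar_chains_diff[OF bar_chains_0]] by fastforce

lemma pr_closed: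
  assumes "c \<in> chains n p r"
  shows "lin pr_fun c \<in> bar_chains G M n"
proof -
  have "length (fst k) = n \<and> set (fst k) \<subseteq> carrier G" if "k \<in> Poly_Mapping.keys c" for k
    using chainsD(1)[OF assms that] by (auto simp: indices_def)
  then have single: "Poly_Mapping.single (fst k) (Poly_Mapping.lookup c k) \<in> bar_chains G M n"
    if "k \<in> Poly_Mapping.keys c" for k
    using chainsD(2)[OF assms] that by (simp add: bar_chains_def lookup_single when_def M_0)
  have sum: "sum f A \<in> bar_chains G M n" if "\<And>k. k \<in> A \<Longrightarrow> f k \<in> bar_chains G M n"
    for f :: "'a list \<times> 's list \<times> 'a list \<Rightarrow> _" and A
    using that by (induction A rule: infinite_finite_induct) (auto simp: bar_chains_0 bar_chains_add)
  show ?thesis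
    unfolding lin_def pr_fun_def by (intro sum single)
qed

lemma emb_bar: "lin emb_fun (lin bar_fun c) = bd (lin emb_fun c)"
proof (rule additive_eq_on_keys[where P = "\<lambda>c. lin emb_fun (lin bar_fun c)" and Q = "\<lambda>c. bd (lin emb_fun c)"])
  fix gs
  have "lin emb_fun (lin bar_fun (Poly_Mapping.single gs m)) = bd (lin emb_fun (Poly_Mapping.single gs m))" for m
    by (cases "gs = []")
      (auto simp: bar_fun_def emb_fun_def bd_fun_Nil bd_fun_nonempty bar_sum bar_alt bar_face_eq fidx_def
        intro!: sum.cong)
  then show "lin emb_fun (lin bar_fun (Poly_Mapping.single gs (Poly_Mapping.lookup c gs))) =
      bd (lin emb_fun (Poly_Mapping.single gs (Poly_Mapping.lookup c gs)))" .
qed (rule additive_compose[OF additive_bar(1)[THEN additive_lin] additive_bar(3)[THEN additive_lin]]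
    additive_compose[OF additive_ops(1) additive_bar(1)[THEN additive_lin]])+

text \<open>The bar part of a face and its coefficient depend only on the bar part of the index, so
  \<open>\<sigma>\<close> and \<open>ls\<close> may be forgotten.\<close>

lemma pr_bd: "lin pr_fun (bd c) = lin bar_fun (lin pr_fun c)"
proof (rule additive_eq_on_keys[where P = "\<lambda>c. lin pr_fun (bd c)" and Q = "\<lambda>c. lin bar_fun (lin pr_fun c)"])
  fix k
  have "lin pr_fun (bd (Poly_Mapping.single k m)) = lin bar_fun (lin pr_fun (Poly_Mapping.single k m))" for m
    by (cases k; cases "fst k = []")
      (auto simp: bar_fun_def pr_fun_def bd_fun_def bar_sum bar_alt bar_face_eq fidx_def
        intro!: sum.cong)
  then show "lin pr_fun (bd (Poly_Mapping.single k (Poly_Mapping.lookup c k))) =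
      lin bar_fun (lin pr_fun (Poly_Mapping.single k (Poly_Mapping.lookup c k)))" .
qed (rule additive_compose[OF additive_bar(2)[THEN additive_lin] additive_ops(1)]
    additive_compose[OF additive_bar(3)[THEN additive_lin] additive_bar(2)[THEN additive_lin]])+

lemma pr_emb: "lin pr_fun (lin emb_fun c) = c"
proof (rule additive_eq_on_keys[where P = "\<lambda>c. lin pr_fun (lin emb_fun c)" and Q = "\<lambda>c. c"])
  fix gs
  have "lin pr_fun (lin emb_fun (Poly_Mapping.single gs m)) = Poly_Mapping.single gs m" for m
    by (simp add: emb_fun_def pr_fun_def)
  then show "lin pr_fun (lin emb_fun (Poly_Mapping.single gs (Poly_Mapping.lookup c gs))) =
      Poly_Mapping.single gs (Poly_Mapping.lookup c gs)" .
qed (rule additive_compose[OF additive_bar(2)[THEN additive_lin] additive_bar(1)[THEN additive_lin]] additive_id)+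

text \<open>The case of empty tuples in \<open>exact_aug\<close>; there \<open>eps\<close> is an
  empty sum, so its vanishing is automatic.\<close>

lemma cycle_is_boundary:
  assumes "c \<in> bar_cycles G M act n"
  shows "c \<in> bar_boundaries G M act n"
proof -
  let ?e = "lin emb_fun c"
  have c: "c \<in> bar_chains G M n" "lin bar_fun c = 0"
    using assms by (auto simp: bar_cycles_def bar_boundary_eq)
  have e: "?e \<in> chains n 0 0" by (rule emb_closed[OF c(1)])
  have "eps ?e = 0"
    by (rule chains_eqI[where P = eps and Q = "\<lambda>_. 0", OF additive_ops(2) additive_const_0 e])
      (auto simp: indices_def eps_fun)
  moreover have "bd ?e = 0" using emb_bar[of c] c(2) by simp
  ultimately obtain d where d: "d \<in> chains (Suc n) 0 0" "bd d = ?e"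
    using exact_aug[OF e] by blast
  then have "lin bar_fun (lin pr_fun d) = c" by (metis pr_bd pr_emb)
  then show ?thesis
    using pr_closed[OF d(1)] by (auto simp: bar_boundaries_def bar_boundary_eq)
qed

lemma bar_boundaries_diff:
  assumes "c \<in> bar_boundaries G M act n" "d \<in> bar_boundaries G M act n"
  shows "c - d \<in> bar_boundaries G M act n"
proof -
  obtain c' d' where "c' \<in> bar_chains G M (Suc n)" "c = lin bar_fun c'"
    "d' \<in> bar_chains G M (Suc n)" "d = lin bar_fun d'"
    using assms by (auto simp: bar_boundaries_def bar_boundary_eq)
  then have "c' - d' \<in> bar_chains G M (Suc n)" "c - d = lin bar_fun (c' - d')"
    by (auto simp: bar_chains_diff additive.diff[OF additive_lin[OF additive_bar(3)]])
  then show ?thesis by (auto simp: bar_boundaries_def bar_boundary_eq)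
qed

lemma trivial_group_homology: "trivial_group (group_homology n G M act)"
proof -
  let ?B = "bar_boundaries G M act n" and ?Z = "bar_cycles G M act n"
  let ?H = "\<lparr>carrier = ?Z, monoid.mult = (+), one = (0 :: 'a list \<Rightarrow>\<^sub>0 'm)\<rparr>"
  have Z0: "0 \<in> ?Z" by (simp add: bar_cycles_def bar_chains_0 bar_boundary_eq)
  have B0: "0 \<in> ?B" by (rule cycle_is_boundary[OF Z0])
  have Badd: "c + d \<in> ?B" if "c \<in> ?B" "d \<in> ?B" for c d
    using bar_boundaries_diff[OF that(1) bar_boundaries_diff[OF B0 that(2)]] by simp
  \<comment> \<open>As every cycle is a boundary, there is only one coset, and the quotient is a
    group with one element.\<close>
  have coset: "?B #>\<^bsub>?H\<^esub> z = ?B" if "z \<in> ?Z" for z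
  proof -
    have z: "z \<in> ?B" by (rule cycle_is_boundary[OF that])
    have "b \<in> (\<lambda>b. b + z) ` ?B" if "b \<in> ?B" for b
      by (rule image_eqI[where x = "b - z"]) (auto simp: bar_boundaries_diff that z)
    then show ?thesis using Badd[OF _ z] by (auto simp: r_coset_def)
  qed
  have "rcosets\<^bsub>?H\<^esub> ?B = {?B}"
    using coset Z0 by (auto simp: RCOSETS_def)
  moreover have "?B <#>\<^bsub>?H\<^esub> ?B = ?B"
  proof -
    have "b \<in> ?B <#>\<^bsub>?H\<^esub> ?B" if "b \<in> ?B" for b
      using that B0 by (force simp: set_mult_def)
    then show ?thesis using Badd by (auto simp: set_mult_def)
  qed
  ultimately have H: "group_homology n G M act = \<lparr>carrier = {?B}, monoid.mult = set_mult ?H, one = ?B\<rparr>"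
    and BB: "set_mult ?H ?B ?B = ?B"
    by (simp_all add: group_homology_def FactGroup_def)
  have "group (group_homology n G M act)"
    unfolding H by (rule groupI) (auto simp: BB)
  then show ?thesis by (simp add: trivial_group_def H)
qed

end

section \<open>Square-summable functions on a group\<close>

text \<open>Norm estimates are reduced to finite subsets, where \<open>L2_set\<close> supplies the
  triangle inequality.\<close>

lemma ell2_bounded:
  assumes "\<And>x. x \<notin> carrier G \<Longrightarrow> f x = 0"
    and le: "\<And>A. finite A \<Longrightarrow> A \<subseteq> carrier G \<Longrightarrow> L2_set (\<lambda>x. cmod (f x)) A \<le> C"
  shows "f \<in> ell2 G" and "ell2_norm G f \<le> C"
proof -
  have C: "0 \<le> C" using le[of "{}"] by simp
  have sum: "(\<Sum>x\<in>A. (cmod (f x))\<^sup>2) \<le> C\<^sup>2" if "finite A" "A \<subseteq> carrier G" for A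
    using le[OF that] by (simp add: L2_set_def real_sqrt_le_iff' C sqrt_le_D)
  have s: "(\<lambda>x. (cmod (f x))\<^sup>2) summable_on carrier G"
    by (rule nonneg_bdd_above_summable_on) (auto intro!: bdd_aboveI sum)
  then show "f \<in> ell2 G" using assms(1) by (simp add: ell2_def)
  have "(\<Sum>\<^sub>\<infinity>x\<in>carrier G. (cmod (f x))\<^sup>2) \<le> C\<^sup>2"
    by (rule infsum_le_finite_sums[OF s sum])
  then show "ell2_norm G f \<le> C"
    using C by (simp add: ell2_norm_def real_le_lsqrt)
qed

lemma ell2_off: "f \<in> ell2 G \<Longrightarrow> x \<notin> carrier G \<Longrightarrow> f x = 0"
  by (simp add: ell2_def)

lemma ell2_norm_nonneg [simp]: "0 \<le> ell2_norm G f"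
  by (simp add: ell2_norm_def infsum_nonneg)

lemma L2_set_le_ell2_norm:
  assumes "f \<in> ell2 G" "finite A" "A \<subseteq> carrier G"
  shows "L2_set (\<lambda>x. cmod (f x)) A \<le> ell2_norm G f"
  using assms unfolding L2_set_def ell2_norm_def ell2_def
  by (auto intro!: real_sqrt_le_mono finite_sum_le_infsum)

lemma cmod_le_ell2_norm:
  assumes "f \<in> ell2 G"
  shows "cmod (f x) \<le> ell2_norm G f"
  using L2_set_le_ell2_norm[OF assms, of "{x}"] ell2_off[OF assms, of x]
  by (cases "x \<in> carrier G") auto

lemma ell2_add:
  assumes "f \<in> ell2 G" "h \<in> ell2 G"
  shows "(\<lambda>x. f x + h x) \<in> ell2 G" "ell2_norm G (\<lambda>x. f x + h x) \<le> ell2_norm G f + ell2_norm G h"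
proof -
  have "L2_set (\<lambda>x. cmod (f x + h x)) A \<le> ell2_norm G f + ell2_norm G h"
    if "finite A" "A \<subseteq> carrier G" for A
  proof -
    have "L2_set (\<lambda>x. cmod (f x + h x)) A \<le> L2_set (\<lambda>x. cmod (f x) + cmod (h x)) A"
      by (rule L2_set_mono) (auto intro: norm_triangle_ineq)
    also have "\<dots> \<le> L2_set (\<lambda>x. cmod (f x)) A + L2_set (\<lambda>x. cmod (h x)) A"
      by (rule L2_set_triangle_ineq)
    finally show ?thesis
      using L2_set_le_ell2_norm[OF assms(1) that] L2_set_le_ell2_norm[OF assms(2) that] by linarith
  qed
  then show "(\<lambda>x. f x + h x) \<in> ell2 G" "ell2_norm G (\<lambda>x. f x + h x) \<le> ell2_norm G f + ell2_norm G h"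
    using ell2_bounded[of G "\<lambda>x. f x + h x"] ell2_off[OF assms(1)] ell2_off[OF assms(2)] by auto
qed

lemma ell2_scale:
  assumes "f \<in> ell2 G"
  shows "(\<lambda>x. a * f x) \<in> ell2 G" "ell2_norm G (\<lambda>x. a * f x) \<le> cmod a * ell2_norm G f"
proof -
  have "L2_set (\<lambda>x. cmod (a * f x)) A \<le> cmod a * ell2_norm G f"
    if "finite A" "A \<subseteq> carrier G" for A
    using L2_set_le_ell2_norm[OF assms that]
    by (simp add: norm_mult L2_set_right_distrib[symmetric] mult_left_mono)
  then show "(\<lambda>x. a * f x) \<in> ell2 G" "ell2_norm G (\<lambda>x. a * f x) \<le> cmod a * ell2_norm G f"
    using ell2_bounded[of G "\<lambda>x. a * f x"] ell2_off[OF assms] by auto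
qed

lemma ell2_zero: "(\<lambda>x. 0) \<in> ell2 G" "ell2_norm G (\<lambda>x. 0) = 0"
  by (auto simp: ell2_def ell2_norm_def)

lemma ell2_sum:
  assumes "finite I" "\<And>i. i \<in> I \<Longrightarrow> h i \<in> ell2 G"
  shows "(\<lambda>x. \<Sum>i\<in>I. h i x) \<in> ell2 G"
  using assms by (induction I rule: finite_induct) (auto intro: ell2_zero ell2_add)

lemma ell2_norm_sum_le:
  assumes "finite I" "\<And>i. i \<in> I \<Longrightarrow> h i \<in> ell2 G"
  shows "ell2_norm G (\<lambda>x. \<Sum>i\<in>I. h i x) \<le> (\<Sum>i\<in>I. ell2_norm G (h i))"
  using assms
proof (induction I rule: finite_induct)
  case (insert i I)
  have "ell2_norm G (\<lambda>x. h i x + (\<Sum>i\<in>I. h i x)) \<le> ell2_norm G (h i) + ell2_norm G (\<lambda>x. \<Sum>i\<in>I. h i x)"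
    by (intro ell2_add ell2_sum) (use insert in auto)
  with insert show ?case by auto
qed (simp add: ell2_zero)

lemma ell2_diff:
  assumes "f \<in> ell2 G" "h \<in> ell2 G"
  shows "(\<lambda>x. f x - h x) \<in> ell2 G" "ell2_norm G (\<lambda>x. f x - h x) \<le> ell2_norm G f + ell2_norm G h"
  using ell2_add[OF assms(1) ell2_scale(1)[OF assms(2), of "-1"]] ell2_scale(2)[OF assms(2), of "-1"]
  by simp_all

lemma sum_fun_apply: "(\<Sum>i\<in>A. h i) x = (\<Sum>i\<in>A. h i x :: 'b::comm_monoid_add)"
  by (induction A rule: infinite_finite_induct) auto

section \<open>The group von Neumann algebra\<close>

lemma vN_iff: "T \<in> group_von_Neumann_algebra G \<longleftrightarrow>
    (\<forall>f\<in>ell2 G. T f \<in> ell2 G) \<and>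
    (\<forall>f\<in>ell2 G. \<forall>h\<in>ell2 G. T (\<lambda>x. f x + h x) = (\<lambda>x. T f x + T h x)) \<and>
    (\<forall>a. \<forall>f\<in>ell2 G. T (\<lambda>x. a * f x) = (\<lambda>x. a * T f x)) \<and>
    (\<exists>C. \<forall>f\<in>ell2 G. ell2_norm G (T f) \<le> C * ell2_norm G f) \<and>
    (\<forall>f. f \<notin> ell2 G \<longrightarrow> T f = 0) \<and>
    (\<forall>g\<in>carrier G. \<forall>f\<in>ell2 G. T (left_translation G g f) = left_translation G g (T f))"
  by (auto simp: group_von_Neumann_algebra_def ell2_operators_def)

lemma vN_closed: "T \<in> group_von_Neumann_algebra G \<Longrightarrow> f \<in> ell2 G \<Longrightarrow> T f \<in> ell2 G"
  and vN_add: "T \<in> group_von_Neumann_algebra G \<Longrightarrow> f \<in> ell2 G \<Longrightarrow> h \<in> ell2 G \<Longrightarrow>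
      T (\<lambda>x. f x + h x) = (\<lambda>x. T f x + T h x)"
  and vN_scale: "T \<in> group_von_Neumann_algebra G \<Longrightarrow> f \<in> ell2 G \<Longrightarrow> T (\<lambda>x. a * f x) = (\<lambda>x. a * T f x)"
  and vN_off: "T \<in> group_von_Neumann_algebra G \<Longrightarrow> f \<notin> ell2 G \<Longrightarrow> T f = 0"
  and vN_left: "T \<in> group_von_Neumann_algebra G \<Longrightarrow> g \<in> carrier G \<Longrightarrow> f \<in> ell2 G \<Longrightarrow>
      T (left_translation G g f) = left_translation G g (T f)"
  by (auto simp: vN_iff)

lemma vN_bounded:
  assumes "T \<in> group_von_Neumann_algebra G"
  obtains C where "0 \<le> C" "\<And>f. f \<in> ell2 G \<Longrightarrow> ell2_norm G (T f) \<le> C * ell2_norm G f"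
proof -
  obtain C where C: "\<And>f. f \<in> ell2 G \<Longrightarrow> ell2_norm G (T f) \<le> C * ell2_norm G f"
    using assms unfolding vN_iff by blast
  show ?thesis
  proof (rule that[of "max 0 C"])
    fix f assume "f \<in> ell2 G"
    then have "ell2_norm G (T f) \<le> C * ell2_norm G f" by (rule C)
    also have "\<dots> \<le> max 0 C * ell2_norm G f" by (intro mult_right_mono) auto
    finally show "ell2_norm G (T f) \<le> max 0 C * ell2_norm G f" .
  qed auto
qed

lemma vN_zero: "T \<in> group_von_Neumann_algebra G \<Longrightarrow> T 0 = 0"
  using vN_scale[of T G 0 0] by (simp add: zero_fun_def ell2_zero)

lemma vN_sum:
  assumes "T \<in> group_von_Neumann_algebra G" "finite I" "\<And>i. i \<in> I \<Longrightarrow> h i \<in> ell2 G"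
  shows "T (\<lambda>x. \<Sum>i\<in>I. h i x) = (\<lambda>x. \<Sum>i\<in>I. T (h i) x)"
  using assms(2,3)
proof (induction I rule: finite_induct)
  case empty
  then show ?case using vN_zero[OF assms(1)] by (simp add: zero_fun_def)
next
  case (insert i I)
  then show ?case
    using vN_add[OF assms(1), of "h i" "\<lambda>x. \<Sum>i\<in>I. h i x"] ell2_sum[of I h G] by auto
qed

lemma vN_diff_arg:
  assumes "T \<in> group_von_Neumann_algebra G" "f \<in> ell2 G" "h \<in> ell2 G"
  shows "T (\<lambda>x. f x - h x) = (\<lambda>x. T f x - T h x)"
  using vN_add[OF assms(1,2) ell2_scale(1)[OF assms(3), of "-1"]] vN_scale[OF assms(1,3), of "-1"]
  by simp

lemma vN_zero_mem: "0 \<in> group_von_Neumann_algebra G"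
  by (auto simp: vN_iff ell2_zero zero_fun_def left_translation_def intro!: exI[of _ 0])

lemma vN_diff:
  assumes "T \<in> group_von_Neumann_algebra G" "T' \<in> group_von_Neumann_algebra G"
  shows "T - T' \<in> group_von_Neumann_algebra G"
proof -
  have app: "(T - T') f = (\<lambda>x. T f x - T' f x)" for f
    by (simp add: fun_diff_def)
  obtain C where C: "\<And>f. f \<in> ell2 G \<Longrightarrow> ell2_norm G (T f) \<le> C * ell2_norm G f"
    using vN_bounded[OF assms(1)] by blast
  obtain C' where C': "\<And>f. f \<in> ell2 G \<Longrightarrow> ell2_norm G (T' f) \<le> C' * ell2_norm G f"
    using vN_bounded[OF assms(2)] by blast
  have "ell2_norm G ((T - T') f) \<le> (C + C') * ell2_norm G f" if "f \<in> ell2 G" for f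
    using ell2_diff(2)[OF vN_closed[OF assms(1) that] vN_closed[OF assms(2) that]] C[OF that] C'[OF that]
    unfolding app by (simp add: distrib_right)
  then have "\<exists>C. \<forall>f\<in>ell2 G. ell2_norm G ((T - T') f) \<le> C * ell2_norm G f" by blast
  moreover have "(T - T') f \<in> ell2 G" if "f \<in> ell2 G" for f
    unfolding app by (rule ell2_diff(1)[OF vN_closed[OF assms(1) that] vN_closed[OF assms(2) that]])
  moreover have "(T - T') (left_translation G g f) = left_translation G g ((T - T') f)"
    if "g \<in> carrier G" "f \<in> ell2 G" for g f
    unfolding app vN_left[OF assms(1) that] vN_left[OF assms(2) that] by (auto simp: left_translation_def)
  moreover have "(T - T') (\<lambda>x. f x + h x) = (\<lambda>x. (T - T') f x + (T - T') h x)"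
    if "f \<in> ell2 G" "h \<in> ell2 G" for f h
    unfolding app vN_add[OF assms(1) that] vN_add[OF assms(2) that] by (simp add: algebra_simps)
  moreover have "(T - T') (\<lambda>x. a * f x) = (\<lambda>x. a * (T - T') f x)" if "f \<in> ell2 G" for a f
    unfolding app vN_scale[OF assms(1) that] vN_scale[OF assms(2) that] by (simp add: algebra_simps)
  moreover have "(T - T') f = 0" if "f \<notin> ell2 G" for f
    by (simp add: vN_off[OF assms(1) that] vN_off[OF assms(2) that])
  ultimately show ?thesis
    unfolding vN_iff by blast
qed

lemma vN_comp:
  assumes "T \<in> group_von_Neumann_algebra G" "T' \<in> group_von_Neumann_algebra G"
  shows "T \<circ> T' \<in> group_von_Neumann_algebra G"
proof -
  obtain C where C: "0 \<le> C" "\<And>f. f \<in> ell2 G \<Longrightarrow> ell2_norm G (T f) \<le> C * ell2_norm G f"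
    using vN_bounded[OF assms(1)] by blast
  obtain C' where C': "\<And>f. f \<in> ell2 G \<Longrightarrow> ell2_norm G (T' f) \<le> C' * ell2_norm G f"
    using vN_bounded[OF assms(2)] by blast
  have "ell2_norm G (T (T' f)) \<le> (C * C') * ell2_norm G f" if "f \<in> ell2 G" for f
    using C(2)[OF vN_closed[OF assms(2) that]] mult_left_mono[OF C'[OF that] C(1)] by simp
  then show ?thesis
    unfolding vN_iff
    by (auto simp: vN_add[OF assms(1)] vN_add[OF assms(2)] vN_scale[OF assms(1)] vN_scale[OF assms(2)]
        vN_off[OF assms(1)] vN_off[OF assms(2)] vN_left[OF assms(1)] vN_left[OF assms(2)]
        vN_closed[OF assms(1)] vN_closed[OF assms(2)] vN_zero[OF assms(1)])
qed

section \<open>Translations and averages as elements of the group von Neumann algebra\<close>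

context group
begin

lemma bij_betw_right_mult: "g \<in> carrier G \<Longrightarrow> bij_betw (\<lambda>x. x \<otimes> g) (carrier G) (carrier G)"
  by (rule bij_betw_byWitness[where f' = "\<lambda>x. x \<otimes> inv g"]) (auto simp: m_assoc)

lemma ell2_left_translation:
  assumes "g \<in> carrier G" "f \<in> ell2 G"
  shows "left_translation G g f \<in> ell2 G"
proof -
  have bij: "bij_betw (\<lambda>x. inv g \<otimes> x) (carrier G) (carrier G)"
    by (rule bij_betw_byWitness[where f' = "\<lambda>x. g \<otimes> x"]) (auto simp: m_assoc[symmetric] assms)
  have "(\<lambda>x. (cmod (f (inv g \<otimes> x)))\<^sup>2) summable_on carrier G"
    using assms(2) summable_on_reindex_bij_betw[OF bij, of "\<lambda>x. (cmod (f x))\<^sup>2"] by (simp add: ell2_def)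
  then show ?thesis
    by (simp add: ell2_def left_translation_def cong: summable_on_cong)
qed

lemma right_translation_apply: "f \<in> ell2 G \<Longrightarrow> x \<in> carrier G \<Longrightarrow> right_translation G g f x = f (x \<otimes> g)"
  by (simp add: right_translation_def)

lemma ell2_right_translation:
  assumes "g \<in> carrier G" "f \<in> ell2 G"
  shows "right_translation G g f \<in> ell2 G" "ell2_norm G (right_translation G g f) = ell2_norm G f"
proof -
  note bij = bij_betw_right_mult[OF assms(1)]
  have "(\<lambda>x. (cmod (f (x \<otimes> g)))\<^sup>2) summable_on carrier G"
    using assms(2) summable_on_reindex_bij_betw[OF bij, of "\<lambda>x. (cmod (f x))\<^sup>2"] by (simp add: ell2_def)
  then show "right_translation G g f \<in> ell2 G"
    using assms(2) by (simp add: ell2_def right_translation_def cong: summable_on_cong)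
  have "(\<Sum>\<^sub>\<infinity>x\<in>carrier G. (cmod (right_translation G g f x))\<^sup>2) = (\<Sum>\<^sub>\<infinity>x\<in>carrier G. (cmod (f (x \<otimes> g)))\<^sup>2)"
    by (rule infsum_cong) (simp add: right_translation_apply assms)
  then show "ell2_norm G (right_translation G g f) = ell2_norm G f"
    using infsum_reindex_bij_betw[OF bij, of "\<lambda>x. (cmod (f x))\<^sup>2"] by (simp add: ell2_norm_def)
qed

lemma right_translation_vN:
  assumes "g \<in> carrier G"
  shows "right_translation G g \<in> group_von_Neumann_algebra G"
proof -
  have "right_translation G g (left_translation G h f) = left_translation G h (right_translation G g f)"
    if "h \<in> carrier G" "f \<in> ell2 G" for h f
    using that assms ell2_left_translation[OF that]
    by (auto simp: right_translation_def left_translation_def fun_eq_iff m_assoc)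
  moreover have "right_translation G g (\<lambda>x. f x + h x) = (\<lambda>x. right_translation G g f x + right_translation G g h x)"
    if "f \<in> ell2 G" "h \<in> ell2 G" for f h
    using that ell2_add(1)[OF that] by (auto simp: right_translation_def)
  moreover have "right_translation G g (\<lambda>x. a * f x) = (\<lambda>x. a * right_translation G g f x)"
    if "f \<in> ell2 G" for a f
    using that ell2_scale(1)[OF that, of a] by (auto simp: right_translation_def)
  moreover have "\<exists>C. \<forall>f\<in>ell2 G. ell2_norm G (right_translation G g f) \<le> C * ell2_norm G f"
    using ell2_right_translation(2)[OF assms] by (intro exI[of _ 1]) auto
  ultimately show ?thesis
    unfolding vN_iff using ell2_right_translation(1)[OF assms]
    by (auto simp: right_translation_def)
qed

lemma right_translation_mult:
  assumes "g \<in> carrier G" "h \<in> carrier G"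
  shows "right_translation G g \<circ> right_translation G h = right_translation G (g \<otimes> h)"
proof
  fix f show "(right_translation G g \<circ> right_translation G h) f = right_translation G (g \<otimes> h) f"
  proof (cases "f \<in> ell2 G")
    case True
    then show ?thesis
      using assms ell2_right_translation(1)[OF assms(2) True]
      by (auto simp: right_translation_def[of G g] right_translation_def[of G "g \<otimes> h"] right_translation_apply m_assoc)
  qed (simp add: right_translation_def zero_fun_def)
qed

definition avg :: "'a set \<Rightarrow> ('a \<Rightarrow> complex) \<Rightarrow> 'a \<Rightarrow> complex" where
  "avg S f = (\<lambda>x. 1 / of_nat (card S) * (\<Sum>s\<in>S. right_translation G s f x))"

text \<open>The inverse of \<open>card S - (\<Sum>s\<in>S. right_translation G s)\<close>, given by its Neumann series.\<close>

definition neumann :: "'a set \<Rightarrow> ('a \<Rightarrow> complex) \<Rightarrow> 'a \<Rightarrow> complex" where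
  "neumann S f = (if f \<in> ell2 G then (\<lambda>x. 1 / of_nat (card S) * suminf (\<lambda>n. (avg S ^^ n) f x)) else 0)"

lemma avg_vN:
  assumes "finite S" "S \<subseteq> carrier G"
  shows "avg S \<in> group_von_Neumann_algebra G"
proof -
  note R = right_translation_vN[OF subsetD[OF assms(2)]]
  have cl: "(\<lambda>x. \<Sum>s\<in>S. right_translation G s f x) \<in> ell2 G" if "f \<in> ell2 G" for f
    by (rule ell2_sum) (use assms that vN_closed[OF R] in auto)
  have "ell2_norm G (avg S f) \<le> cmod (1 / of_nat (card S)) * card S * ell2_norm G f" if "f \<in> ell2 G" for f
  proof -
    have "ell2_norm G (\<lambda>x. \<Sum>s\<in>S. right_translation G s f x) \<le> (\<Sum>s\<in>S. ell2_norm G (right_translation G s f))"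
      by (rule ell2_norm_sum_le) (use assms that vN_closed[OF R] in auto)
    also have "\<dots> = card S * ell2_norm G f"
      using assms that by (simp add: ell2_right_translation(2) subset_iff)
    finally show ?thesis
      unfolding avg_def mult.assoc
      by (intro order.trans[OF ell2_scale(2)[OF cl[OF that]]] mult_left_mono) auto
  qed
  moreover have "avg S f \<in> ell2 G" if "f \<in> ell2 G" for f
    unfolding avg_def by (rule ell2_scale(1)[OF cl[OF that]])
  moreover have "avg S f = 0" if "f \<notin> ell2 G" for f
    using that by (simp add: avg_def right_translation_def zero_fun_def)
  moreover have "left_translation G g (avg S f) = avg S (left_translation G g f)" if "g \<in> carrier G" "f \<in> ell2 G" for g f
  proof -
    have "avg S (left_translation G g f) = (\<lambda>x. 1 / of_nat (card S) * (\<Sum>s\<in>S. left_translation G g (right_translation G s f) x))"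
      unfolding avg_def by (intro ext arg_cong2[of _ _ _ _ "(*)"] refl sum.cong) (simp add: vN_left[OF R that])
    then show ?thesis by (auto simp: left_translation_def avg_def)
  qed
  moreover have "avg S (\<lambda>x. f x + h x) = (\<lambda>x. avg S f x + avg S h x)" if "f \<in> ell2 G" "h \<in> ell2 G" for f h
    unfolding avg_def
    by (simp add: vN_add[OF R that] sum.distrib distrib_left add_divide_distrib cong: sum.cong)
  moreover have "avg S (\<lambda>x. a * f x) = (\<lambda>x. a * avg S f x)" if "f \<in> ell2 G" for a f
    unfolding avg_def
    by (simp add: vN_scale[OF R that] sum_distrib_left mult_ac cong: sum.cong)
  ultimately show ?thesis
    unfolding vN_iff by auto
qed

lemma avg_commute:
  assumes "finite S" "S \<subseteq> carrier G" "g \<in> carrier G" "\<And>s. s \<in> S \<Longrightarrow> s \<otimes> g = g \<otimes> s" "f \<in> ell2 G"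
  shows "avg S (right_translation G g f) = right_translation G g (avg S f)"
proof -
  have comm: "right_translation G s (right_translation G g f) = right_translation G g (right_translation G s f)"
    if "s \<in> S" for s
    using right_translation_mult[of s g] right_translation_mult[of g s] assms that
    by (metis comp_apply subsetD)
  have P: "avg S f \<in> ell2 G" by (rule vN_closed[OF avg_vN[OF assms(1,2)] assms(5)])
  have R: "right_translation G s f \<in> ell2 G" if "s \<in> S" for s
    using ell2_right_translation(1) assms that by blast
  show ?thesis
  proof
    fix x
    have "avg S (right_translation G g f) x
        = 1 / of_nat (card S) * (\<Sum>s\<in>S. right_translation G g (right_translation G s f) x)"
      by (simp add: avg_def comm cong: sum.cong)
    also have "\<dots> = right_translation G g (avg S f) x"
    proof (cases "x \<in> carrier G")
      case True
      have "(\<Sum>s\<in>S. right_translation G g (right_translation G s f) x) = (\<Sum>s\<in>S. right_translation G s f (x \<otimes> g))"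
        by (rule sum.cong) (auto simp: right_translation_apply R True)
      then show ?thesis using right_translation_apply[OF P True, of g] by (simp add: avg_def)
    next
      case False
      then have "right_translation G g h x = 0" for h
        by (simp add: right_translation_def)
      then show ?thesis by simp
    qed
    finally show "avg S (right_translation G g f) x = right_translation G g (avg S f) x" .
  qed
qed

section \<open>The inverse operator in the presence of a spectral gap\<close>

context
  fixes S :: "'a set" and \<rho> :: real
  assumes S: "finite S" "S \<noteq> {}" "S \<subseteq> carrier G" and \<rho>: "0 \<le> \<rho>" "\<rho> < 1"
    and gap: "\<And>f. f \<in> ell2 G \<Longrightarrow> ell2_norm G (avg S f) \<le> \<rho> * ell2_norm G f"
begin

lemma pow_closed: "f \<in> ell2 G \<Longrightarrow> (avg S ^^ n) f \<in> ell2 G"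
  by (induction n) (auto intro: vN_closed[OF avg_vN[OF S(1,3)]])

lemma pow_norm: "f \<in> ell2 G \<Longrightarrow> ell2_norm G ((avg S ^^ n) f) \<le> \<rho> ^ n * ell2_norm G f"
proof (induction n)
  case (Suc n)
  have "ell2_norm G ((avg S ^^ Suc n) f) \<le> \<rho> * ell2_norm G ((avg S ^^ n) f)"
    using gap[OF pow_closed[OF Suc.prems]] by simp
  also have "\<dots> \<le> \<rho> * (\<rho> ^ n * ell2_norm G f)"
    using Suc \<rho> by (intro mult_left_mono) auto
  finally show ?case by simp
qed simp

lemma summable_pow:
  assumes "f \<in> ell2 G"
  shows "summable (\<lambda>n. (avg S ^^ n) f x)"
proof (rule summable_comparison_test'[where N = 0])
  show "summable (\<lambda>n. \<rho> ^ n * ell2_norm G f)"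
    using \<rho> by (intro summable_mult2 summable_geometric) auto
  show "norm ((avg S ^^ n) f x) \<le> \<rho> ^ n * ell2_norm G f" for n
    using cmod_le_ell2_norm[OF pow_closed[OF assms]] pow_norm[OF assms] by (rule order.trans)
qed

text \<open>The series is defined pointwise. On a finite set its partial sums are controlled by the
  geometric series, the bound passes to the limit, and bounds on finite sets determine the
  norm.\<close>

lemma ell2_series:
  assumes "f \<in> ell2 G"
  shows "(\<lambda>x. suminf (\<lambda>n. (avg S ^^ n) f x)) \<in> ell2 G"
    and "ell2_norm G (\<lambda>x. suminf (\<lambda>n. (avg S ^^ n) f x)) \<le> 1 / (1 - \<rho>) * ell2_norm G f"
proof -
  have le: "L2_set (\<lambda>x. cmod (suminf (\<lambda>n. (avg S ^^ n) f x))) A \<le> 1 / (1 - \<rho>) * ell2_norm G f"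
    if A: "finite A" "A \<subseteq> carrier G" for A
  proof (rule LIMSEQ_le_const2)
    have "(\<lambda>N. \<Sum>n<N. (avg S ^^ n) f x) \<longlonglongrightarrow> suminf (\<lambda>n. (avg S ^^ n) f x)" for x
      using summable_LIMSEQ[OF summable_pow[OF assms]] .
    then show "(\<lambda>N. L2_set (\<lambda>x. cmod (\<Sum>n<N. (avg S ^^ n) f x)) A) \<longlonglongrightarrow> L2_set (\<lambda>x. cmod (suminf (\<lambda>n. (avg S ^^ n) f x))) A"
      unfolding L2_set_def by (intro tendsto_intros)
    have "L2_set (\<lambda>x. cmod (\<Sum>n<N. (avg S ^^ n) f x)) A \<le> 1 / (1 - \<rho>) * ell2_norm G f" for N
    proof -
      have "L2_set (\<lambda>x. cmod (\<Sum>n<N. (avg S ^^ n) f x)) A \<le> ell2_norm G (\<lambda>x. \<Sum>n<N. (avg S ^^ n) f x)"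
        by (rule L2_set_le_ell2_norm[OF _ A]) (intro ell2_sum pow_closed assms finite_lessThan)
      also have "\<dots> \<le> (\<Sum>n<N. ell2_norm G ((avg S ^^ n) f))"
        by (intro ell2_norm_sum_le pow_closed assms finite_lessThan)
      also have "\<dots> \<le> (\<Sum>n<N. \<rho> ^ n * ell2_norm G f)"
        by (intro sum_mono pow_norm assms)
      also have "\<dots> = (\<Sum>n<N. \<rho> ^ n) * ell2_norm G f"
        by (simp add: sum_distrib_right)
      also have "\<dots> \<le> suminf (\<lambda>n. \<rho> ^ n) * ell2_norm G f"
        using \<rho> by (intro mult_right_mono sum_le_suminf summable_geometric) auto
      also have "suminf (\<lambda>n. \<rho> ^ n) = 1 / (1 - \<rho>)"
        using \<rho> by (intro suminf_geometric) auto
      finally show ?thesis .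
    qed
    then show "\<exists>N. \<forall>n\<ge>N. L2_set (\<lambda>x. cmod (\<Sum>n<n. (avg S ^^ n) f x)) A \<le> 1 / (1 - \<rho>) * ell2_norm G f"
      by blast
  qed
  have off: "suminf (\<lambda>n. (avg S ^^ n) f x) = 0" if "x \<notin> carrier G" for x
    using ell2_off[OF pow_closed[OF assms] that] by simp
  show "(\<lambda>x. suminf (\<lambda>n. (avg S ^^ n) f x)) \<in> ell2 G"
    and "ell2_norm G (\<lambda>x. suminf (\<lambda>n. (avg S ^^ n) f x)) \<le> 1 / (1 - \<rho>) * ell2_norm G f"
    by (rule ell2_bounded[OF off le]; assumption)+
qed

lemma neumann_vN: "neumann S \<in> group_von_Neumann_algebra G"
proof -
  note P = avg_vN[OF S(1,3)]
  have "neumann S f \<in> ell2 G" if "f \<in> ell2 G" for f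
    using that ell2_scale(1)[OF ell2_series(1)[OF that], of "1 / of_nat (card S)"] by (simp add: neumann_def)
  moreover have "ell2_norm G (neumann S f) \<le> cmod (1 / of_nat (card S)) * (1 / (1 - \<rho>)) * ell2_norm G f"
    if "f \<in> ell2 G" for f
    using order.trans[OF ell2_scale(2)[OF ell2_series(1)[OF that], of "1 / of_nat (card S)"] mult_left_mono[OF ell2_series(2)[OF that]]] that
    by (simp add: neumann_def mult.assoc)
  moreover have "neumann S (\<lambda>x. f x + h x) = (\<lambda>x. neumann S f x + neumann S h x)"
    if "f \<in> ell2 G" "h \<in> ell2 G" for f h
  proof -
    have "(avg S ^^ n) (\<lambda>x. f x + h x) = (\<lambda>x. (avg S ^^ n) f x + (avg S ^^ n) h x)" for n
      by (induction n) (simp_all add: vN_add[OF P] pow_closed that)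
    then show ?thesis
      using that ell2_add(1)[OF that]
      by (simp add: neumann_def suminf_add[OF summable_pow summable_pow, symmetric] distrib_left add_divide_distrib)
  qed
  moreover have "neumann S (\<lambda>x. a * f x) = (\<lambda>x. a * neumann S f x)" if "f \<in> ell2 G" for a f
  proof -
    have "(avg S ^^ n) (\<lambda>x. a * f x) = (\<lambda>x. a * (avg S ^^ n) f x)" for n
      by (induction n) (simp_all add: vN_scale[OF P] pow_closed that)
    then show ?thesis
      using that ell2_scale(1)[OF that, of a] by (simp add: neumann_def suminf_mult[OF summable_pow])
  qed
  moreover have "neumann S (left_translation G g f) = left_translation G g (neumann S f)"
    if "g \<in> carrier G" "f \<in> ell2 G" for g f
  proof -
    have "(avg S ^^ n) (left_translation G g f) = left_translation G g ((avg S ^^ n) f)" for n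
      by (induction n) (simp_all add: vN_left[OF P] pow_closed that)
    then show ?thesis
      using that ell2_left_translation[OF that] by (auto simp: neumann_def left_translation_def)
  qed
  moreover have "neumann S f = 0" if "f \<notin> ell2 G" for f
    using that by (simp add: neumann_def)
  ultimately show ?thesis
    unfolding vN_iff by blast
qed

text \<open>Every power of the average commutes with translation by an element that centralises
  \<open>S\<close>, hence so does the series. This is the naturality that later yields
  \<open>T_act\<close>.\<close>

lemma neumann_commute:
  assumes "g \<in> carrier G" "\<And>s. s \<in> S \<Longrightarrow> s \<otimes> g = g \<otimes> s"
  shows "neumann S \<circ> right_translation G g = right_translation G g \<circ> neumann S"
proof
  fix f
  show "(neumann S \<circ> right_translation G g) f = (right_translation G g \<circ> neumann S) f"
  proof (cases "f \<in> ell2 G")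
    case True
    have "(avg S ^^ n) (right_translation G g f) = right_translation G g ((avg S ^^ n) f)" for n
      by (induction n) (simp_all add: avg_commute[OF S(1,3) assms] pow_closed True)
    moreover have "neumann S f \<in> ell2 G" by (rule vN_closed[OF neumann_vN True])
    ultimately show ?thesis
      using True ell2_right_translation(1)[OF assms(1) True] pow_closed[OF True]
      by (auto simp: right_translation_def[of G g] neumann_def[of S "right_translation G g f"])
        (auto simp: neumann_def right_translation_def)
  next
    case False
    then have "right_translation G g f = 0" "neumann S f = 0"
      by (simp_all add: right_translation_def neumann_def)
    then show ?thesis
      using vN_zero[OF neumann_vN] vN_zero[OF right_translation_vN[OF assms(1)]] by simp
  qed
qed

text \<open>Applying the series to \<open>avg S f\<close> shifts it by one place and loses the term
  \<open>f\<close>; the factor \<open>card S\<close> turns the average back into the sum over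
  \<open>S\<close>.\<close>

lemma neumann_inverse:
  assumes "f \<in> ell2 G"
  shows "(\<lambda>x. \<Sum>s\<in>S. neumann S f x - neumann S (right_translation G s f) x) = f"
proof
  fix x
  have card: "(of_nat (card S) :: complex) \<noteq> 0" using S by simp
  have R: "right_translation G s f \<in> ell2 G" if "s \<in> S" for s
    using ell2_right_translation(1) assms that S(3) by blast
  have P: "avg S f \<in> ell2 G" by (rule vN_closed[OF avg_vN[OF S(1,3)] assms])
  have "(\<lambda>x. of_nat (card S) * avg S f x) = (\<lambda>x. \<Sum>s\<in>S. right_translation G s f x)"
    using card by (simp add: avg_def)
  then have "(\<lambda>x. \<Sum>s\<in>S. neumann S (right_translation G s f) x) = (\<lambda>x. of_nat (card S) * neumann S (avg S f) x)"
    using vN_sum[OF neumann_vN S(1) R] vN_scale[OF neumann_vN P, of "of_nat (card S)"] by simp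
  then have "(\<Sum>s\<in>S. neumann S (right_translation G s f) x) = suminf (\<lambda>n. (avg S ^^ n) (avg S f) x)"
    using P card by (simp add: neumann_def fun_eq_iff)
  also have "\<dots> = suminf (\<lambda>n. (avg S ^^ Suc n) f x)"
    by (simp add: funpow_swap1)
  also have "\<dots> = suminf (\<lambda>n. (avg S ^^ n) f x) - f x"
    using suminf_split_head[OF summable_pow[OF assms]] by simp
  finally show "(\<Sum>s\<in>S. neumann S f x - neumann S (right_translation G s f) x) = f x"
    using card assms by (simp add: sum_subtractf neumann_def)
qed

text \<open>Composing \<open>m\<close> with the inverse operator turns
  \<open>neumann_inverse\<close> into a statement about the module, where \<open>s\<close> acts by
  composition with its translation. The minus sign is needed because the differences here are
  translate minus original.\<close>

lemma vN_neumann_inverse: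
  assumes m: "m \<in> group_von_Neumann_algebra G"
  shows "(\<Sum>s\<in>S. ((- (m \<circ> neumann S)) \<circ> right_translation G s) - (- (m \<circ> neumann S))) = m"
proof
  fix f
  show "(\<Sum>s\<in>S. ((- (m \<circ> neumann S)) \<circ> right_translation G s) - (- (m \<circ> neumann S))) f = m f"
  proof (cases "f \<in> ell2 G")
    case True
    have cl: "neumann S f \<in> ell2 G" "neumann S (right_translation G s f) \<in> ell2 G" if "s \<in> S" for s
      using vN_closed[OF neumann_vN] ell2_right_translation(1) True S(3) that by blast+
    have "(\<lambda>x. \<Sum>s\<in>S. m (neumann S f) x - m (neumann S (right_translation G s f)) x)
        = (\<lambda>x. \<Sum>s\<in>S. m (\<lambda>x. neumann S f x - neumann S (right_translation G s f) x) x)"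
      by (intro ext sum.cong refl) (simp add: vN_diff_arg[OF m] cl)
    also have "\<dots> = m (\<lambda>x. \<Sum>s\<in>S. neumann S f x - neumann S (right_translation G s f) x)"
      by (rule vN_sum[OF m S(1), symmetric]) (intro ell2_diff cl)
    also have "\<dots> = m f" by (simp add: neumann_inverse[OF True])
    finally show ?thesis by (simp add: fun_eq_iff sum_fun_apply)
  next
    case False
    then have zero: "right_translation G s f = 0" "neumann S f = 0" for s
      by (simp_all add: right_translation_def neumann_def)
    show ?thesis
      by (simp add: fun_eq_iff sum_fun_apply zero vN_zero[OF neumann_vN] vN_zero[OF m] vN_off[OF m False])
  qed
qed

end

end

section \<open>Spectral gap from non-amenability\<close>

lemma infsum_sum_swap:
  fixes g :: "'i \<Rightarrow> 'x \<Rightarrow> real"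
  assumes "finite I" "\<And>i. i \<in> I \<Longrightarrow> g i summable_on A"
  shows "(\<lambda>x. \<Sum>i\<in>I. g i x) summable_on A" "(\<Sum>\<^sub>\<infinity>x\<in>A. \<Sum>i\<in>I. g i x) = (\<Sum>i\<in>I. infsum (g i) A)"
proof -
  have "(\<lambda>x. \<Sum>i\<in>I. g i x) summable_on A \<and> (\<Sum>\<^sub>\<infinity>x\<in>A. \<Sum>i\<in>I. g i x) = (\<Sum>i\<in>I. infsum (g i) A)"
    using assms
  proof (induction I rule: finite_induct)
    case (insert i I)
    then have "g i summable_on A" "(\<lambda>x. \<Sum>i\<in>I. g i x) summable_on A" by auto
    from summable_on_add[OF this] infsum_add[OF this] insert show ?case by auto
  qed auto
  then show "(\<lambda>x. \<Sum>i\<in>I. g i x) summable_on A" "(\<Sum>\<^sub>\<infinity>x\<in>A. \<Sum>i\<in>I. g i x) = (\<Sum>i\<in>I. infsum (g i) A)"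
    by auto
qed

text \<open>Lagrange's identity evaluates the sum of the squares of \<open>cmod (a i - a j)\<close>
  over all pairs, and for distinct \<open>s\<close> and \<open>t\<close> the pairs
  \<open>(s, t)\<close> and \<open>(t, s)\<close> alone bound it from below.\<close>

lemma cmod_sum_lagrange:
  fixes a :: "'i \<Rightarrow> complex"
  assumes "finite S" "s \<in> S" "t \<in> S"
  shows "(cmod (a s - a t))\<^sup>2 + (cmod (\<Sum>i\<in>S. a i))\<^sup>2 \<le> card S * (\<Sum>i\<in>S. (cmod (a i))\<^sup>2)"
proof -
  have sq: "(cmod (u - v))\<^sup>2 = (cmod u)\<^sup>2 + (cmod v)\<^sup>2 - 2 * Re (u * cnj v)" for u v
    by (simp add: cmod_power2) (simp add: power2_eq_square algebra_simps)
  have mult_cnj: "Re (z * cnj z) = (cmod z)\<^sup>2" for z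
    by (simp add: cmod_power2) (simp add: power2_eq_square)
  have "(\<Sum>i\<in>S. \<Sum>j\<in>S. Re (a i * cnj (a j))) = Re ((\<Sum>i\<in>S. a i) * cnj (\<Sum>j\<in>S. a j))"
    by (simp only: cnj_sum sum_product Re_sum)
  also have "\<dots> = (cmod (\<Sum>i\<in>S. a i))\<^sup>2"
    by (rule mult_cnj)
  finally have re: "(\<Sum>i\<in>S. \<Sum>j\<in>S. Re (a i * cnj (a j))) = (cmod (\<Sum>i\<in>S. a i))\<^sup>2" .
  have "(\<Sum>i\<in>S. \<Sum>j\<in>S. (cmod (a i - a j))\<^sup>2)
      = 2 * (card S * (\<Sum>i\<in>S. (cmod (a i))\<^sup>2)) - 2 * (\<Sum>i\<in>S. \<Sum>j\<in>S. Re (a i * cnj (a j)))"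
    by (simp add: sq sum.distrib sum_subtractf sum_distrib_left[symmetric])
  also note re
  finally have tot: "(\<Sum>i\<in>S. \<Sum>j\<in>S. (cmod (a i - a j))\<^sup>2)
      = 2 * (card S * (\<Sum>i\<in>S. (cmod (a i))\<^sup>2)) - 2 * (cmod (\<Sum>i\<in>S. a i))\<^sup>2" .
  have "2 * (cmod (a s - a t))\<^sup>2 \<le> (\<Sum>p\<in>S \<times> S. (cmod (a (fst p) - a (snd p)))\<^sup>2)"
  proof (cases "s = t")
    case False
    have "2 * (cmod (a s - a t))\<^sup>2 = (\<Sum>p\<in>{(s, t), (t, s)}. (cmod (a (fst p) - a (snd p)))\<^sup>2)"
      using False by (simp add: norm_minus_commute)
    also have "\<dots> \<le> (\<Sum>p\<in>S \<times> S. (cmod (a (fst p) - a (snd p)))\<^sup>2)"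
      by (rule sum_mono2) (use assms in auto)
    finally show ?thesis .
  qed (auto intro: sum_nonneg)
  also have "\<dots> = (\<Sum>i\<in>S. \<Sum>j\<in>S. (cmod (a i - a j))\<^sup>2)"
    by (simp add: sum.cartesian_product case_prod_unfold)
  finally show ?thesis using tot by simp
qed

lemma ell2_norm_square: "(ell2_norm G f)\<^sup>2 = (\<Sum>\<^sub>\<infinity>x\<in>carrier G. (cmod (f x))\<^sup>2)"
  by (simp add: ell2_norm_def infsum_nonneg)

lemma ell2_summable: "f \<in> ell2 G \<Longrightarrow> (\<lambda>x. (cmod (f x))\<^sup>2) summable_on carrier G"
  by (simp add: ell2_def)

text \<open>A weighted arithmetic-geometric estimate with free parameter \<open>\<eta>\<close> takes
  the place of the Cauchy-Schwarz inequality. It holds pointwise and can therefore be summed over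
  any part of the group.\<close>

lemma infsum_square_diff_le:
  assumes "f \<in> ell2 G" "h \<in> ell2 G" "Y \<subseteq> carrier G" "0 < \<eta>"
  shows "\<bar>(\<Sum>\<^sub>\<infinity>x\<in>Y. (cmod (f x))\<^sup>2) - (\<Sum>\<^sub>\<infinity>x\<in>Y. (cmod (h x))\<^sup>2)\<bar> \<le>
    (ell2_norm G (\<lambda>x. f x - h x))\<^sup>2 / (2 * \<eta>) + \<eta> * ((ell2_norm G f)\<^sup>2 + (ell2_norm G h)\<^sup>2)"
proof -
  let ?F = "\<lambda>x. (cmod (f x))\<^sup>2" and ?H = "\<lambda>x. (cmod (h x))\<^sup>2" and ?D = "\<lambda>x. (cmod (f x - h x))\<^sup>2"
  let ?g = "\<lambda>x. ?D x * (1 / (2 * \<eta>)) + \<eta> * (?F x + ?H x)"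
  have D: "(\<lambda>x. f x - h x) \<in> ell2 G" by (rule ell2_diff(1)[OF assms(1,2)])
  note s = ell2_summable[OF assms(1)] ell2_summable[OF assms(2)] ell2_summable[OF D]
  have sg: "?g summable_on carrier G"
    by (intro summable_on_add summable_on_cmult_left summable_on_cmult_right s)
  have ig: "infsum ?g (carrier G) =
      (ell2_norm G (\<lambda>x. f x - h x))\<^sup>2 / (2 * \<eta>) + \<eta> * ((ell2_norm G f)\<^sup>2 + (ell2_norm G h)\<^sup>2)"
    by (simp add: infsum_add infsum_cmult_left' infsum_cmult_right' summable_on_add summable_on_cmult_left
        summable_on_cmult_right s ell2_norm_square del: times_divide_eq_right mult_1_right) simp
  have pt: "\<bar>?F x - ?H x\<bar> \<le> ?g x" for x
  proof -
    define u v d where "u = cmod (f x)" and "v = cmod (h x)" and "d = cmod (f x - h x)"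
    have "\<bar>u - v\<bar> \<le> d" unfolding u_def v_def d_def by (rule norm_triangle_ineq3)
    have nn: "0 \<le> u" "0 \<le> v" "0 \<le> d" by (auto simp: u_def v_def d_def)
    have "\<bar>u\<^sup>2 - v\<^sup>2\<bar> = \<bar>u - v\<bar> * (u + v)"
      using nn by (simp add: power2_eq_square square_diff_square_factored abs_mult mult.commute)
    also have "\<dots> \<le> d * (u + v)"
      using nn \<open>\<bar>u - v\<bar> \<le> d\<close> by (intro mult_right_mono) auto
    also have "\<dots> \<le> d\<^sup>2 * (1 / (2 * \<eta>)) + \<eta> * (u\<^sup>2 + v\<^sup>2)"
    proof -
      \<comment> \<open>Expanding these squares gives the pointwise estimate after division by
        \<open>2 * \<eta>\<close>.\<close>
      have "0 \<le> (d - \<eta> * (u + v))\<^sup>2 + \<eta>\<^sup>2 * (u - v)\<^sup>2" by simp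
      then have "2 * \<eta> * (d * (u + v)) \<le> d\<^sup>2 + 2 * \<eta>\<^sup>2 * (u\<^sup>2 + v\<^sup>2)"
        by (simp add: power2_eq_square algebra_simps)
      also have "\<dots> = 2 * \<eta> * (d\<^sup>2 * (1 / (2 * \<eta>)) + \<eta> * (u\<^sup>2 + v\<^sup>2))"
        using assms(4) by (simp add: distrib_left power2_eq_square)
      finally show ?thesis using assms(4) by simp
    qed
    finally show ?thesis by (simp add: u_def v_def d_def)
  qed
  have sub: "k summable_on Y" if "k summable_on carrier G" for k :: "'a \<Rightarrow> real"
    by (rule summable_on_subset_banach[OF that assms(3)])
  have g0: "0 \<le> ?g x" for x using pt[of x] by linarith
  have "infsum ?g Y \<le> infsum ?g (carrier G)"
    by (rule infsum_mono_neutral[OF sub[OF sg] sg]) (use assms(3) g0 in auto)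
  moreover have "infsum ?F Y \<le> infsum (\<lambda>x. ?H x + ?g x) Y"
  proof (rule infsum_mono)
    show "?F x \<le> ?H x + ?g x" for x using pt[of x] by linarith
  qed (intro sub summable_on_add s sg)+
  moreover have "infsum ?H Y \<le> infsum (\<lambda>x. ?F x + ?g x) Y"
  proof (rule infsum_mono)
    show "?H x \<le> ?F x + ?g x" for x using pt[of x] by linarith
  qed (intro sub summable_on_add s sg)+
  ultimately show ?thesis
    using infsum_add[OF sub[OF s(1)] sub[OF sg]] infsum_add[OF sub[OF s(2)] sub[OF sg]] ig by linarith
qed

section \<open>From almost invariant vectors to an invariant mean on a subgroup\<close>

context group
begin

text \<open>\<open>cmod_sum_lagrange\<close> for the pair of \<open>\<one>\<close> and
  \<open>s\<close> is summed over the group, where all translates have the norm of \<open>f\<close>.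
  Thus a vector whose average is almost as long as itself is almost invariant.\<close>

lemma avg_almost_invariant:
  assumes S: "finite S" "\<one> \<in> S" "S \<subseteq> carrier G" and f: "f \<in> ell2 G" and s: "s \<in> S"
  shows "(ell2_norm G (\<lambda>x. f x - right_translation G s f x))\<^sup>2 + (real (card S))\<^sup>2 * (ell2_norm G (avg S f))\<^sup>2
    \<le> (real (card S))\<^sup>2 * (ell2_norm G f)\<^sup>2"
proof -
  have R: "right_translation G t f \<in> ell2 G" "ell2_norm G (right_translation G t f) = ell2_norm G f"
    if "t \<in> S" for t
    using ell2_right_translation[OF _ f] S(3) that by auto
  have card: "card S \<noteq> 0" using S by auto
  note sum = ell2_summable[OF ell2_diff(1)[OF f R(1)[OF s]]]
    summable_on_cmult_right[OF ell2_summable[OF vN_closed[OF avg_vN[OF S(1,3)] f]]]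
  have pt: "(cmod (f x - right_translation G s f x))\<^sup>2 + (real (card S))\<^sup>2 * (cmod (avg S f x))\<^sup>2
      \<le> card S * (\<Sum>t\<in>S. (cmod (right_translation G t f x))\<^sup>2)" if "x \<in> carrier G" for x
  proof -
    have "right_translation G \<one> f x = f x"
      using that f by (simp add: right_translation_apply)
    moreover have "(real (card S))\<^sup>2 * (cmod (avg S f x))\<^sup>2 = (cmod (\<Sum>t\<in>S. right_translation G t f x))\<^sup>2"
      using card by (simp add: avg_def norm_divide power_divide)
    ultimately show ?thesis
      using cmod_sum_lagrange[OF S(1,2) s, of "\<lambda>t. right_translation G t f x"] by simp
  qed
  have "(ell2_norm G (\<lambda>x. f x - right_translation G s f x))\<^sup>2 + (real (card S))\<^sup>2 * (ell2_norm G (avg S f))\<^sup>2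
      = (\<Sum>\<^sub>\<infinity>x\<in>carrier G. (cmod (f x - right_translation G s f x))\<^sup>2 + (real (card S))\<^sup>2 * (cmod (avg S f x))\<^sup>2)"
    by (simp add: infsum_add[OF sum] ell2_norm_square infsum_cmult_right')
  also have "\<dots> \<le> (\<Sum>\<^sub>\<infinity>x\<in>carrier G. card S * (\<Sum>t\<in>S. (cmod (right_translation G t f x))\<^sup>2))"
    by (rule infsum_mono)
      (auto intro!: summable_on_add sum pt summable_on_cmult_right infsum_sum_swap S(1) ell2_summable R)
  also have "\<dots> = card S * (\<Sum>t\<in>S. (ell2_norm G (right_translation G t f))\<^sup>2)"
    by (simp add: infsum_cmult_right' infsum_sum_swap(2)[OF S(1) ell2_summable[OF R(1)]] ell2_norm_square)
  also have "\<dots> = (real (card S))\<^sup>2 * (ell2_norm G f)\<^sup>2"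
    by (simp add: R power2_eq_square)
  finally show ?thesis .
qed

text \<open>\<open>r x\<close> leads from \<open>x\<close> to a chosen representative of its left
  coset. It turns right translation on \<open>G\<close> into left translation by inverses on
  \<open>H\<close>, so that densities on \<open>G\<close> can be pushed forward to
  \<open>H\<close>.\<close>

lemma coset_retraction:
  assumes "subgroup H G"
  obtains r where "\<And>x. x \<in> carrier G \<Longrightarrow> r x \<in> H"
    and "\<And>x s. x \<in> carrier G \<Longrightarrow> s \<in> H \<Longrightarrow> r (x \<otimes> s) = inv s \<otimes> r x"
proof -
  interpret H: subgroup H G by fact
  define rep where "rep x = (SOME y. y \<in> carrier G \<and> inv x \<otimes> y \<in> H)" for x
  have rep: "rep x \<in> carrier G \<and> inv x \<otimes> rep x \<in> H" if "x \<in> carrier G" for x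
    unfolding rep_def by (rule someI[of _ x]) (use that in auto)
  \<comment> \<open>\<open>x\<close> and \<open>x \<otimes> s\<close> define the same coset, so the
    choice operator is applied to equivalent predicates.\<close>
  have inv: "rep (x \<otimes> s) = rep x" if x: "x \<in> carrier G" and s: "s \<in> H" for x s
  proof -
    have sc: "s \<in> carrier G" using s by auto
    have "inv (x \<otimes> s) \<otimes> y \<in> H \<longleftrightarrow> inv x \<otimes> y \<in> H" if y: "y \<in> carrier G" for y
    proof -
      have eq: "inv (x \<otimes> s) \<otimes> y = inv s \<otimes> (inv x \<otimes> y)"
        using x sc y by (simp add: inv_mult_group m_assoc)
      then have "inv x \<otimes> y = s \<otimes> (inv (x \<otimes> s) \<otimes> y)"
        using x sc y by (simp add: m_assoc[symmetric])
      with eq s show ?thesis by (metis H.m_closed H.m_inv_closed)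
    qed
    then show ?thesis unfolding rep_def by meson
  qed
  show ?thesis
  proof (rule that[of "\<lambda>x. inv x \<otimes> rep x"])
    fix x s assume x: "x \<in> carrier G" and s: "s \<in> H"
    then have "s \<in> carrier G" by auto
    then show "inv (x \<otimes> s) \<otimes> rep (x \<otimes> s) = inv s \<otimes> (inv x \<otimes> rep x)"
      using rep[OF x] x by (simp add: inv[OF x s] inv_mult_group m_assoc)
  qed (use rep in auto)
qed

text \<open>
  If \<open>f\<close> almost realises the norm \<open>1\<close> of the averaging operator, then \<open>f\<close> is almost invariant, and
  so is the probability density \<open>(cmod f)\<^sup>2\<close>; it is pushed forward to \<open>H\<close> along the left cosets.
\<close>

lemma approximate_mean:
  assumes H: "subgroup H G"
    and nogap: "\<And>S \<rho>. finite S \<Longrightarrow> S \<noteq> {} \<Longrightarrow> S \<subseteq> H \<Longrightarrow> 0 \<le> \<rho> \<Longrightarrow> \<rho> < 1 \<Longrightarrow>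
      \<exists>f\<in>ell2 G. \<rho> * ell2_norm G f < ell2_norm G (avg S f)"
    and S0: "finite S0" "S0 \<subseteq> H" and \<epsilon>: "0 < (\<epsilon>::real)"
  shows "\<exists>\<mu> :: 'a set \<Rightarrow> real. (\<forall>A. 0 \<le> \<mu> A \<and> \<mu> A \<le> 1) \<and> \<mu> H = 1 \<and>
    (\<forall>A B. A \<inter> B = {} \<longrightarrow> \<mu> (A \<union> B) = \<mu> A + \<mu> B) \<and>
    (\<forall>s\<in>S0. \<forall>A. A \<subseteq> H \<longrightarrow> \<bar>\<mu> (s <# A) - \<mu> A\<bar> \<le> \<epsilon>)"
proof -
  interpret H: subgroup H G by fact
  obtain r where r: "\<And>x. x \<in> carrier G \<Longrightarrow> r x \<in> H"
    "\<And>x s. x \<in> carrier G \<Longrightarrow> s \<in> H \<Longrightarrow> r (x \<otimes> s) = inv s \<otimes> r x"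
    using coset_retraction[OF H] by blast
  \<comment> \<open>The identity is added so that \<open>avg_almost_invariant\<close> compares
    \<open>f\<close> itself with its translates.\<close>
  define S where "S = insert \<one> S0"
  have S: "finite S" "S \<noteq> {}" "S \<subseteq> H" "\<one> \<in> S" "S \<subseteq> carrier G"
    using S0 by (auto simp: S_def)
  define n where "n = real (card S)"
  have n: "0 < n" using S by (auto simp: n_def card_gt_0_iff)
  \<comment> \<open>The second term makes the defect \<open>n\<^sup>2 * \<delta>\<close> at most
    \<open>\<epsilon>\<^sup>2 / 4\<close>; the cap \<open>1\<close> keeps the argument of
    \<open>sqrt (1 - \<delta>)\<close> nonnegative.\<close>
  define \<delta> where "\<delta> = min 1 (\<epsilon>\<^sup>2 / (4 * n\<^sup>2))"
  have \<delta>: "0 < \<delta>" "\<delta> \<le> 1" "n\<^sup>2 * \<delta> \<le> \<epsilon>\<^sup>2 / 4"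
    using n \<epsilon> by (auto simp: \<delta>_def min_def field_simps)
  obtain f where f: "f \<in> ell2 G" and gt: "sqrt (1 - \<delta>) * ell2_norm G f < ell2_norm G (avg S f)"
    using nogap[OF S(1-3), of "sqrt (1 - \<delta>)"] \<delta> by auto
  define q where "q = (ell2_norm G f)\<^sup>2"
  have Rf: "right_translation G s f \<in> ell2 G" "ell2_norm G (right_translation G s f) = ell2_norm G f"
    if "s \<in> S" for s
    using ell2_right_translation[OF _ f] S(5) that by auto
  have "(sqrt (1 - \<delta>) * ell2_norm G f)\<^sup>2 < (ell2_norm G (avg S f))\<^sup>2"
    using gt \<delta> by (intro power_strict_mono) auto
  then have av: "(1 - \<delta>) * q < (ell2_norm G (avg S f))\<^sup>2"
    using \<delta> by (simp add: power_mult_distrib q_def)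
  have inv: "(ell2_norm G (\<lambda>x. f x - right_translation G s f x))\<^sup>2 + n\<^sup>2 * (ell2_norm G (avg S f))\<^sup>2 \<le> n\<^sup>2 * q"
    if "s \<in> S" for s
    using avg_almost_invariant[OF S(1,4,5) f that] by (simp add: n_def q_def)
  \<comment> \<open>The strict inequality for the average forces \<open>f\<close> to be nonzero, so
    that dividing by \<open>q\<close> normalises its square to a probability density.\<close>
  have "0 \<le> (1 - \<delta>) * q" using \<delta> by (simp add: q_def)
  then have "0 < (ell2_norm G (avg S f))\<^sup>2" using av by linarith
  then have "0 < n\<^sup>2 * (ell2_norm G (avg S f))\<^sup>2" using n by simp
  also have "\<dots> \<le> n\<^sup>2 * q"
    using inv[OF S(4)] zero_le_power2[of "ell2_norm G (\<lambda>x. f x - right_translation G \<one> f x)"] by linarith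
  finally have q: "0 < q" using n by (simp add: zero_less_mult_iff)
  have close: "(ell2_norm G (\<lambda>x. f x - right_translation G s f x))\<^sup>2 \<le> \<epsilon>\<^sup>2 / 4 * q" if "s \<in> S" for s
  proof -
    have "n\<^sup>2 * ((1 - \<delta>) * q) \<le> n\<^sup>2 * (ell2_norm G (avg S f))\<^sup>2"
      using av by (intro mult_left_mono) auto
    then have "(ell2_norm G (\<lambda>x. f x - right_translation G s f x))\<^sup>2 \<le> (n\<^sup>2 * \<delta>) * q"
      using inv[OF that] by (simp add: algebra_simps)
    also have "\<dots> \<le> \<epsilon>\<^sup>2 / 4 * q"
      using \<delta> q by (intro mult_right_mono) auto
    finally show ?thesis .
  qed
  let ?F = "\<lambda>x. (cmod (f x))\<^sup>2"
  define P where "P A = {x \<in> carrier G. r x \<in> A}" for A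
  define \<mu> where "\<mu> A = infsum ?F (P A) / q" for A
  have sF: "?F summable_on Y" if "Y \<subseteq> carrier G" for Y
    by (rule summable_on_subset_banach[OF ell2_summable[OF f] that])
  have qF: "infsum ?F (carrier G) = q"
    by (simp add: q_def ell2_norm_square)
  have PH: "P H = carrier G" using r by (auto simp: P_def)
  show ?thesis
  proof (intro exI[of _ \<mu>] conjI allI impI ballI)
    show "0 \<le> \<mu> A" for A using q by (simp add: \<mu>_def infsum_nonneg)
    have "infsum ?F (P A) \<le> infsum ?F (carrier G)" for A
      by (rule infsum_mono_neutral) (auto simp: P_def intro!: sF)
    then show "\<mu> A \<le> 1" for A using q qF by (simp add: \<mu>_def)
    show "\<mu> H = 1" using q by (simp add: \<mu>_def PH qF)
    show "\<mu> (A \<union> B) = \<mu> A + \<mu> B" if "A \<inter> B = {}" for A B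
    proof -
      have "P (A \<union> B) = P A \<union> P B" "P A \<inter> P B = {}" "P A \<subseteq> carrier G" "P B \<subseteq> carrier G"
        using that by (auto simp: P_def)
      then show ?thesis by (simp add: \<mu>_def infsum_Un_disjoint sF add_divide_distrib)
    qed
    show "\<bar>\<mu> (s <# A) - \<mu> A\<bar> \<le> \<epsilon>" if s: "s \<in> S0" and A: "A \<subseteq> H" for s A
    proof -
      have sS: "s \<in> S" "s \<in> H" "s \<in> carrier G" using s S0 by (auto simp: S_def)
      define Y where "Y = {x \<in> carrier G. r (x \<otimes> s) \<in> A}"
      \<comment> \<open>By equivariance of \<open>r\<close>, a left translate of \<open>A\<close> in
        \<open>H\<close> corresponds to a right translate of its preimage in
        \<open>G\<close>.\<close>
      have "r x \<in> s <# A \<longleftrightarrow> r (x \<otimes> s) \<in> A" if "x \<in> carrier G" for x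
      proof -
        have rx: "r x \<in> carrier G" using r(1)[OF that] by auto
        have "r x \<in> s <# A \<longleftrightarrow> (\<exists>a\<in>A. r x = s \<otimes> a)" by (auto simp: l_coset_def)
        also have "\<dots> \<longleftrightarrow> inv s \<otimes> r x \<in> A"
        proof
          assume "\<exists>a\<in>A. r x = s \<otimes> a"
          then obtain a where a: "a \<in> A" "r x = s \<otimes> a" by auto
          then have "a \<in> carrier G" using A by auto
          then show "inv s \<otimes> r x \<in> A" using a sS by (simp add: m_assoc[symmetric])
        next
          assume "inv s \<otimes> r x \<in> A"
          moreover have "r x = s \<otimes> (inv s \<otimes> r x)" using sS rx by (simp add: m_assoc[symmetric])
          ultimately show "\<exists>a\<in>A. r x = s \<otimes> a" by blast
        qed
        finally show ?thesis using r(2)[OF that sS(2)] by simp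
      qed
      then have PY: "P (s <# A) = Y" by (auto simp: P_def Y_def)
      have "bij_betw (\<lambda>x. x \<otimes> s) Y (P A)"
        by (rule bij_betw_byWitness[where f' = "\<lambda>x. x \<otimes> inv s"]) (auto simp: Y_def P_def m_assoc sS)
      then have "infsum ?F (P A) = (\<Sum>\<^sub>\<infinity>x\<in>Y. (cmod (f (x \<otimes> s)))\<^sup>2)"
        using infsum_reindex_bij_betw[of "\<lambda>x. x \<otimes> s" Y "P A" ?F] by simp
      also have "\<dots> = (\<Sum>\<^sub>\<infinity>x\<in>Y. (cmod (right_translation G s f x))\<^sup>2)"
        by (rule infsum_cong) (auto simp: Y_def right_translation_apply f)
      finally have PA: "infsum ?F (P A) = (\<Sum>\<^sub>\<infinity>x\<in>Y. (cmod (right_translation G s f x))\<^sup>2)" .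
      \<comment> \<open>With the parameter \<open>\<epsilon> / 4\<close>, each of the two summands
        contributes at most \<open>\<epsilon> / 2 * q\<close>.\<close>
      have "\<bar>infsum ?F Y - infsum ?F (P A)\<bar> \<le>
          (ell2_norm G (\<lambda>x. f x - right_translation G s f x))\<^sup>2 / (2 * (\<epsilon> / 4)) + \<epsilon> / 4 * (q + q)"
        using infsum_square_diff_le[OF f Rf(1)[OF sS(1)], of Y "\<epsilon> / 4"] \<epsilon>
        unfolding PA by (simp add: Y_def q_def Rf(2)[OF sS(1)])
      also have "\<dots> \<le> (\<epsilon>\<^sup>2 / 4 * q) / (2 * (\<epsilon> / 4)) + \<epsilon> / 4 * (q + q)"
        using close[OF sS(1)] \<epsilon> by (intro add_right_mono divide_right_mono) auto
      also have "\<dots> = \<epsilon> * q"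
        using \<epsilon> by (simp add: field_simps power2_eq_square)
      finally have "\<bar>infsum ?F Y - infsum ?F (P A)\<bar> \<le> \<epsilon> * q" .
      moreover have "\<mu> (s <# A) - \<mu> A = (infsum ?F Y - infsum ?F (P A)) / q"
        by (simp add: \<mu>_def PY diff_divide_distrib)
      ultimately show ?thesis using q by (simp add: abs_divide pos_divide_le_eq)
    qed
  qed
qed

text \<open>Compactness: the conditions of being additive, normalised and almost invariant cut out
  closed subsets of a product of unit intervals. They have the finite intersection property by
  \<open>approximate_mean\<close>, and a common point is an invariant mean.\<close>

lemma amenable_if_no_gap:
  assumes H: "subgroup H G"
    and nogap: "\<And>S \<rho>. finite S \<Longrightarrow> S \<noteq> {} \<Longrightarrow> S \<subseteq> H \<Longrightarrow> 0 \<le> \<rho> \<Longrightarrow> \<rho> < 1 \<Longrightarrow>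
      \<exists>f\<in>ell2 G. \<rho> * ell2_norm G f < ell2_norm G (avg S f)"
  shows "amenable (G\<lparr>carrier := H\<rparr>)"
proof -
  interpret H: subgroup H G by fact
  define K :: "('a set \<Rightarrow> real) set" where "K = Pi\<^sub>E UNIV (\<lambda>_. {0..1})"
  have K: "compact K"
    using compactin_PiE[of "\<lambda>_. euclidean" UNIV "\<lambda>_::'a set. {0..1::real}"]
    by (simp add: K_def euclidean_product_topology)
  have cont: "continuous_on UNIV (\<lambda>\<mu> :: 'a set \<Rightarrow> real. \<mu> A)" for A
    by simp
  define E where "E = (\<lambda>(s, \<epsilon>). {\<mu> :: 'a set \<Rightarrow> real. \<mu> H = 1 \<and>
      (\<forall>A B. A \<inter> B = {} \<longrightarrow> \<mu> (A \<union> B) = \<mu> A + \<mu> B) \<and> (\<forall>A. A \<subseteq> H \<longrightarrow> \<bar>\<mu> (s <# A) - \<mu> A\<bar> \<le> \<epsilon>)})"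
  have closed: "closed (E p)" for p
  proof -
    obtain s \<epsilon> where p: "p = (s, \<epsilon>)" by (cases p)
    show ?thesis
      unfolding p E_def prod.case
      by (intro closed_Collect_conj closed_Collect_all closed_Collect_imp closed_Collect_eq
          closed_Collect_le continuous_intros cont open_Collect_const)
  qed
  have fip: "K \<inter> (\<Inter>p\<in>I. E p) \<noteq> {}" if I: "finite I" "I \<subseteq> H \<times> {0<..}" for I
  proof -
    \<comment> \<open>One tolerance serves all the finitely many conditions; inserting
      \<open>1\<close> covers the empty family.\<close>
    define \<epsilon> where "\<epsilon> = Min (insert 1 (snd ` I))"
    have fst_I: "finite (fst ` I)" "fst ` I \<subseteq> H" and \<epsilon>: "0 < \<epsilon>"
      using I by (auto simp: \<epsilon>_def)
    obtain \<mu> where \<mu>: "\<forall>A. 0 \<le> \<mu> A \<and> \<mu> A \<le> 1" "\<mu> H = 1"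
      "\<forall>A B. A \<inter> B = {} \<longrightarrow> \<mu> (A \<union> B) = \<mu> A + \<mu> B"
      "\<forall>s\<in>fst ` I. \<forall>A. A \<subseteq> H \<longrightarrow> \<bar>\<mu> (s <# A) - \<mu> A\<bar> \<le> \<epsilon>"
      using approximate_mean[OF H nogap fst_I \<epsilon>] by blast
    have "\<mu> \<in> E p" if p: "p \<in> I" for p
    proof -
      obtain s e where eq: "p = (s, e)" by (cases p)
      have "snd p \<in> snd ` I" "fst p \<in> fst ` I" using p by blast+
      then have "\<epsilon> \<le> e" and s: "s \<in> fst ` I" using I by (simp_all add: \<epsilon>_def eq)
      then have "\<bar>\<mu> (s <# A) - \<mu> A\<bar> \<le> e" if "A \<subseteq> H" for A
        using \<mu>(4)[rule_format, OF s that] by linarith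
      then show ?thesis using \<mu>(2,3) by (simp add: E_def eq)
    qed
    moreover have "\<mu> \<in> K" using \<mu>(1) by (auto simp: K_def)
    ultimately show ?thesis by blast
  qed
  have "K \<inter> (\<Inter>p\<in>H \<times> {0<..}. E p) \<noteq> {}"
    by (rule compact_imp_fip_image[OF K closed fip])
  then obtain \<mu> where \<mu>: "\<mu> \<in> K" "\<And>s \<epsilon>. s \<in> H \<Longrightarrow> 0 < \<epsilon> \<Longrightarrow> \<mu> \<in> E (s, \<epsilon>)"
    by blast
  have "\<mu> H = 1 \<and> (\<forall>A B. A \<inter> B = {} \<longrightarrow> \<mu> (A \<union> B) = \<mu> A + \<mu> B)"
    using \<mu>(2)[OF H.one_closed, of 1] by (simp add: E_def)
  moreover have "\<mu> (s <# A) = \<mu> A" if "s \<in> H" "A \<subseteq> H" for s A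
  proof -
    have "\<bar>\<mu> (s <# A) - \<mu> A\<bar> \<le> 0 + \<epsilon>" if "0 < \<epsilon>" for \<epsilon>
      using \<mu>(2)[OF \<open>s \<in> H\<close> that] \<open>A \<subseteq> H\<close> by (simp add: E_def)
    then have "\<bar>\<mu> (s <# A) - \<mu> A\<bar> \<le> 0" by (rule field_le_epsilon)
    then show ?thesis by simp
  qed
  moreover have "0 \<le> \<mu> A" for A using \<mu>(1) by (auto simp: K_def PiE_def Pi_def)
  ultimately show ?thesis
    unfolding amenable_def by (intro exI[of _ \<mu>]) (auto simp: l_coset_def)
qed

text \<open>The contrapositive of \<open>amenable_if_no_gap\<close> combined with the Neumann
  series. The last two conclusions provide what \<open>T_inverse\<close> and \<open>T_act\<close>
  ask for.\<close>

lemma nonamenable_inverse: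
  assumes H: "subgroup H G" "\<not> amenable (G\<lparr>carrier := H\<rparr>)"
  obtains S B where "S \<subseteq> H" "B \<in> group_von_Neumann_algebra G"
    and "\<And>m. m \<in> group_von_Neumann_algebra G \<Longrightarrow>
      (\<Sum>s\<in>S. ((- (m \<circ> B)) \<circ> right_translation G s) - (- (m \<circ> B))) = m"
    and "\<And>g. g \<in> carrier G \<Longrightarrow> (\<And>s. s \<in> H \<Longrightarrow> s \<otimes> g = g \<otimes> s) \<Longrightarrow>
      B \<circ> right_translation G g = right_translation G g \<circ> B"
proof -
  obtain S \<rho> where S: "finite S" "S \<noteq> {}" "S \<subseteq> H" and \<rho>: "0 \<le> \<rho>" "\<rho> < 1"
    and gap: "\<And>f. f \<in> ell2 G \<Longrightarrow> ell2_norm G (avg S f) \<le> \<rho> * ell2_norm G f"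
    using amenable_if_no_gap[OF H(1)] H(2) by (metis not_le)
  have SG: "S \<subseteq> carrier G" using S subgroup.subset[OF H(1)] by auto
  show ?thesis
    by (rule that[OF S(3) neumann_vN[OF S(1,2) SG \<rho> gap] vN_neumann_inverse[OF S(1,2) SG \<rho> gap]
        neumann_commute[OF S(1,2) SG \<rho> gap]]) (use S(3) in auto)
qed

end

section \<open>Disjoint open sets\<close>

text \<open>Perfectness gives a second point in \<open>V\<close>, and the Hausdorff property
  separates the two points.\<close>

lemma perfect_Hausdorff_split:
  assumes "perfect_topology X" "Hausdorff_space X" "openin X V" "V \<noteq> {}"
  shows "\<exists>A B. openin X A \<and> openin X B \<and> A \<noteq> {} \<and> B \<noteq> {} \<and> A \<subseteq> V \<and> B \<subseteq> V \<and> A \<inter> B = {}"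
proof -
  obtain x where x: "x \<in> V" using assms(4) by auto
  then have xE: "x \<in> topspace X" using openin_subset[OF assms(3)] by auto
  have "V \<noteq> {x}" using assms(1,3) xE by (auto simp: perfect_topology_def)
  then obtain y where y: "y \<in> V" "y \<noteq> x" using x by auto
  then have "y \<in> topspace X" using openin_subset[OF assms(3)] by auto
  then obtain A B where "openin X A" "openin X B" "x \<in> A" "y \<in> B" "disjnt A B"
    using assms(2) xE y(2) unfolding Hausdorff_space_def by metis
  then show ?thesis
    using x y assms(3) by (intro exI[of _ "A \<inter> V"] exI[of _ "B \<inter> V"]) (auto simp: disjnt_def)
qed

text \<open>Infinite sequences are used so that the induction, which takes up a new cell at each
  step, never runs out of cells.\<close>

definition disjoint_opens :: "'x topology \<Rightarrow> (nat \<Rightarrow> 'x set) set" where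
  "disjoint_opens X = {v. (\<forall>i. openin X (v i) \<and> v i \<noteq> {}) \<and> (\<forall>i j. i \<noteq> j \<longrightarrow> v i \<inter> v j = {})}"

text \<open>Split the space into two disjoint open parts, keep the part \<open>A\<close>, and split
  the part \<open>B\<close> again. The parts kept along the way form the sequence.\<close>

lemma disjoint_opens_nonempty:
  assumes "topspace X \<noteq> {}" "perfect_topology X" "Hausdorff_space X"
  shows "\<exists>v. v \<in> disjoint_opens X"
proof -
  obtain A B where AB: "\<And>V. openin X V \<Longrightarrow> V \<noteq> {} \<Longrightarrow> openin X (A V) \<and> openin X (B V) \<and>
      A V \<noteq> {} \<and> B V \<noteq> {} \<and> A V \<subseteq> V \<and> B V \<subseteq> V \<and> A V \<inter> B V = {}"
    using perfect_Hausdorff_split[OF assms(2,3)] by metis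
  define V where "V n = (B ^^ n) (topspace X)" for n
  have V: "openin X (V n) \<and> V n \<noteq> {}" for n
    by (induction n) (use assms(1) AB in \<open>auto simp: V_def\<close>)
  have sub: "A (V n) \<subseteq> V n" "B (V n) \<subseteq> V n" "A (V n) \<inter> B (V n) = {}" for n
    using AB[of "V n"] V[of n] by simp_all
  have "V (n + k) \<subseteq> V n" for n k
  proof (induction k)
    case (Suc k)
    have "V (n + Suc k) = B (V (n + k))" by (simp add: V_def)
    then show ?case using sub(2)[of "n + k"] Suc by simp
  qed simp
  then have "A (V i) \<inter> A (V j) = {}" if "i < j" for i j
  proof -
    have "A (V j) \<subseteq> V j" by (rule sub)
    also have "V j \<subseteq> V (Suc i)"
      using \<open>\<And>n k. V (n + k) \<subseteq> V n\<close>[of "Suc i" "j - Suc i"] that by simp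
    also have "V (Suc i) = B (V i)" by (simp add: V_def)
    finally show ?thesis using sub(3)[of i] by blast
  qed
  then have "A (V i) \<inter> A (V j) = {}" if "i \<noteq> j" for i j
    using that by (metis Int_commute linorder_neqE_nat)
  then show ?thesis
    using AB V by (intro exI[of _ "\<lambda>n. A (V n)"]) (auto simp: disjoint_opens_def)
qed

text \<open>Taking the least index that meets \<open>W\<close> is a canonical choice, so refinement
  is equivariant. If no entry meets \<open>W\<close>, there is nothing to cut.\<close>

definition refine :: "'x set \<Rightarrow> (nat \<Rightarrow> 'x set) \<Rightarrow> 'x set" where
  "refine W v = (if \<exists>i. W \<inter> v i \<noteq> {} then W \<inter> v (LEAST i. W \<inter> v i \<noteq> {}) else W)"

lemma refine_subset: "refine W v \<subseteq> W"
  by (simp add: refine_def)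

lemma refine_open:
  assumes "openin X W" "W \<noteq> {}" "v \<in> disjoint_opens X"
  shows "openin X (refine W v) \<and> refine W v \<noteq> {}"
  using assms LeastI_ex[of "\<lambda>i. W \<inter> v i \<noteq> {}"]
  by (auto simp: refine_def disjoint_opens_def)

lemma refine_dichotomy:
  assumes "v \<in> disjoint_opens X"
  shows "refine W v \<subseteq> v i \<or> refine W v \<inter> v i = {}"
proof (cases "\<exists>i. W \<inter> v i \<noteq> {}")
  case True
  let ?k = "LEAST i. W \<inter> v i \<noteq> {}"
  have "refine W v \<subseteq> v ?k" using True by (simp add: refine_def)
  then show ?thesis using assms by (cases "i = ?k") (auto simp: disjoint_opens_def, blast)
qed (auto simp: refine_def)

lemma foldl_refine_open:
  assumes "openin X W" "W \<noteq> {}" "set \<sigma> \<subseteq> disjoint_opens X"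
  shows "openin X (foldl refine W \<sigma>) \<and> foldl refine W \<sigma> \<noteq> {}"
  using assms by (induction \<sigma> arbitrary: W) (auto simp: refine_open)

lemma foldl_refine_subset: "foldl refine W \<sigma> \<subseteq> W"
proof (induction \<sigma> arbitrary: W)
  case (Cons v \<sigma>)
  show ?case using Cons[of "refine W v"] refine_subset[of W v] by simp
qed simp

text \<open>The step at \<open>v\<close> establishes the alternative, and later steps only shrink
  the set and so preserve it.\<close>

lemma foldl_refine_dichotomy:
  assumes "set \<sigma> \<subseteq> disjoint_opens X" "v \<in> set \<sigma>"
  shows "foldl refine W \<sigma> \<subseteq> v i \<or> foldl refine W \<sigma> \<inter> v i = {}"
  using assms
proof (induction \<sigma> arbitrary: W)
  case (Cons u \<sigma>)
  show ?case
  proof (cases "v = u")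
    case True
    then show ?thesis
      using refine_dichotomy[of u X W i] foldl_refine_subset[of "refine W u" \<sigma>] Cons.prems by auto
  qed (use Cons in auto)
qed simp

definition cell :: "(nat \<Rightarrow> 'x set) list \<Rightarrow> nat \<Rightarrow> 'x set" where
  "cell \<sigma> j = foldl refine (hd \<sigma> j) (tl \<sigma>)"

lemma cell_open:
  assumes "\<sigma> \<noteq> []" "set \<sigma> \<subseteq> disjoint_opens X"
  shows "openin X (cell \<sigma> j)" "cell \<sigma> j \<noteq> {}"
  using assms foldl_refine_open[of X "hd \<sigma> j" "tl \<sigma>"]
  by (cases \<sigma>; auto simp: cell_def disjoint_opens_def)+

lemma cell_disjoint:
  assumes "\<sigma> \<noteq> []" "set \<sigma> \<subseteq> disjoint_opens X" "i \<noteq> j"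
  shows "cell \<sigma> i \<inter> cell \<sigma> j = {}"
proof -
  have "hd \<sigma> \<in> disjoint_opens X" using assms by (cases \<sigma>) auto
  then have "hd \<sigma> i \<inter> hd \<sigma> j = {}" using assms(3) by (auto simp: disjoint_opens_def)
  then show ?thesis
    using foldl_refine_subset[of "hd \<sigma> i" "tl \<sigma>"] foldl_refine_subset[of "hd \<sigma> j" "tl \<sigma>"]
    unfolding cell_def by blast
qed

text \<open>For the head of \<open>\<sigma>\<close> the alternative comes from the disjointness of
  its entries, for the other sequences from the cutting.\<close>

lemma cell_dichotomy:
  assumes "set \<sigma> \<subseteq> disjoint_opens X" "v \<in> set \<sigma>"
  shows "cell \<sigma> j \<subseteq> v i \<or> cell \<sigma> j \<inter> v i = {}"
proof -
  obtain u \<tau> where \<sigma>: "\<sigma> = u # \<tau>" using assms by (cases \<sigma>) auto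
  show ?thesis
  proof (cases "v = u")
    case True
    have "u j \<subseteq> u i \<or> u j \<inter> u i = {}" using assms \<sigma> by (cases "i = j") (auto simp: disjoint_opens_def)
    then show ?thesis
      using True foldl_refine_subset[of "u j" \<tau>] by (auto simp: cell_def \<sigma>)
  next
    case False
    then show ?thesis
      using assms foldl_refine_dichotomy[of \<tau> X v] by (auto simp: cell_def \<sigma>)
  qed
qed

section \<open>Groups with a deferment system\<close>

locale deferment = group G for G (structure) +
  fixes X :: "'x topology" and \<phi> :: "'a \<Rightarrow> 'x \<Rightarrow> 'x" and \<Delta> :: "'x set \<Rightarrow> 'a set"
  assumes acts: "acts_by_homeomorphisms G X \<phi>" and system: "deferment_system G X \<phi> \<Delta>"
begin

sublocale group_action G "topspace X" \<phi>
  using acts by (simp add: acts_by_homeomorphisms_def)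

lemma \<Delta>_subgroup: "openin X U \<Longrightarrow> subgroup (\<Delta> U) G"
  using system by (simp add: deferment_system_def)

lemma \<Delta>_carrier: "openin X U \<Longrightarrow> h \<in> \<Delta> U \<Longrightarrow> h \<in> carrier G"
  using \<Delta>_subgroup subgroup.mem_carrier by metis

lemma \<Delta>_support: "openin X U \<Longrightarrow> h \<in> \<Delta> U \<Longrightarrow> x \<in> topspace X \<Longrightarrow> x \<notin> U \<Longrightarrow> \<phi> h x = x"
  using system by (auto simp: deferment_system_def support_of_def)

lemma \<Delta>_conj: "openin X U \<Longrightarrow> g \<in> carrier G \<Longrightarrow> h \<in> \<Delta> U \<Longrightarrow> g \<otimes> h \<otimes> inv g \<in> \<Delta> (\<phi> g ` U)"
  using system unfolding deferment_system_def by blast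

text \<open>By normality the commutator of \<open>h\<close> and \<open>k\<close> lies in both
  factors of a direct product with two factors, and these meet trivially.\<close>

lemma \<Delta>_commute:
  assumes "openin X A" "openin X B" "A \<inter> B = {}" and h: "h \<in> \<Delta> A" and k: "k \<in> \<Delta> B"
  shows "h \<otimes> k = k \<otimes> h"
proof -
  define U where "U = (\<lambda>i::nat. if i = 1 then A else B)"
  let ?K = "subgroup_generated G (\<Delta> A \<union> \<Delta> B)"
  have I: "{1..2} = {1, 2::nat}" by auto
  have "\<forall>i\<in>{1..2}. openin X (U i)" "disjoint_family_on U {1..2}"
    using assms by (auto simp: U_def disjoint_family_on_def I)
  then have idp: "internal_direct_product G {1..2} (\<lambda>i. \<Delta> (U i))"
    using system unfolding deferment_system_def by blast
  have un: "(\<Union>j\<in>{1..2::nat}. \<Delta> (U j)) = \<Delta> A \<union> \<Delta> B" and un': "(\<Union>j\<in>{1..2::nat} - {1}. \<Delta> (U j)) = \<Delta> B"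
    unfolding I by (auto simp: U_def)
  have "\<Delta> (U 1) \<lhd> ?K \<and> \<Delta> (U 1) \<inter> generate G (\<Delta> B) = {\<one>}"
    using idp unfolding internal_direct_product_def un by (subst un'[symmetric]) simp
  then have nA: "\<Delta> A \<lhd> ?K" and int: "\<Delta> A \<inter> generate G (\<Delta> B) = {\<one>}" by (simp_all add: U_def)
  have "\<Delta> (U 2) \<lhd> ?K"
    using idp unfolding internal_direct_product_def un by simp
  then have nB: "\<Delta> B \<lhd> ?K" by (simp add: U_def)
  have hc: "h \<in> carrier G" and kc: "k \<in> carrier G" using \<Delta>_carrier assms by auto
  have K: "h \<in> carrier ?K" "k \<in> carrier ?K"
    using h k hc kc by (auto simp: carrier_subgroup_generated intro!: generate.incl)
  interpret A: subgroup "\<Delta> A" G by (rule \<Delta>_subgroup[OF assms(1)])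
  interpret B: subgroup "\<Delta> B" G by (rule \<Delta>_subgroup[OF assms(2)])
  have "k \<otimes> inv h \<otimes> inv k \<in> \<Delta> A"
    using normal.inv_op_closed2[OF nA K(2), of "inv h"] h K by simp
  then have "h \<otimes> (k \<otimes> inv h \<otimes> inv k) \<in> \<Delta> A" using h by simp
  moreover have "h \<otimes> k \<otimes> inv h \<in> \<Delta> B"
    using normal.inv_op_closed2[OF nB K(1) k] K by simp
  then have "(h \<otimes> k \<otimes> inv h) \<otimes> inv k \<in> \<Delta> B" using k by simp
  then have "(h \<otimes> k \<otimes> inv h) \<otimes> inv k \<in> generate G (\<Delta> B)" by (rule generate.incl)
  moreover have "h \<otimes> (k \<otimes> inv h \<otimes> inv k) = (h \<otimes> k \<otimes> inv h) \<otimes> inv k"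
    using hc kc by (simp add: m_assoc)
  ultimately have "(h \<otimes> k \<otimes> inv h) \<otimes> inv k = \<one>" using int by auto
  then have "h \<otimes> k \<otimes> inv h = k" using hc kc by (metis inv_equality inv_inv inv_closed m_closed)
  then show ?thesis using hc kc by (metis inv_solve_right' m_closed)
qed

text \<open>If \<open>U\<close> and \<open>V\<close> are disjoint, then \<open>h\<close> fixes
  \<open>V\<close> pointwise. If \<open>U\<close> lies in \<open>V\<close>, then \<open>h\<close>
  fixes the complement of \<open>V\<close> pointwise and, being a bijection of the space, preserves
  \<open>V\<close>.\<close>

lemma \<Delta>_preserves:
  assumes "openin X U" "V \<subseteq> topspace X" "h \<in> \<Delta> U" "U \<subseteq> V \<or> U \<inter> V = {}"
  shows "\<phi> h ` V = V"
proof -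
  have h: "h \<in> carrier G" by (rule \<Delta>_carrier[OF assms(1,3)])
  have UE: "U \<subseteq> topspace X" by (rule openin_subset[OF assms(1)])
  have fix_out: "\<phi> h ` Y = Y" if "Y \<subseteq> topspace X" "Y \<inter> U = {}" for Y
  proof -
    have "\<phi> h x = x" if "x \<in> Y" for x
      using \<Delta>_support[OF assms(1,3)] that \<open>Y \<subseteq> topspace X\<close> \<open>Y \<inter> U = {}\<close> by blast
    then show ?thesis by simp
  qed
  show ?thesis
  proof (cases "U \<subseteq> V")
    case True
    have "\<phi> h ` V = \<phi> h ` (topspace X - (topspace X - V))" using assms(2) by (simp add: double_diff)
    also have "\<dots> = \<phi> h ` topspace X - \<phi> h ` (topspace X - V)"
      by (rule inj_on_image_set_diff[OF inj_prop[OF h]]) auto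
    also have "\<phi> h ` (topspace X - V) = topspace X - V"
      by (rule fix_out) (use True in auto)
    finally show ?thesis using surj_prop[OF h] assms(2) by (simp add: double_diff)
  next
    case False
    then show ?thesis using fix_out[OF assms(2)] assms(4) by auto
  qed
qed

section \<open>The group action on sequences of disjoint open sets and on their cells\<close>

definition move :: "'a \<Rightarrow> (nat \<Rightarrow> 'x set) \<Rightarrow> nat \<Rightarrow> 'x set" where
  "move g v = (\<lambda>i. \<phi> g ` v i)"

lemma image_Int:
  "g \<in> carrier G \<Longrightarrow> A \<subseteq> topspace X \<Longrightarrow> B \<subseteq> topspace X \<Longrightarrow> \<phi> g ` (A \<inter> B) = \<phi> g ` A \<inter> \<phi> g ` B"
  by (rule inj_on_image_Int[OF inj_prop])

lemma disjoint_opens_topspace: "v \<in> disjoint_opens X \<Longrightarrow> v i \<subseteq> topspace X"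
  by (simp add: disjoint_opens_def openin_subset)

lemma move_closed:
  assumes "g \<in> carrier G" "v \<in> disjoint_opens X"
  shows "move g v \<in> disjoint_opens X"
proof -
  have "open_map X X (\<phi> g)"
    using acts assms(1) by (simp add: acts_by_homeomorphisms_def homeomorphic_imp_open_map)
  moreover have "\<phi> g ` v i \<inter> \<phi> g ` v j = {}" if "i \<noteq> j" for i j
    using image_Int[OF assms(1) disjoint_opens_topspace[OF assms(2)] disjoint_opens_topspace[OF assms(2)], of i j]
      assms(2) that by (simp add: disjoint_opens_def)
  ultimately show ?thesis
    using assms(2) by (auto simp: disjoint_opens_def move_def open_map_def)
qed

lemma move_mult:
  assumes "g \<in> carrier G" "h \<in> carrier G" "v \<in> disjoint_opens X"
  shows "move (g \<otimes> h) v = move g (move h v)"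
proof
  fix i
  have "\<phi> (g \<otimes> h) x = \<phi> g (\<phi> h x)" if "x \<in> v i" for x
    using composition_rule[of x g h] disjoint_opens_topspace[OF assms(3)] that assms by blast
  then show "move (g \<otimes> h) v i = move g (move h v) i"
    by (simp add: move_def image_image)
qed

lemma refine_move:
  assumes g: "g \<in> carrier G" and W: "W \<subseteq> topspace X" and v: "v \<in> disjoint_opens X"
  shows "refine (\<phi> g ` W) (move g v) = \<phi> g ` refine W v"
proof -
  have "\<phi> g ` W \<inter> move g v i = \<phi> g ` (W \<inter> v i)" for i
    using image_Int[OF g W disjoint_opens_topspace[OF v]] by (simp add: move_def)
  then show ?thesis by (simp add: refine_def)
qed

lemma cell_move:
  assumes g: "g \<in> carrier G" and \<sigma>: "\<sigma> \<noteq> []" "set \<sigma> \<subseteq> disjoint_opens X"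
  shows "cell (map (move g) \<sigma>) j = \<phi> g ` cell \<sigma> j"
proof -
  have fold: "foldl refine (\<phi> g ` W) (map (move g) \<tau>) = \<phi> g ` foldl refine W \<tau>"
    if "W \<subseteq> topspace X" "set \<tau> \<subseteq> disjoint_opens X" for W \<tau>
    using that
  proof (induction \<tau> arbitrary: W)
    case (Cons v \<tau>)
    then show ?case using refine_subset[of W v] by (simp add: refine_move[OF g])
  qed simp
  obtain u \<tau> where eq: "\<sigma> = u # \<tau>" using \<sigma>(1) by (cases \<sigma>) auto
  then show ?thesis
    using fold[of "u j" \<tau>] \<sigma> disjoint_opens_topspace by (simp add: cell_def move_def)
qed

text \<open>Cells are built from \<open>hd\<close>, which is unspecified on the empty tuple; the
  value \<open>{}\<close> makes the requirements on elements of \<open>\<Lambda>\<close> vacuous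
  there.\<close>

definition \<Lambda> :: "(nat \<Rightarrow> 'x set) list \<Rightarrow> nat \<Rightarrow> 'a set" where
  "\<Lambda> \<sigma> j = (if \<sigma> = [] then {} else \<Delta> (cell \<sigma> j))"

lemma \<Lambda>_in_carrier: "set \<sigma> \<subseteq> disjoint_opens X \<Longrightarrow> l \<in> \<Lambda> \<sigma> j \<Longrightarrow> l \<in> carrier G"
  using \<Delta>_carrier cell_open(1)[of \<sigma> X j] by (auto simp: \<Lambda>_def split: if_splits)

lemma \<Lambda>_move:
  assumes "set \<sigma> \<subseteq> disjoint_opens X" "g \<in> carrier G" "l \<in> \<Lambda> \<sigma> j"
  shows "inv g \<otimes> l \<otimes> g \<in> \<Lambda> (map (move (inv g)) \<sigma>) j"
proof -
  have \<sigma>: "\<sigma> \<noteq> []" and l: "l \<in> \<Delta> (cell \<sigma> j)" using assms(3) by (auto simp: \<Lambda>_def split: if_splits)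
  show ?thesis
    using \<Delta>_conj[OF cell_open(1)[OF \<sigma> assms(1)] inv_closed[OF assms(2)] l] assms(2) \<sigma>
    by (simp add: \<Lambda>_def cell_move[OF inv_closed[OF assms(2)] \<sigma> assms(1)])
qed

text \<open>This is the purpose of the cutting: a cell lies inside or outside each entry of each
  sequence in \<open>\<sigma>\<close>, so an element supported in the cell preserves all these
  entries as sets.\<close>

lemma \<Lambda>_fixes:
  assumes "set \<sigma> \<subseteq> disjoint_opens X" "l \<in> \<Lambda> \<sigma> j"
  shows "map (move (inv l)) \<sigma> = \<sigma>"
proof (rule map_idI)
  fix v assume v: "v \<in> set \<sigma>"
  have \<sigma>: "\<sigma> \<noteq> []" and l: "l \<in> \<Delta> (cell \<sigma> j)" using assms(2) by (auto simp: \<Lambda>_def split: if_splits)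
  note op = cell_open(1)[OF \<sigma> assms(1)]
  have "inv l \<in> \<Delta> (cell \<sigma> j)" by (rule subgroup.m_inv_closed[OF \<Delta>_subgroup[OF op] l])
  moreover have "v i \<subseteq> topspace X" for i using disjoint_opens_topspace assms(1) v by blast
  ultimately have "\<phi> (inv l) ` v i = v i" for i
    by (intro \<Delta>_preserves[OF op _ _ cell_dichotomy[OF assms(1) v]])
  then show "move (inv l) v = v" by (simp add: move_def)
qed

lemma \<Lambda>_commutes:
  assumes "set \<sigma> \<subseteq> disjoint_opens X" "l \<in> \<Lambda> \<sigma> i" "l' \<in> \<Lambda> \<sigma> j" "i \<noteq> j"
  shows "l \<otimes> l' = l' \<otimes> l"
proof -
  have \<sigma>: "\<sigma> \<noteq> []" and l: "l \<in> \<Delta> (cell \<sigma> i)" "l' \<in> \<Delta> (cell \<sigma> j)"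
    using assms(2,3) by (auto simp: \<Lambda>_def split: if_splits)
  show ?thesis
    by (rule \<Delta>_commute[OF cell_open(1)[OF \<sigma> assms(1)] cell_open(1)[OF \<sigma> assms(1)] cell_disjoint[OF \<sigma> assms(1,4)] l])
qed

lemma invisible:
  assumes "topspace X \<noteq> {}" "perfect_topology X" "Hausdorff_space X"
    and nonam: "\<And>U. openin X U \<Longrightarrow> U \<noteq> {} \<Longrightarrow> \<not> amenable (G\<lparr>carrier := \<Delta> U\<rparr>)"
  shows "ell2_invisible G"
proof -
  let ?N = "group_von_Neumann_algebra G" and ?R = "right_translation G"
  obtain s0 where s0: "s0 \<in> disjoint_opens X"
    using disjoint_opens_nonempty[OF assms(1-3)] by blast
  have "\<exists>S B. S \<subseteq> \<Lambda> \<sigma> j \<and> B \<in> ?N \<and> (\<forall>m\<in>?N. (\<Sum>s\<in>S. ((- (m \<circ> B)) \<circ> ?R s) - (- (m \<circ> B))) = m) \<and>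
      (\<forall>g\<in>carrier G. (\<forall>s\<in>\<Lambda> \<sigma> j. s \<otimes> g = g \<otimes> s) \<longrightarrow> B \<circ> ?R g = ?R g \<circ> B)"
    if \<sigma>: "\<sigma> \<noteq> []" "set \<sigma> \<subseteq> disjoint_opens X" for \<sigma> j
  proof -
    have eq: "\<Lambda> \<sigma> j = \<Delta> (cell \<sigma> j)" using \<sigma> by (simp add: \<Lambda>_def)
    have sub: "subgroup (\<Lambda> \<sigma> j) G" and na: "\<not> amenable (G\<lparr>carrier := \<Lambda> \<sigma> j\<rparr>)"
      unfolding eq using \<Delta>_subgroup nonam cell_open[OF \<sigma>] by auto
    show ?thesis
    proof (rule nonamenable_inverse[OF sub na])
      fix S B
      assume "S \<subseteq> \<Lambda> \<sigma> j" "B \<in> ?N"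
        and "\<And>m. m \<in> ?N \<Longrightarrow> (\<Sum>s\<in>S. ((- (m \<circ> B)) \<circ> ?R s) - (- (m \<circ> B))) = m"
        and "\<And>g. g \<in> carrier G \<Longrightarrow> (\<And>s. s \<in> \<Lambda> \<sigma> j \<Longrightarrow> s \<otimes> g = g \<otimes> s) \<Longrightarrow> B \<circ> ?R g = ?R g \<circ> B"
      then show ?thesis
        by (intro exI[of _ S] exI[of _ B] conjI ballI impI) simp_all
    qed
  qed
  \<comment> \<open>\<open>S\<close> and \<open>B\<close> are chosen for each
    \<open>\<sigma>\<close> and \<open>j\<close> separately, with no relation between different
    choices.\<close>
  then obtain S B where SB: "\<And>\<sigma> j. \<sigma> \<noteq> [] \<Longrightarrow> set \<sigma> \<subseteq> disjoint_opens X \<Longrightarrow>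
      S \<sigma> j \<subseteq> \<Lambda> \<sigma> j \<and> B \<sigma> j \<in> ?N \<and>
      (\<forall>m\<in>?N. (\<Sum>s\<in>S \<sigma> j. ((- (m \<circ> B \<sigma> j)) \<circ> ?R s) - (- (m \<circ> B \<sigma> j))) = m) \<and>
      (\<forall>g\<in>carrier G. (\<forall>s\<in>\<Lambda> \<sigma> j. s \<otimes> g = g \<otimes> s) \<longrightarrow> B \<sigma> j \<circ> ?R g = ?R g \<circ> B \<sigma> j)"
    by metis
  interpret twisted_bar_complex G "\<lambda>T g. T \<circ> ?R g" ?N "disjoint_opens X" move s0 \<Lambda> S "\<lambda>\<sigma> j m. - (m \<circ> B \<sigma> j)"
  proof
    show "(m \<circ> ?R g) \<circ> ?R h = m \<circ> ?R (g \<otimes> h)" if "g \<in> carrier G" "h \<in> carrier G"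
      for g h and m :: "('a \<Rightarrow> complex) \<Rightarrow> 'a \<Rightarrow> complex"
      unfolding comp_assoc right_translation_mult[OF that] ..
    show "- (m \<circ> B \<sigma> j) \<in> ?N" if "\<sigma> \<noteq> []" "set \<sigma> \<subseteq> disjoint_opens X" "m \<in> ?N" for \<sigma> j m
      using vN_diff[OF vN_zero_mem vN_comp[OF that(3)]] SB[OF that(1,2)] by fastforce
    show "- ((m \<circ> ?R l) \<circ> B \<sigma> j) = (- (m \<circ> B \<sigma> j)) \<circ> ?R l"
      if "\<sigma> \<noteq> []" "set \<sigma> \<subseteq> disjoint_opens X" "m \<in> ?N" "l \<in> \<Lambda> \<sigma> i" "i \<noteq> j" for \<sigma> i j m l
    proof -
      \<comment> \<open>Elements of different cells commute, so \<open>l\<close> centralises the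
        subgroup of cell \<open>j\<close>, and \<open>B \<sigma> j\<close> commutes with translation
        by \<open>l\<close>.\<close>
      have "\<forall>s\<in>\<Lambda> \<sigma> j. s \<otimes> l = l \<otimes> s"
        using \<Lambda>_commutes[OF that(2) _ that(4)] that(5) by metis
      then have comm: "B \<sigma> j \<circ> ?R l = ?R l \<circ> B \<sigma> j"
        using SB[OF that(1,2)] \<Lambda>_in_carrier[OF that(2,4)] by blast
      have "B \<sigma> j (?R l f) = ?R l (B \<sigma> j f)" for f
        using fun_cong[OF comm, of f] by simp
      then show ?thesis by (intro ext) simp
    qed
  qed (use SB in \<open>auto simp: s0 vN_zero_mem vN_diff vN_comp right_translation_vN move_closed move_mult
      \<Lambda>_in_carrier \<Lambda>_move \<Lambda>_fixes \<Lambda>_commutes fun_eq_iff\<close>)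
  show ?thesis
    unfolding ell2_invisible_def using trivial_group_homology by blast
qed

end

theorem theorem7p13:
  fixes G :: "('g, 'b) monoid_scheme"
    and X :: "'x topology"
    and \<phi> :: "'g \<Rightarrow> 'x \<Rightarrow> 'x"
    and \<Delta> :: "'x set \<Rightarrow> 'g set"
  assumes "group G"
    and "topspace X \<noteq> {}"
    and "perfect_topology X"
    and "Hausdorff_space X"
    and "acts_by_homeomorphisms G X \<phi>"
    and "deferment_system G X \<phi> \<Delta>"
    and "\<And>U. openin X U \<Longrightarrow> U \<noteq> {} \<Longrightarrow> \<not> amenable (G\<lparr>carrier := \<Delta> U\<rparr>)"
  shows "ell2_invisible G"
proof -
  interpret deferment G X \<phi> \<Delta>
    using assms(1,5,6) by (simp add: deferment_def deferment_axioms_def)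
  show ?thesis by (rule invisible) (use assms in auto)
qed

end
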